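(* Let $\epsilon>0$, $\rho,\delta\in(0,1)$, $C_g=1+\sqrt{2\rho/n}$, $\Omega\ge 1$, $w(\Omega)=3\sqrt{\Omega}$, and let $T$ be a positive integer. Let $\mathcal{P}^i=\mathcal{P}_{\delta,n,\rho}$ for every $i\in[m]$. Let $\{x_t,p_t\}_{t=1}^T$ be generated by the alternating scheme in which $x_{t+1}$ is computed by the $\epsilon$-SMD update with per-iteration sample size $K$ and step size $\alpha_{x,t}=c_x/\sqrt t$, $c_x=\frac{1}{C_g G}\sqrt{D_x/\Omega}$, and each $p_{t+1}^i$ is computed by the Bandit Mirror Descent update with step size $\alpha_{p,t}^i=c_p^i/\sqrt t$, $c_p^i=\frac{2\delta}{C_g M^i n^2}\sqrt{\rho/\Omega}$ (both updates defined in the context). Let $\theta\in\Delta_T$ be the normalization of $\{\alpha_{x,t}\}_{t=1}^T$ (equivalently of $\{\alpha_{p,t}^i\}_{t=1}^T$), i.e. $\theta_t=t^{-1/2}/\sum_{s=1}^T s^{-1/2}$. Suppose that $K$ satisfies the approximation condition with parameters $C_K\in(0,\frac12)$ and $\nu_1\in(0,1)$: with probability at least $1-\nu_1$, $$|\hat f_t^i(x)-f_t^i(x)|\le\frac{C_K\epsilon}{2}\qquad\forall x\in X,\ i\in[m],\ t\in[T].$$ Let $$\mathcal{R}_x(T)=\frac{C_g\cdot G\cdot\ln(T)\cdot\sqrt{2D_x}}{\sqrt T},\qquad \mathcal{R}_p^i(T)=\frac{2C_g\cdot M^i\cdot\ln(T)\cdot\sqrt{2\rho}}{\delta\sqrt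 T}\quad\forall i\in[m].$$ Then $$\mathbb{P}\Big\{\epsilon^{\bullet}+\epsilon^{\circ}\le w(\Omega)\Big(\mathcal{R}_x(T)+\max_{i\in[m]}\mathcal{R}_p^i(T)\Big)+C_K\epsilon\Big\}\ge 1-4m\exp(-\Omega)-\nu_1.$$
   Context: Setting: $[m]=\{1,\dots,m\}$; $\Delta_T$ is the standard unit simplex in $\mathbb{R}^T$. $X\subseteq\mathbb{R}^d$ is closed and convex. For each $i\in[m]$, $F_r^i:X\to\mathbb{R}$, $r\in[n]$, are convex, $G$-Lipschitz with respect to $\|\cdot\|$ (below), and $|F_r^i(x)|\le M^i$ for all $x\in X$, where $M^i>0$; $\mathbf{F}^i(x)=(F_1^i(x),\dots,F_n^i(x))$. Ambiguity set: $\mathcal{P}_{\delta,n,\rho}=\{p\in\mathbb{R}^n: p\ge\frac{\delta}{n}\mathbb{1}_n,\ D_{\chi^2}(p\|\frac{\mathbb{1}_n}{n})\le\frac{\rho}{n}\}$, where $D_{\chi^2}(p\|q)=\sum_{r=1}^n\frac{q^{(r)}}{2}\big(\frac{p^{(r)}}{q^{(r)}}-1\big)^2$ and $\mathbb{1}_n$ is the all-ones vector (no constraint $\mathbb{1}_n^\top p=1$ is imposed). $\mathcal{P}=\mathcal{P}^1\times\cdots\times\mathcal{P}^m$, $\phi(x,p)=\max_{i\in[m]}(p^i)^\top\mathbf{F}^i(x)$, $f_t^i(x)=(p_t^i)^\top\mathbf{F}^i(x)$. Error terms: $$\epsilon^{\bullet}=\sum_{t=1}^T\theta_t\phi(x_t,p_t)-\inf_{x\in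 X}\sum_{t=1}^T\theta_t\phi(x,p_t),$$ $$\epsilon^{i}=\sup_{p^i\in\mathcal{P}^i}\sum_{t=1}^T\theta_t(p^i)^\top\mathbf{F}^i(x_t)-\sum_{t=1}^T\theta_t(p_t^i)^\top\mathbf{F}^i(x_t),\qquad\epsilon^{\circ}=\max_{i\in[m]}\epsilon^i.$$ Mirror descent setup: $\psi_x:X\to\mathbb{R}$ is differentiable and 1-strongly convex with respect to a norm $\|\cdot\|$; $B_{\psi_x}(x,y)=\psi_x(x)-\psi_x(y)-\nabla\psi_x(y)^\top(x-y)$; $D_x=\max_{x,y\in X}B_{\psi_x}(x,y)<\infty$. Scheme: start from $x_1\in X$, $p_1\in\mathcal{P}$; at each $t$, given $(x_t,p_t)$, compute $p_{t+1}^i$ for all $i$ and $x_{t+1}$ as follows, using fresh random samples. $\epsilon$-SMD update (with normalization): for each $i$ draw i.i.d. indices $s_1,\dots,s_K\in[n]$ from $p_t^i/(\mathbb{1}_n^\top p_t^i)$ and set $\hat f_t^i(x)=\frac{\mathbb{1}_n^\top p_t^i}{K}\sum_{k=1}^K F_{s_k}^i(x)$; take $\hat i_t\in\operatorname{argmax}_i\hat f_t^i(x_t)$; sample $I_{x,t}$ from $p_t^{\hat i_t}/(\mathbb{1}_n^\top p_t^{\hat i_t})$; take $g_{x,t}\in\partial\big((\mathbb{1}_n^\top p_t^{\hat i_t})F_{I_{x,t}}^{\hat i_t}\big)(x_t)$; set $x_{t+1}=\operatorname{argmin}_{x\in X}\{g_{x,t}^\top(x-x_t)+\frac1{\alpha_{x,t}}B_{\psi_x}(x,x_t)\}$.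 Bandit Mirror Descent update: sample $I_{p,t}^i$ from $p_t^i/(\mathbb{1}_n^\top p_t^i)$; define $g_{p,t}^i\in\mathbb{R}^n$ by $g_{p,t}^{i,(r)}=\frac{(\mathbb{1}_n^\top p_t^i)F_r^i(x_t)}{p_t^{i,(r)}}$ if $r=I_{p,t}^i$ and $0$ otherwise; set $w_{t+1}^i=p_t^i+\alpha_{p,t}^i g_{p,t}^i$ and let $p_{t+1}^i$ be the Euclidean projection of $w_{t+1}^i$ onto $\mathcal{P}_{\delta,n,\rho}$.
   Formalization: Formalized for T ≥ 2 (at T = 1, ln T = 0 makes the claim false), and the chosen subgradient is required to have dual norm at most (1ᵀp)G, since unbounded normal-cone subgradients at boundary points of X make the claim false. *)

theory Defs
  imports "HOL-Probability.Probability"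
begin

(* Conventions: [n] and [m] are the index types 'n and 'm, so n = CARD('n), m = CARD('m);
   a loss F i r :: real^'d => real is only ever used on the set X;
   p = (p^1,...,p^m) is a function 'm => real^'n. *)

definition is_norm :: "('a::real_vector \<Rightarrow> real) \<Rightarrow> bool" where
  "is_norm N \<longleftrightarrow>
     (\<forall>x. 0 \<le> N x) \<and> (\<forall>x. N x = 0 \<longleftrightarrow> x = 0) \<and>
     (\<forall>a x. N (a *\<^sub>R x) = \<bar>a\<bar> * N x) \<and> (\<forall>x y. N (x + y) \<le> N x + N y)"

definition lipschitz_wrt :: "('a::real_vector \<Rightarrow> real) \<Rightarrow> real \<Rightarrow> 'a set \<Rightarrow> ('a \<Rightarrow> real) \<Rightarrow> bool" where
  "lipschitz_wrt N L X f \<longleftrightarrow> (\<forall>x\<in>X. \<forall>y\<in>X. \<bar>f x - f y\<bar> \<le> L * N (x - y))"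

definition strongly_convex_wrt :: "('a::real_vector \<Rightarrow> real) \<Rightarrow> real \<Rightarrow> 'a set \<Rightarrow> ('a \<Rightarrow> real) \<Rightarrow> bool" where
  "strongly_convex_wrt N \<mu> X \<psi> \<longleftrightarrow>
     (\<forall>x\<in>X. \<forall>y\<in>X. \<forall>u\<in>{0..1}.
        \<psi> (u *\<^sub>R x + (1 - u) *\<^sub>R y)
          \<le> u * \<psi> x + (1 - u) * \<psi> y - \<mu> / 2 * u * (1 - u) * (N (x - y))\<^sup>2)"

definition bregman :: "('a::real_inner \<Rightarrow> real) \<Rightarrow> ('a \<Rightarrow> 'a) \<Rightarrow> 'a \<Rightarrow> 'a \<Rightarrow> real" where
  "bregman \<psi> grad\<psi> x y = \<psi> x - \<psi> y - grad\<psi> y \<bullet> (x - y)"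

definition subdifferential_on :: "'a::real_inner set \<Rightarrow> ('a \<Rightarrow> real) \<Rightarrow> 'a \<Rightarrow> 'a set" where
  "subdifferential_on X f x = {g. \<forall>y\<in>X. f y \<ge> f x + g \<bullet> (y - x)}"

(* The dual norm of g is at most L. *)
definition dual_norm_le :: "('a::real_inner \<Rightarrow> real) \<Rightarrow> 'a \<Rightarrow> real \<Rightarrow> bool" where
  "dual_norm_le N g L \<longleftrightarrow> (\<forall>h. g \<bullet> h \<le> L * N h)"

definition chi2_div :: "real^'n::finite \<Rightarrow> real^'n \<Rightarrow> real" where
  "chi2_div p q = (\<Sum>r\<in>UNIV. q $ r / 2 * (p $ r / q $ r - 1)\<^sup>2)"

(* Elements need not sum to 1. *)
definition ambiguity_set :: "real \<Rightarrow> real \<Rightarrow> (real^'n::finite) set" where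
  "ambiguity_set \<delta> \<rho> =
     {p. (\<forall>r. p $ r \<ge> \<delta> / real CARD('n)) \<and>
         chi2_div p (\<chi> r. 1 / real CARD('n)) \<le> \<rho> / real CARD('n)}"

definition total_mass :: "real^'n::finite \<Rightarrow> real" where
  "total_mass p = (\<Sum>r\<in>UNIV. p $ r)"

definition normalized_weight :: "real^'n::finite \<Rightarrow> 'n \<Rightarrow> real" where
  "normalized_weight p r = p $ r / total_mass p"

definition Fvec :: "('m \<Rightarrow> 'n::finite \<Rightarrow> 'a \<Rightarrow> real) \<Rightarrow> 'm \<Rightarrow> 'a \<Rightarrow> real^'n" where
  "Fvec F i x = (\<chi> r. F i r x)"

definition phi :: "('m::finite \<Rightarrow> 'n::finite \<Rightarrow> 'a \<Rightarrow> real) \<Rightarrow> 'a \<Rightarrow> ('m \<Rightarrow> real^'n) \<Rightarrow> real" where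
  "phi F x p = (MAX i. p i \<bullet> Fvec F i x)"

definition theta :: "nat \<Rightarrow> nat \<Rightarrow> real" where
  "theta T t = real t powr (- 1/2) / (\<Sum>s=1..T. real s powr (- 1/2))"

definition eps_bullet ::
  "'a set \<Rightarrow> ('m::finite \<Rightarrow> 'n::finite \<Rightarrow> 'a \<Rightarrow> real) \<Rightarrow> nat \<Rightarrow> (nat \<Rightarrow> 'a) \<Rightarrow> (nat \<Rightarrow> 'm \<Rightarrow> real^'n) \<Rightarrow> real"
  where
  "eps_bullet X F T xs ps =
     (\<Sum>t=1..T. theta T t * phi F (xs t) (ps t)) -
     (INF x\<in>X. \<Sum>t=1..T. theta T t * phi F x (ps t))"

definition eps_i ::
  "(real^'n) set \<Rightarrow> ('m \<Rightarrow> 'n::finite \<Rightarrow> 'a \<Rightarrow> real) \<Rightarrow> nat \<Rightarrow> (nat \<Rightarrow> 'a) \<Rightarrow> (nat \<Rightarrow> 'm \<Rightarrow> real^'n) \<Rightarrow> 'm \<Rightarrow> real"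
  where
  "eps_i P F T xs ps i =
     (SUP q\<in>P. \<Sum>t=1..T. theta T t * (q \<bullet> Fvec F i (xs t))) -
     (\<Sum>t=1..T. theta T t * (ps t i \<bullet> Fvec F i (xs t)))"

definition eps_circ ::
  "(real^'n) set \<Rightarrow> ('m::finite \<Rightarrow> 'n::finite \<Rightarrow> 'a \<Rightarrow> real) \<Rightarrow> nat \<Rightarrow> (nat \<Rightarrow> 'a) \<Rightarrow> (nat \<Rightarrow> 'm \<Rightarrow> real^'n) \<Rightarrow> real"
  where
  "eps_circ P F T xs ps = (MAX i. eps_i P F T xs ps i)"

definition fhat ::
  "('m \<Rightarrow> 'n::finite \<Rightarrow> 'a \<Rightarrow> real) \<Rightarrow> nat \<Rightarrow> ('m \<Rightarrow> real^'n) \<Rightarrow> ('m \<Rightarrow> nat \<Rightarrow> 'n) \<Rightarrow> 'm \<Rightarrow> 'a \<Rightarrow> real"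
  where
  "fhat F K p s i x = total_mass (p i) / real K * (\<Sum>k=1..K. F i (s i k) x)"

definition bandit_grad ::
  "('m \<Rightarrow> 'n::finite \<Rightarrow> 'a \<Rightarrow> real) \<Rightarrow> 'a \<Rightarrow> ('m \<Rightarrow> real^'n) \<Rightarrow> 'm \<Rightarrow> 'n \<Rightarrow> real^'n" where
  "bandit_grad F x p i I = (\<chi> r. if r = I then total_mass (p i) * F i r x / p i $ r else 0)"

definition cond_prob_given ::
  "'w measure \<Rightarrow> 'w measure \<Rightarrow> ('w \<Rightarrow> bool) \<Rightarrow> ('w \<Rightarrow> real) \<Rightarrow> bool" where
  "cond_prob_given M A E q \<longleftrightarrow>
     (AE \<omega> in M. real_cond_exp M A (indicator {\<omega> \<in> space M. E \<omega>}) \<omega> = q \<omega>)"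

(* One step uses the chain of sigma-algebras H t <= H' t <= H (Suc t) : H t is the history that
   determines (x_t, p_t); H' t also contains the estimation samples S t, the bandit samples Ip t
   and the index ihat t; the sample Ix t is drawn afterwards.  "Fresh" means that the samples are,
   conditionally on what precedes them, distributed as prescribed and mutually independent.
   Ties in the argmax and the choice of subgradient are arbitrary, and may be random. *)

definition history_chain ::
  "'w measure \<Rightarrow> nat \<Rightarrow> (nat \<Rightarrow> 'w measure) \<Rightarrow> (nat \<Rightarrow> 'w measure) \<Rightarrow> bool" where
  "history_chain M T H H' \<longleftrightarrow>
     (\<forall>t\<in>{1..T}. subalgebra (H' t) (H t) \<and> subalgebra (H (Suc t)) (H' t) \<and> subalgebra M (H (Suc t)))"

definition starts_in ::
  "'w measure \<Rightarrow> 'w measure \<Rightarrow> (real^'d::finite) set \<Rightarrow> (real^'n::finite) set \<Rightarrow>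
   ('w \<Rightarrow> real^'d) \<Rightarrow> ('w \<Rightarrow> 'm \<Rightarrow> real^'n) \<Rightarrow> bool" where
  "starts_in M H1 X P x1 p1 \<longleftrightarrow>
     x1 \<in> borel_measurable H1 \<and> (\<forall>i. (\<lambda>\<omega>. p1 \<omega> i) \<in> borel_measurable H1) \<and>
     (\<forall>\<omega>\<in>space M. x1 \<omega> \<in> X \<and> (\<forall>i. p1 \<omega> i \<in> P))"

definition samples_fresh ::
  "'w measure \<Rightarrow> nat \<Rightarrow> 'w measure \<Rightarrow> 'w measure \<Rightarrow> 'w measure \<Rightarrow> ('w \<Rightarrow> 'm::finite \<Rightarrow> real^'n::finite) \<Rightarrow>
   ('w \<Rightarrow> 'm \<Rightarrow> nat \<Rightarrow> 'n) \<Rightarrow> ('w \<Rightarrow> 'm \<Rightarrow> 'n) \<Rightarrow> ('w \<Rightarrow> 'm) \<Rightarrow> ('w \<Rightarrow> 'n) \<Rightarrow> bool" where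
  "samples_fresh M K Ht Ht' Hnext p S Ip ihat Ix \<longleftrightarrow>
     (\<forall>i. \<forall>k\<in>{1..K}. (\<lambda>\<omega>. S \<omega> i k) \<in> measurable Ht' (count_space UNIV)) \<and>
     (\<forall>i. (\<lambda>\<omega>. Ip \<omega> i) \<in> measurable Ht' (count_space UNIV)) \<and>
     ihat \<in> measurable Ht' (count_space UNIV) \<and>
     Ix \<in> measurable Hnext (count_space UNIV) \<and>
     (\<forall>s u. cond_prob_given M Ht
        (\<lambda>\<omega>. (\<forall>i. \<forall>k\<in>{1..K}. S \<omega> i k = s i k) \<and> (\<forall>i. Ip \<omega> i = u i))
        (\<lambda>\<omega>. (\<Prod>i\<in>UNIV. \<Prod>k=1..K. normalized_weight (p \<omega> i) (s i k)) *
              (\<Prod>i\<in>UNIV. normalized_weight (p \<omega> i) (u i)))) \<and>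
     (\<forall>r. cond_prob_given M Ht' (\<lambda>\<omega>. Ix \<omega> = r)
        (\<lambda>\<omega>. normalized_weight (p \<omega> (ihat \<omega>)) r))"

definition eps_SMD_update ::
  "(real^'d::finite) set \<Rightarrow> (real^'d \<Rightarrow> real) \<Rightarrow> real \<Rightarrow> ('m::finite \<Rightarrow> 'n::finite \<Rightarrow> real^'d \<Rightarrow> real) \<Rightarrow>
   (real^'d \<Rightarrow> real) \<Rightarrow> (real^'d \<Rightarrow> real^'d) \<Rightarrow> nat \<Rightarrow> real \<Rightarrow>
   real^'d \<Rightarrow> ('m \<Rightarrow> real^'n) \<Rightarrow> ('m \<Rightarrow> nat \<Rightarrow> 'n) \<Rightarrow> 'm \<Rightarrow> 'n \<Rightarrow> real^'d \<Rightarrow> real^'d \<Rightarrow> bool" where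
  "eps_SMD_update X N G F \<psi> grad\<psi> K \<alpha> x p S ihat Ix g xnext \<longleftrightarrow>
     is_arg_max (\<lambda>i. fhat F K p S i x) (\<lambda>i. True) ihat \<and>
     g \<in> subdifferential_on X (\<lambda>y. total_mass (p ihat) * F ihat Ix y) x \<and>
     \<comment> \<open>The function above is (total mass * G)-Lipschitz and its subgradients are bounded
        accordingly.  This excludes only the unbounded normal-cone part that the subdifferential
        relative to X acquires at boundary points of X.\<close>
     dual_norm_le N g (total_mass (p ihat) * G) \<and>
     is_arg_min (\<lambda>y. g \<bullet> (y - x) + 1 / \<alpha> * bregman \<psi> grad\<psi> y x) (\<lambda>y. y \<in> X) xnext"

definition bandit_MD_update ::
  "(real^'n::finite) set \<Rightarrow> ('m \<Rightarrow> 'n \<Rightarrow> 'a \<Rightarrow> real) \<Rightarrow> ('m \<Rightarrow> real) \<Rightarrow>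
   'a \<Rightarrow> ('m \<Rightarrow> real^'n) \<Rightarrow> ('m \<Rightarrow> 'n) \<Rightarrow> ('m \<Rightarrow> real^'n) \<Rightarrow> bool" where
  "bandit_MD_update P F \<alpha> x p Ip pnext \<longleftrightarrow>
     (\<forall>i. pnext i = closest_point P (p i + \<alpha> i *\<^sub>R bandit_grad F x p i (Ip i)))"

end

theory Submission
  imports Defs
begin

text \<open>
Both error terms are regrets of a stochastic mirror descent whose step sizes are the optimal constant over
\<open>sqrt t\<close>. The player \<open>x\<close> runs it on \<open>X\<close> with the Bregman divergence of \<open>\<psi>\<close>, Lipschitz bound
\<open>C\<^sub>g * G\<close> and Bregman diameter \<open>D\<^sub>x\<close>. Each player \<open>p i\<close> runs it on the ambiguity set with half the squared
Euclidean norm, for which the proximal step is the projection, Lipschitz bound \<open>C\<^sub>g * Mb i * n / \<delta>\<close> and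
Bregman diameter at most \<open>4 * \<rho> / n\<^sup>2\<close>. With these values the two prescribed step sizes and the two rates are instances of one
formula, so a single theorem about stochastic mirror descent, \<open>linearized_gap_high_probability\<close>, serves
every player.

That theorem bounds \<open>\<Sum>t. theta T t * (gbar t \<bullet> (x t - y))\<close> simultaneously for all comparison points \<open>y\<close>,
where \<open>gbar t\<close> is the conditional mean of the sampled direction \<open>g t\<close>. Writing \<open>\<xi> t = gbar t - g t\<close>, the
weighted sum splits into three parts. The part with \<open>g t\<close> is the deterministic regret of mirror descent. The
part \<open>\<xi> t \<bullet> (x t - y)\<close> is not a martingale difference sum once \<open>y\<close> may depend on the outcome; it is
handled by ghost iterates \<open>v t\<close> that run an online algorithm on the losses \<open>\<xi> t\<close>. Then \<open>\<xi> t \<bullet> (v t - y)\<close>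
has a deterministic regret bound that is uniform in \<open>y\<close>, and \<open>\<xi> t \<bullet> (x t - v t)\<close> is a bounded martingale
difference, for which the Azuma argument gives a Gaussian tail. With deviation level \<open>4 * D * sqrt h\<close>, \<open>h\<close> the
harmonic sum, the failure probability is at most \<open>exp (- \<Omega>)\<close>. The constants fit into
the claimed rate once \<open>T \<ge> 36\<close>; for smaller horizons the rate already exceeds the trivial bound
\<open>L * sqrt (2 * D)\<close> (\<open>step_size_quotient_le\<close> and \<open>sqrt_le_3_ln\<close>).

It remains to relate the gaps to the errors. For a player \<open>p i\<close> the loss is linear and its exact gradient is the
conditional mean of the bandit gradient (\<open>bandit_grad_unbiased\<close>), so \<open>eps_i\<close> is the supremum of the gap over
all comparison points. For the
player \<open>x\<close>, the conditional mean of the sampled subgradient is almost surely a subgradient of the full loss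
with the estimated maximal index (\<open>gbar_subgradient\<close>), and replacing the maximal index by the estimated one costs
the approximation error twice, which is the term \<open>C\<^sub>K * \<epsilon>\<close> (\<open>eps_bullet_le\<close>). A union bound over the
approximation event and the \<open>m + 1\<close> players concludes, since \<open>m + 1 \<le> 4 * m\<close>.

A point of substance rather than routine is measurability: a probability is only controlled if the event is
measurable, and the errors involve an infimum over \<open>X\<close> and suprema over the ambiguity set. These are reduced to
countable dense subsets by continuity (\<open>borel_measurable_SUP_compact\<close>).
\<close>

section \<open>Norms and dual bounds\<close>

lemma is_norm_0: "is_norm N \<Longrightarrow> N 0 = 0"
  by (simp add: is_norm_def)

lemma is_norm_nonneg: "is_norm N \<Longrightarrow> 0 \<le> N v"
  by (simp add: is_norm_def)

lemma is_norm_uminus: "is_norm N \<Longrightarrow> N (- v) = N v"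
  unfolding is_norm_def by (metis abs_minus_cancel abs_one mult_1 scaleR_minus1_left)

lemma is_norm_minus_commute: "is_norm N \<Longrightarrow> N (v - w) = N (w - v)"
  using is_norm_uminus[of N "v - w"] by simp

lemma is_norm_norm: "is_norm (norm :: 'a::real_normed_vector \<Rightarrow> real)"
  by (auto simp: is_norm_def norm_triangle_ineq)

text \<open>
A norm is convex, and convex functions on a finite-dimensional space are continuous.
\<close>

lemma is_norm_continuous:
  fixes N :: "'a::euclidean_space \<Rightarrow> real"
  assumes N: "is_norm N"
  shows "continuous_on UNIV N"
proof (rule convex_on_continuous[OF open_UNIV])
  show "convex_on UNIV N"
  proof (rule convex_onI)
    fix t :: real and v w :: 'a assume "0 < t" "t < 1"
    then show "N ((1 - t) *\<^sub>R v + t *\<^sub>R w) \<le> (1 - t) * N v + t * N w"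
      using N unfolding is_norm_def by (metis abs_of_pos diff_gt_0_iff_gt)
  qed simp
qed

text \<open>
By homogeneity the extreme values of \<open>N\<close> on the Euclidean unit sphere, attained by compactness, are the two constants.
\<close>

lemma is_norm_equivalent:
  fixes N :: "'a::euclidean_space \<Rightarrow> real"
  assumes N: "is_norm N"
  obtains c C where "c > 0" "C > 0" "\<And>v. c * norm v \<le> N v" "\<And>v. N v \<le> C * norm v"
proof -
  let ?S = "sphere (0::'a) 1"
  have ne: "?S \<noteq> {}" by simp
  have cont: "continuous_on ?S N"
    using is_norm_continuous[OF N] continuous_on_subset by blast
  obtain a where a: "a \<in> ?S" "\<And>v. v \<in> ?S \<Longrightarrow> N a \<le> N v"
    using continuous_attains_inf[OF compact_sphere ne cont] by blast
  obtain b where b: "b \<in> ?S" "\<And>v. v \<in> ?S \<Longrightarrow> N v \<le> N b"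
    using continuous_attains_sup[OF compact_sphere ne cont] by blast
  have pos: "N v > 0" if "v \<in> ?S" for v
  proof -
    have "v \<noteq> 0" using that by auto
    then show ?thesis using N unfolding is_norm_def by (metis less_eq_real_def)
  qed
  have scale: "N v = norm v * N (v /\<^sub>R norm v)" for v
  proof (cases "v = 0")
    case False
    have "N (norm v *\<^sub>R (v /\<^sub>R norm v)) = \<bar>norm v\<bar> * N (v /\<^sub>R norm v)"
      using N unfolding is_norm_def by blast
    then show ?thesis using False by simp
  qed (simp add: is_norm_0[OF N])
  have unit: "v /\<^sub>R norm v \<in> ?S" if "v \<noteq> 0" for v
    using that by simp
  have 1: "N a * norm v \<le> N v" for v
  proof (cases "v = 0")
    case False
    have "norm v * N a \<le> norm v * N (v /\<^sub>R norm v)"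
      using a(2)[OF unit[OF False]] by (intro mult_left_mono) auto
    then show ?thesis using scale[of v] by (simp add: mult.commute)
  qed (simp add: is_norm_0[OF N])
  have 2: "N v \<le> N b * norm v" for v
  proof (cases "v = 0")
    case False
    have "norm v * N (v /\<^sub>R norm v) \<le> norm v * N b"
      using b(2)[OF unit[OF False]] by (intro mult_left_mono) auto
    then show ?thesis using scale[of v] by (simp add: mult.commute)
  qed (simp add: is_norm_0[OF N])
  show ?thesis using that[OF pos[OF a(1)] pos[OF b(1)] 1 2] .
qed

lemma dual_norm_le_abs:
  assumes "is_norm N" "dual_norm_le N v L"
  shows "\<bar>v \<bullet> h\<bar> \<le> L * N h"
proof -
  have "v \<bullet> h \<le> L * N h" "v \<bullet> (- h) \<le> L * N (- h)"
    using assms(2) unfolding dual_norm_le_def by blast+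
  then show ?thesis using is_norm_uminus[OF assms(1)] by (simp add: abs_le_iff)
qed

lemma dual_norm_le_diff:
  assumes N: "is_norm N" and v: "dual_norm_le N v L" and w: "dual_norm_le N w K"
  shows "dual_norm_le N (v - w) (L + K)"
  unfolding dual_norm_le_def
proof
  fix h
  show "(v - w) \<bullet> h \<le> (L + K) * N h"
    using dual_norm_le_abs[OF N v, of h] dual_norm_le_abs[OF N w, of h]
    by (simp add: algebra_simps)
qed

lemma dual_norm_le_imp_norm_le:
  fixes N :: "'a::euclidean_space \<Rightarrow> real"
  assumes C: "\<And>v. N v \<le> C * norm v" and "0 \<le> L" and "dual_norm_le N v L" and "0 \<le> C"
  shows "norm v \<le> L * C"
proof (cases "v = 0")
  case False
  have "norm v * norm v = v \<bullet> v" by (simp add: dot_square_norm power2_eq_square)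
  also have "\<dots> \<le> L * N v" using assms(3) unfolding dual_norm_le_def by blast
  also have "\<dots> \<le> L * (C * norm v)" using C assms(2) by (intro mult_left_mono)
  finally show ?thesis using False by (simp flip: mult.assoc)
qed (use assms in simp)

lemma dual_norm_le_norm: "dual_norm_le norm v L" if "norm v \<le> L"
  unfolding dual_norm_le_def
  by (metis mult_right_mono norm_cauchy_schwarz norm_ge_zero order_trans that)

lemma dual_norm_le_mono:
  assumes "is_norm N" "dual_norm_le N v L" "L \<le> L'"
  shows "dual_norm_le N v L'"
  unfolding dual_norm_le_def
proof
  fix h
  have "v \<bullet> h \<le> L * N h" using assms(2) by (simp add: dual_norm_le_def)
  also have "\<dots> \<le> L' * N h" using assms(3) is_norm_nonneg[OF assms(1)] by (rule mult_right_mono)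
  finally show "v \<bullet> h \<le> L' * N h" .
qed

lemma lipschitz_wrt_continuous_on:
  fixes N :: "'a::euclidean_space \<Rightarrow> real"
  assumes N: "is_norm N" and "0 \<le> G" and f: "lipschitz_wrt N G X f"
  shows "continuous_on X f"
proof -
  obtain c C where C: "C > 0" "\<And>v. N v \<le> C * norm v" using is_norm_equivalent[OF N] by metis
  have "(G * C)-lipschitz_on X f"
  proof (rule lipschitz_onI)
    fix y z assume "y \<in> X" "z \<in> X"
    then have "\<bar>f y - f z\<bar> \<le> G * N (y - z)" using f by (simp add: lipschitz_wrt_def)
    also have "\<dots> \<le> G * (C * norm (y - z))" using C(2) assms(2) by (intro mult_left_mono)
    finally show "dist (f y) (f z) \<le> G * C * dist y z" by (simp add: dist_norm)
  qed (use assms(2) C in simp)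
  then show ?thesis by (rule lipschitz_on_continuous_on)
qed

section \<open>Mirror descent and ghost iterates\<close>

text \<open>
The number \<open>D\<close> is any bound on the Bregman diameter of \<open>X\<close>. Together with strong convexity it forces \<open>X\<close> to be
bounded, hence compact. The derivative is taken relative to \<open>X\<close>, so \<open>grad\<close> is determined only on directions
inside \<open>X\<close> and carries no regularity as a function.
\<close>

locale mirror_geometry =
  fixes X :: "'a::euclidean_space set" and N \<psi> :: "'a \<Rightarrow> real" and grad :: "'a \<Rightarrow> 'a" and D :: real
  assumes X_closed: "closed X" and X_convex: "convex X" and X_nonempty: "X \<noteq> {}"
    and N: "is_norm N"
    and deriv: "\<And>y. y \<in> X \<Longrightarrow> (\<psi> has_derivative (\<lambda>h. grad y \<bullet> h)) (at y within X)"
    and strong: "strongly_convex_wrt N 1 X \<psi>"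
    and bregman_le: "\<And>y z. y \<in> X \<Longrightarrow> z \<in> X \<Longrightarrow> bregman \<psi> grad y z \<le> D"
begin

abbreviation B :: "'a \<Rightarrow> 'a \<Rightarrow> real" where "B \<equiv> bregman \<psi> grad"

lemma segment_in: "x + u *\<^sub>R (y - x) \<in> X" if "x \<in> X" "y \<in> X" "0 \<le> u" "u \<le> 1"
proof -
  have "(1 - u) *\<^sub>R x + u *\<^sub>R y \<in> X"
    using X_convex that by (auto simp: convex_alt)
  then show ?thesis by (simp add: algebra_simps)
qed

text \<open>
All that is used of \<open>grad\<close> is this limit along segments of \<open>X\<close>.
\<close>

lemma directional_derivative:
  assumes x: "x \<in> X" and y: "y \<in> X"
  shows "((\<lambda>u. (\<psi> (x + u *\<^sub>R (y - x)) - \<psi> x) / u) \<longlongrightarrow> grad x \<bullet> (y - x)) (at_right 0)"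
proof -
  let ?c = "\<lambda>u::real. x + u *\<^sub>R (y - x)"
  have 1: "(?c has_derivative (\<lambda>h. h *\<^sub>R (y - x))) (at 0 within {0..1})"
    by (auto intro!: derivative_eq_intros)
  have "?c ` {0..1} \<subseteq> X" using segment_in[OF x y] by auto
  then have 2: "(\<psi> has_derivative (\<lambda>h. grad x \<bullet> h)) (at (?c 0) within ?c ` {0..1})"
    using has_derivative_subset[OF deriv[OF x]] by simp
  have "((\<lambda>u. \<psi> (?c u)) has_derivative (\<lambda>h. grad x \<bullet> (h *\<^sub>R (y - x)))) (at 0 within {0..1})"
    using has_derivative_in_compose[OF 1 2] by simp
  then have "((\<lambda>u. \<psi> (?c u)) has_field_derivative (grad x \<bullet> (y - x))) (at 0 within {0..1})"
    by (rule has_derivative_imp_has_field_derivative) simp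
  then have "((\<lambda>u. (\<psi> (?c u) - \<psi> x) / u) \<longlongrightarrow> grad x \<bullet> (y - x)) (at 0 within {0..1})"
    by (simp add: has_field_derivative_iff)
  then show ?thesis by (simp add: at_within_Icc_at_right)
qed

lemma eventually_unit_interval: "\<forall>\<^sub>F u in at_right (0::real). 0 < u \<and> u \<le> 1"
  unfolding eventually_at_right_field by (rule exI[of _ 1]) auto

text \<open>
Strong convexity bounds the difference quotient along the segment; the gap appears on letting the step tend to zero.
\<close>

lemma bregman_ge:
  assumes x: "x \<in> X" and y: "y \<in> X"
  shows "(N (y - x))\<^sup>2 / 2 \<le> B y x"
proof -
  let ?n = "(N (y - x))\<^sup>2"
  have quot: "(\<psi> (x + u *\<^sub>R (y - x)) - \<psi> x) / u \<le> \<psi> y - \<psi> x - 1 / 2 * (1 - u) * ?n"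
    if "0 < u" "u \<le> 1" for u
  proof -
    have "\<psi> (u *\<^sub>R y + (1 - u) *\<^sub>R x) \<le> u * \<psi> y + (1 - u) * \<psi> x - 1 / 2 * u * (1 - u) * ?n"
      using strong x y that unfolding strongly_convex_wrt_def by auto
    moreover have "u *\<^sub>R y + (1 - u) *\<^sub>R x = x + u *\<^sub>R (y - x)" by (simp add: algebra_simps)
    ultimately have "\<psi> (x + u *\<^sub>R (y - x)) - \<psi> x \<le> u * (\<psi> y - \<psi> x - 1 / 2 * (1 - u) * ?n)"
      by (simp add: algebra_simps)
    then show ?thesis using that by (simp add: pos_divide_le_eq mult.commute)
  qed
  have lim: "((\<lambda>u. \<psi> y - \<psi> x - 1 / 2 * (1 - u) * ?n) \<longlongrightarrow> \<psi> y - \<psi> x - 1 / 2 * (1 - 0) * ?n) (at_right 0)"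
    by (intro tendsto_intros)
  have "grad x \<bullet> (y - x) \<le> \<psi> y - \<psi> x - 1 / 2 * (1 - 0) * ?n"
    by (rule tendsto_le[OF _ lim directional_derivative[OF x y]])
       (auto intro!: eventually_mono[OF eventually_unit_interval] quot[simplified])
  then show ?thesis by (simp add: bregman_def)
qed

lemma bregman_nonneg: "x \<in> X \<Longrightarrow> y \<in> X \<Longrightarrow> 0 \<le> B y x"
  using bregman_ge[of x y] by (smt (verit) divide_nonneg_nonneg zero_le_power2)

lemma D_nonneg: "0 \<le> D"
  using X_nonempty bregman_nonneg bregman_le by (meson ex_in_conv order_trans)

lemma N_diam: "N (y - x) \<le> sqrt (2 * D)" if "x \<in> X" "y \<in> X"
  using bregman_ge[OF that] bregman_le[OF that(2,1)] by (intro real_le_rsqrt) linarith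

lemma compact_X: "compact X"
proof -
  obtain c C where c: "c > 0" "\<And>v. c * norm v \<le> N v"
    using is_norm_equivalent[OF N] by metis
  obtain x where x: "x \<in> X" using X_nonempty by blast
  have "norm (y - x) \<le> sqrt (2 * D) / c" if "y \<in> X" for y
    using c(2)[of "y - x"] N_diam[OF x that] c(1) by (simp add: pos_le_divide_eq mult.commute)
  then have "X \<subseteq> cball x (sqrt (2 * D) / c)"
    by (auto simp: dist_norm norm_minus_commute)
  then show ?thesis using X_closed bounded_subset[OF bounded_cball] by (auto simp: compact_eq_bounded_closed)
qed

lemma continuous_psi: "continuous_on X \<psi>"
  using deriv by (auto simp: continuous_on_eq_continuous_within intro: has_derivative_continuous)

lemma first_order_optimality:
  assumes x: "x \<in> X" and min: "\<And>y. y \<in> X \<Longrightarrow> a \<bullet> x + \<psi> x \<le> a \<bullet> y + \<psi> y" and y: "y \<in> X"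
  shows "0 \<le> (a + grad x) \<bullet> (y - x)"
proof -
  have quot: "- (a \<bullet> (y - x)) \<le> (\<psi> (x + u *\<^sub>R (y - x)) - \<psi> x) / u" if "0 < u" "u \<le> 1" for u
  proof -
    have "a \<bullet> x + \<psi> x \<le> a \<bullet> (x + u *\<^sub>R (y - x)) + \<psi> (x + u *\<^sub>R (y - x))"
      using segment_in[OF x y] that by (intro min) auto
    then have "- (a \<bullet> (y - x)) * u \<le> \<psi> (x + u *\<^sub>R (y - x)) - \<psi> x"
      by (simp add: inner_add_right mult.commute)
    then show ?thesis using that by (simp add: pos_le_divide_eq)
  qed
  have "- (a \<bullet> (y - x)) \<le> grad x \<bullet> (y - x)"
    by (rule tendsto_le[OF _ directional_derivative[OF x y] tendsto_const])
       (auto intro!: eventually_mono[OF eventually_unit_interval] quot)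
  then show ?thesis by (simp add: inner_add_left)
qed

text \<open>
Young's inequality: the movement of an iterate is paid for by the quadratic growth that strong convexity supplies.
Both regret bounds below lose exactly this amount in each round.
\<close>

lemma linear_loss_trade_off:
  assumes "dual_norm_le N v L"
  shows "\<alpha> * (v \<bullet> h) - (N h)\<^sup>2 / 2 \<le> \<alpha>\<^sup>2 * L\<^sup>2 / 2"
proof -
  have "\<alpha> * (v \<bullet> h) \<le> \<bar>\<alpha>\<bar> * \<bar>v \<bullet> h\<bar>" by (metis abs_ge_self abs_mult)
  also have "\<dots> \<le> \<bar>\<alpha>\<bar> * (L * N h)"
    using dual_norm_le_abs[OF N assms] by (intro mult_left_mono) auto
  finally have "\<alpha> * (v \<bullet> h) \<le> (\<bar>\<alpha>\<bar> * L) * N h" by simp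
  moreover have "0 \<le> (\<bar>\<alpha>\<bar> * L - N h)\<^sup>2" by simp
  ultimately show ?thesis by (simp add: power2_diff power_mult_distrib)
qed

text \<open>
Optimality of the step gives the three-point inequality with the term \<open>B x' x\<close>, which absorbs the movement
from \<open>x\<close> to \<open>x'\<close>.
\<close>

lemma mirror_step:
  assumes x: "x \<in> X" and y: "y \<in> X" and v: "dual_norm_le N v L" and "\<alpha> > 0"
    and step: "is_arg_min (\<lambda>y. v \<bullet> (y - x) + 1 / \<alpha> * B y x) (\<lambda>y. y \<in> X) x'"
  shows "\<alpha> * (v \<bullet> (x - y)) \<le> B y x - B y x' + \<alpha>\<^sup>2 * L\<^sup>2 / 2"
proof -
  have x': "x' \<in> X" using step by (simp add: is_arg_min_def)
  have opt: "(\<alpha> *\<^sub>R v - grad x) \<bullet> x' + \<psi> x' \<le> (\<alpha> *\<^sub>R v - grad x) \<bullet> z + \<psi> z" if "z \<in> X" for z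
  proof -
    have "v \<bullet> (x' - x) + 1 / \<alpha> * B x' x \<le> v \<bullet> (z - x) + 1 / \<alpha> * B z x"
      using step that by (auto simp: is_arg_min_def not_less)
    then have "\<alpha> * (v \<bullet> (x' - x) + 1 / \<alpha> * B x' x) \<le> \<alpha> * (v \<bullet> (z - x) + 1 / \<alpha> * B z x)"
      using \<open>\<alpha> > 0\<close> by (intro mult_left_mono) auto
    then show ?thesis using \<open>\<alpha> > 0\<close>
      by (simp add: bregman_def inner_diff_left inner_diff_right algebra_simps)
  qed
  have "0 \<le> (\<alpha> *\<^sub>R v - grad x + grad x') \<bullet> (y - x')"
    using first_order_optimality[OF x' opt y] .
  then have "\<alpha> * (v \<bullet> (x' - y)) \<le> B y x - B y x' - B x' x"
    by (simp add: bregman_def inner_diff_left inner_diff_right inner_add_left algebra_simps)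
  moreover have "\<alpha> * (v \<bullet> (x - x')) - (N (x - x'))\<^sup>2 / 2 \<le> \<alpha>\<^sup>2 * L\<^sup>2 / 2"
    by (rule linear_loss_trade_off[OF v])
  moreover have "(N (x - x'))\<^sup>2 / 2 \<le> B x' x"
    using bregman_ge[OF x x'] is_norm_minus_commute[OF N] by metis
  moreover have "\<alpha> * (v \<bullet> (x - y)) = \<alpha> * (v \<bullet> (x' - y)) + \<alpha> * (v \<bullet> (x - x'))"
    by (simp add: inner_diff_right algebra_simps)
  ultimately show ?thesis by linarith
qed

lemma mirror_descent_regret:
  assumes x: "\<And>t. t \<in> {1..T} \<Longrightarrow> x t \<in> X" and y: "y \<in> X"
    and v: "\<And>t. t \<in> {1..T} \<Longrightarrow> dual_norm_le N (v t) L"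
    and \<alpha>: "\<And>t. t \<in> {1..T} \<Longrightarrow> \<alpha> t > 0"
    and step: "\<And>t. t \<in> {1..T} \<Longrightarrow>
      is_arg_min (\<lambda>y. v t \<bullet> (y - x t) + 1 / \<alpha> t * B y (x t)) (\<lambda>y. y \<in> X) (x (Suc t))"
  shows "(\<Sum>t=1..T. \<alpha> t * (v t \<bullet> (x t - y))) \<le> D + L\<^sup>2 / 2 * (\<Sum>t=1..T. (\<alpha> t)\<^sup>2)"
proof (cases "T = 0")
  case True
  then show ?thesis using D_nonneg by simp
next
  case False
  have "(\<Sum>t=1..T. \<alpha> t * (v t \<bullet> (x t - y)))
      \<le> (\<Sum>t=1..T. (B y (x t) - B y (x (Suc t))) + L\<^sup>2 / 2 * (\<alpha> t)\<^sup>2)"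
  proof (rule sum_mono)
    fix t assume t: "t \<in> {1..T}"
    show "\<alpha> t * (v t \<bullet> (x t - y)) \<le> (B y (x t) - B y (x (Suc t))) + L\<^sup>2 / 2 * (\<alpha> t)\<^sup>2"
      using mirror_step[OF x[OF t] y v[OF t] \<alpha>[OF t] step[OF t]] by (simp add: mult.commute)
  qed
  also have "\<dots> = (\<Sum>t=1..T. B y (x t) - B y (x (Suc t))) + L\<^sup>2 / 2 * (\<Sum>t=1..T. (\<alpha> t)\<^sup>2)"
    by (simp only: sum.distrib sum_distrib_left)
  also have "(\<Sum>t=1..T. B y (x t) - B y (x (Suc t))) = B y (x 1) - B y (x (Suc T))"
    using sum_Suc_diff[of 1 T "\<lambda>t. - B y (x t)"] by (simp add: algebra_simps)
  also have "\<dots> \<le> D"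
  proof -
    have "x (Suc T) \<in> X" using step[of T] False by (auto simp: is_arg_min_def)
    then show ?thesis
      using bregman_nonneg[OF _ y, of "x (Suc T)"] bregman_le[OF y x[of 1]] False by simp
  qed
  finally show ?thesis by simp
qed

text \<open>
Follow-the-regularized-leader: the next ghost iterate depends only on the sum \<open>z\<close> of the past losses. Unlike
a mirror descent step, this never evaluates \<open>grad\<close> at a random point, and strong convexity makes the minimizer a
Lipschitz function of \<open>z\<close>. The ghost iterates of a random sequence of losses are therefore measurable.
\<close>

definition ghost :: "'a \<Rightarrow> 'a \<Rightarrow> 'a" where
  "ghost x0 z = (SOME v. v \<in> X \<and> (\<forall>y\<in>X. z \<bullet> v + B v x0 \<le> z \<bullet> y + B y x0))"

lemma ghost_minimizes:
  shows "ghost x0 z \<in> X" and "y \<in> X \<Longrightarrow> z \<bullet> ghost x0 z + B (ghost x0 z) x0 \<le> z \<bullet> y + B y x0"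
proof -
  \<comment> \<open>Compactness of \<open>X\<close> provides the minimizer, so the choice is legitimate.\<close>
  have "continuous_on X (\<lambda>v. z \<bullet> v + B v x0)"
    unfolding bregman_def by (intro continuous_intros continuous_psi)
  then have "\<exists>v\<in>X. \<forall>y\<in>X. z \<bullet> v + B v x0 \<le> z \<bullet> y + B y x0"
    by (rule continuous_attains_inf[OF compact_X X_nonempty])
  then have "\<exists>v. v \<in> X \<and> (\<forall>y\<in>X. z \<bullet> v + B v x0 \<le> z \<bullet> y + B y x0)" by blast
  from someI_ex[OF this] show "ghost x0 z \<in> X"
    and "y \<in> X \<Longrightarrow> z \<bullet> ghost x0 z + B (ghost x0 z) x0 \<le> z \<bullet> y + B y x0"
    unfolding ghost_def by auto
qed

lemma ghost_quadratic_growth: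
  assumes y: "y \<in> X"
  shows "z \<bullet> ghost x0 z + B (ghost x0 z) x0 + (N (y - ghost x0 z))\<^sup>2 / 2 \<le> z \<bullet> y + B y x0"
proof -
  let ?v = "ghost x0 z"
  have v: "?v \<in> X" by (rule ghost_minimizes)
  have "(z - grad x0) \<bullet> ?v + \<psi> ?v \<le> (z - grad x0) \<bullet> w + \<psi> w" if "w \<in> X" for w
    using ghost_minimizes(2)[OF that, of z x0]
    by (simp add: bregman_def inner_diff_left inner_diff_right)
  from first_order_optimality[OF v this y] bregman_ge[OF v y] show ?thesis
    by (simp add: bregman_def inner_diff_left inner_diff_right inner_add_left algebra_simps)
qed

text \<open>
Adding the quadratic growth of the two minimized objectives cancels everything but the linear perturbation.
\<close>

lemma ghost_continuous: "continuous_on UNIV (ghost x0)"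
proof -
  obtain c C where c: "c > 0" "\<And>v. c * norm v \<le> N v"
    using is_norm_equivalent[OF N] by metis
  have lip: "norm (ghost x0 z - ghost x0 w) \<le> norm (z - w) / c\<^sup>2" for z w
  proof -
    let ?v = "ghost x0 z" and ?u = "ghost x0 w"
    have "(N (?u - ?v))\<^sup>2 / 2 + (N (?v - ?u))\<^sup>2 / 2 \<le> (z - w) \<bullet> (?u - ?v)"
      using ghost_quadratic_growth[OF ghost_minimizes(1), of z x0 x0 w]
            ghost_quadratic_growth[OF ghost_minimizes(1), of w x0 x0 z]
      by (simp add: inner_diff_left inner_diff_right)
    then have "(N (?v - ?u))\<^sup>2 \<le> (z - w) \<bullet> (?u - ?v)"
      using is_norm_minus_commute[OF N, of ?u ?v] by simp
    also have "\<dots> \<le> norm (z - w) * norm (?v - ?u)"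
      using norm_cauchy_schwarz[of "z - w" "?u - ?v"] by (simp add: norm_minus_commute)
    finally have "(N (?v - ?u))\<^sup>2 \<le> norm (z - w) * norm (?v - ?u)" .
    moreover have "(c * norm (?v - ?u))\<^sup>2 \<le> (N (?v - ?u))\<^sup>2"
      using c by (intro power_mono) auto
    ultimately have "(c\<^sup>2 * norm (?v - ?u)) * norm (?v - ?u) \<le> norm (z - w) * norm (?v - ?u)"
      by (simp add: power2_eq_square algebra_simps)
    then have "c\<^sup>2 * norm (?v - ?u) \<le> norm (z - w)"
      by (cases "?v = ?u") auto
    then show ?thesis using c(1) by (simp add: pos_le_divide_eq mult.commute)
  qed
  have "(1 / c\<^sup>2)-lipschitz_on UNIV (ghost x0)"
    using lip by (intro lipschitz_onI) (auto simp: dist_norm)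
  then show ?thesis by (rule lipschitz_on_continuous_on)
qed

text \<open>
The minimal value of the regularized cumulative loss is a potential. It increases in each round by the loss at the
ghost iterate, up to the cost of \<open>linear_loss_trade_off\<close>, and at the end it is at most the value at \<open>y\<close>.
\<close>

lemma ghost_regret:
  fixes T :: nat
  assumes x0: "x0 \<in> X" and y: "y \<in> X"
    and v: "\<And>t. t \<in> {1..T} \<Longrightarrow> dual_norm_le N (v t) L"
  shows "(\<Sum>t=1..T. \<alpha> t * (v t \<bullet> (ghost x0 (\<Sum>s=1..<t. \<alpha> s *\<^sub>R v s) - y)))
      \<le> D + L\<^sup>2 / 2 * (\<Sum>t=1..T. (\<alpha> t)\<^sup>2)"
proof -
  define Z where "Z t = (\<Sum>s=1..<t. \<alpha> s *\<^sub>R v s)" for t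
  define w where "w t = ghost x0 (Z t)" for t
  have w: "w t \<in> X" for t unfolding w_def by (rule ghost_minimizes)
  have step: "Z t \<bullet> w t + B (w t) x0 + \<alpha> t * (v t \<bullet> w t)
      \<le> Z (Suc t) \<bullet> w (Suc t) + B (w (Suc t)) x0 + L\<^sup>2 / 2 * (\<alpha> t)\<^sup>2" if t: "t \<in> {1..T}" for t
  proof -
    have "Z t \<bullet> w t + B (w t) x0 + (N (w (Suc t) - w t))\<^sup>2 / 2
        \<le> Z t \<bullet> w (Suc t) + B (w (Suc t)) x0"
      using ghost_quadratic_growth[OF w[of "Suc t"], of "Z t" x0] by (simp add: w_def)
    moreover have "Z (Suc t) = Z t + \<alpha> t *\<^sub>R v t" using t by (simp add: Z_def)
    moreover have "\<alpha> t * (v t \<bullet> (w t - w (Suc t))) - (N (w t - w (Suc t)))\<^sup>2 / 2 \<le> (\<alpha> t)\<^sup>2 * L\<^sup>2 / 2"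
      by (rule linear_loss_trade_off[OF v[OF t]])
    ultimately show ?thesis
      using is_norm_minus_commute[OF N, of "w t" "w (Suc t)"]
      by (simp add: inner_diff_right inner_add_left algebra_simps)
  qed
  have "(\<Sum>t=1..n. \<alpha> t * (v t \<bullet> w t))
      \<le> Z (Suc n) \<bullet> w (Suc n) + B (w (Suc n)) x0 + L\<^sup>2 / 2 * (\<Sum>t=1..n. (\<alpha> t)\<^sup>2)" if "n \<le> T" for n
    using that
  proof (induction n)
    case 0
    have "Z (Suc 0) = 0" by (simp add: Z_def)
    then show ?case using bregman_nonneg[OF x0 w] by simp
  next
    case (Suc n)
    then show ?case using step[of "Suc n"] by (simp add: algebra_simps)
  qed
  from this[of T] have "(\<Sum>t=1..T. \<alpha> t * (v t \<bullet> w t))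
      \<le> Z (Suc T) \<bullet> w (Suc T) + B (w (Suc T)) x0 + L\<^sup>2 / 2 * (\<Sum>t=1..T. (\<alpha> t)\<^sup>2)" by simp
  also have "\<dots> \<le> Z (Suc T) \<bullet> y + D + L\<^sup>2 / 2 * (\<Sum>t=1..T. (\<alpha> t)\<^sup>2)"
    using ghost_minimizes(2)[OF y, of "Z (Suc T)" x0] bregman_le[OF y x0] by (simp add: w_def)
  also have "Z (Suc T) \<bullet> y = (\<Sum>t=1..T. \<alpha> t * (v t \<bullet> y))"
    by (simp add: Z_def inner_sum_left atLeastLessThanSuc_atLeastAtMost)
  finally have "(\<Sum>t=1..T. \<alpha> t * (v t \<bullet> w t)) - (\<Sum>t=1..T. \<alpha> t * (v t \<bullet> y))
      \<le> D + L\<^sup>2 / 2 * (\<Sum>t=1..T. (\<alpha> t)\<^sup>2)" by simp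
  then show ?thesis
    unfolding w_def Z_def by (simp add: inner_diff_right right_diff_distrib sum_subtractf)
qed

end

lemma bregman_half_square: "bregman (\<lambda>y. (y \<bullet> y) / 2) (\<lambda>y. y) y z = (norm (y - z))\<^sup>2 / 2"
  by (simp add: bregman_def power2_norm_eq_inner inner_diff_left inner_diff_right inner_commute field_simps)

lemma strongly_convex_half_square:
  fixes X :: "'a::real_inner set"
  shows "strongly_convex_wrt norm 1 X (\<lambda>y. (y \<bullet> y) / 2)"
  unfolding strongly_convex_wrt_def
proof (intro ballI)
  fix y z :: 'a and u :: real
  show "(u *\<^sub>R y + (1 - u) *\<^sub>R z) \<bullet> (u *\<^sub>R y + (1 - u) *\<^sub>R z) / 2
      \<le> u * (y \<bullet> y / 2) + (1 - u) * (z \<bullet> z / 2) - 1 / 2 * u * (1 - u) * (norm (y - z))\<^sup>2"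
    by (simp add: power2_norm_eq_inner inner_diff_left inner_diff_right inner_add_left inner_add_right
        inner_commute[of z y] field_simps)
qed

text \<open>
Completing the square turns the proximal objective into the squared distance to the unprojected point.
\<close>

lemma closest_point_is_mirror_step:
  fixes P :: "'a::euclidean_space set"
  assumes "closed P" "P \<noteq> {}" "0 < \<alpha>"
  shows "is_arg_min (\<lambda>y. (- b) \<bullet> (y - q) + 1 / \<alpha> * bregman (\<lambda>y. (y \<bullet> y) / 2) (\<lambda>y. y) y q)
           (\<lambda>y. y \<in> P) (closest_point P (q + \<alpha> *\<^sub>R b))"
proof -
  have eq: "(- b) \<bullet> (y - q) + 1 / \<alpha> * bregman (\<lambda>y. (y \<bullet> y) / 2) (\<lambda>y. y) y q
      = (dist (q + \<alpha> *\<^sub>R b) y)\<^sup>2 / (2 * \<alpha>) - \<alpha> * (b \<bullet> b) / 2" for y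
    using assms(3)
    by (simp add: bregman_half_square dist_norm power2_norm_eq_inner inner_diff_left inner_diff_right
        inner_add_left inner_add_right inner_commute field_simps)
  show ?thesis
    unfolding is_arg_min_def eq
    using closest_point_in_set[OF assms(1,2)] closest_point_le[OF assms(1)] assms(3)
    by (auto simp: not_less divide_right_mono power_mono)
qed

lemma has_derivative_half_square: "((\<lambda>y. (y \<bullet> y) / 2) has_derivative (\<bullet>) y) (at y within P)" for y :: "'a::real_inner"
proof -
  have "((\<lambda>y. y \<bullet> y) has_derivative (\<lambda>h. y \<bullet> h + h \<bullet> y)) (at y within P)"
    by (rule has_derivative_inner[OF has_derivative_ident has_derivative_ident])
  from has_derivative_scaleR_right[OF this, of "1/2"] show ?thesis
    by (simp add: inner_commute[of _ y])
qed

section \<open>Step-size sums\<close>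

text \<open>
This is the moment generating function of a fair sign, so it is the two-point case of Hoeffding's lemma.
\<close>

lemma cosh_le_exp_half_square: "cosh (h::real) \<le> exp (h\<^sup>2 / 2)"
proof -
  have *: "cosh h \<le> exp (h\<^sup>2 / 2)" if "h \<ge> 0" for h :: real
  proof -
    have "- (2 * h) * (1/2) + ln (1 + 1/2 * (exp (2 * h) - 1)) \<le> (2 * h)\<^sup>2 / 8"
      using Hoeffdings_lemma_aux[of "2 * h" "1/2"] that by simp
    moreover have "1 + 1/2 * (exp (2 * h) - 1) = exp h * cosh h"
    proof -
      have "exp h * exp (- h) = 1" "exp (2 * h) = exp h * exp h"
        by (simp_all add: exp_minus flip: exp_add)
      then show ?thesis by (simp add: cosh_field_def algebra_simps)
    qed
    ultimately have "ln (cosh h) \<le> h\<^sup>2 / 2"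
      by (simp add: ln_mult cosh_real_pos power2_eq_square)
    then have "exp (ln (cosh h)) \<le> exp (h\<^sup>2 / 2)" by (simp only: exp_le_cancel_iff)
    then show ?thesis by (simp only: exp_ln[OF cosh_real_pos])
  qed
  show ?thesis using *[of h] *[of "- h"] by (cases "h \<ge> 0") auto
qed

text \<open>
Convexity of the exponential between \<open>- h\<close> and \<open>h\<close>. The right-hand side is affine in \<open>y\<close>, so a conditionally centred
\<open>y\<close> leaves only \<open>cosh h\<close> after integration.
\<close>

lemma exp_le_chord:
  fixes h y :: real
  assumes "\<bar>y\<bar> \<le> 1"
  shows "exp (h * y) \<le> cosh h + y * sinh h"
proof -
  have "convex_on UNIV (exp :: real \<Rightarrow> real)"
    using convex_on_exp[of 1] by simp
  then have "exp ((1 - (1 + y) / 2) *\<^sub>R (- h) + ((1 + y) / 2) *\<^sub>R h)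
      \<le> (1 - (1 + y) / 2) * exp (- h) + (1 + y) / 2 * exp h"
    using assms by (intro convex_onD) auto
  moreover have "(1 - (1 + y) / 2) *\<^sub>R (- h) + ((1 + y) / 2) *\<^sub>R h = h * y"
    by (simp add: field_simps)
  moreover have "(1 - (1 + y) / 2) * exp (- h) + (1 + y) / 2 * exp h = cosh h + y * sinh h"
    by (simp add: cosh_field_def sinh_field_def field_simps)
  ultimately show ?thesis by simp
qed

lemma sum_inverse_le_ln: "T \<ge> 1 \<Longrightarrow> (\<Sum>t=1..T. 1 / real t) \<le> 1 + ln (real T)"
proof (induction T rule: dec_induct)
  case (step n)
  have "ln (real n / real (Suc n)) \<le> real n / real (Suc n) - 1"
    using step by (intro ln_le_minus_one) auto
  then have "1 / real (Suc n) \<le> ln (real (Suc n)) - ln (real n)"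
    using step by (simp add: ln_div field_simps)
  then show ?case using step by simp
qed simp

lemma sum_inverse_sqrt_ge: "2 * sqrt (real T + 1) - 2 \<le> (\<Sum>t=1..T. 1 / sqrt (real t))"
proof (induction T)
  case (Suc n)
  have "2 * (sqrt (real n + 2) * sqrt (real n + 1)) \<le> (real n + 2) + (real n + 1)"
    using arith_geo_mean_sqrt[of "real n + 2" "real n + 1"] by (simp add: real_sqrt_mult)
  then have "2 * sqrt (real n + 2) - 2 * sqrt (real n + 1) \<le> 1 / sqrt (real n + 1)"
    by (simp add: pos_le_divide_eq left_diff_distrib mult.assoc)
  then show ?case using Suc by (simp add: add.commute add.left_commute)
qed simp

text \<open>
For these horizons the claimed rate is weaker than the diameter bound, and no concentration is needed.
\<close>

lemma sqrt_le_3_ln: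
  assumes "2 \<le> T" "T \<le> (36::nat)"
  shows "sqrt (real T) \<le> 3 * ln (real T)"
proof -
  have ln2: "ln (2::real) \<ge> 1/2"
    using ln_le_minus_one[of "1/2::real"] by (simp add: ln_div)
  have ln3: "ln (3::real) \<ge> 1"
    using exp_le by (simp add: ln_ge_iff)
  consider "T = 2" | "3 \<le> T" "T \<le> 9" | "9 \<le> T" using assms by linarith
  then show ?thesis
  proof cases
    case 1
    have "sqrt 2 \<le> (3/2::real)" by (intro real_le_lsqrt) (auto simp: power2_eq_square)
    then show ?thesis using 1 ln2 by simp
  next
    case 2
    have "sqrt (real T) \<le> 3" using 2 by (intro real_le_lsqrt) auto
    moreover have "ln 3 \<le> ln (real T)" using 2 by simp
    ultimately show ?thesis using ln3 by linarith
  next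
    case 3
    have "sqrt (real T) \<le> 6" using assms by (intro real_le_lsqrt) auto
    moreover have "ln ((3::real)\<^sup>2) \<le> ln (real T)" using 3 by (subst ln_le_cancel_iff) auto
    then have "2 * ln (3::real) \<le> ln (real T)" by (simp only: ln_realpow)
    ultimately show ?thesis using ln3 by linarith
  qed
qed

text \<open>
The numerator is the constant produced by the two regret bounds and the deviation level, the denominator the
normalization of \<open>theta\<close>. For \<open>T \<ge> 36\<close> one has \<open>S \<ge> 5/3 * sqrt T\<close>, and the numerator is at most
\<open>7 * ln T\<close>, while \<open>sqrt 2 \<ge> 7/5\<close> and \<open>3 * 7/5 * 5/3 = 7\<close>.
\<close>

lemma step_size_quotient_le:
  fixes T :: nat
  assumes T: "36 \<le> T"
  defines "h \<equiv> \<Sum>t=1..T. 1 / real t" and "S \<equiv> \<Sum>t=1..T. 1 / sqrt (real t)"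
  shows "(2 + 5/2 * h + 4 * sqrt h) / S \<le> 3 * sqrt 2 * ln (real T) / sqrt (real T)"
proof -
  let ?l = "ln (real T)"
  have h: "h \<le> 1 + ?l" unfolding h_def using T by (intro sum_inverse_le_ln) auto
  have h0: "0 \<le> h" unfolding h_def by (intro sum_nonneg) auto
  have sqrth: "4 * sqrt h \<le> h + 4"
  proof -
    have "0 \<le> (sqrt h - 2)\<^sup>2" by simp
    then show ?thesis using h0 by (simp add: power2_diff)
  qed
  have l: "?l \<ge> 3"
  proof -
    have "exp (3::real) = exp 1 ^ 3" by (simp flip: exp_of_nat_mult)
    also have "\<dots> \<le> 3 ^ 3" using exp_le by (intro power_mono) auto
    also have "\<dots> \<le> real T" using T by simp
    finally show ?thesis using T by (simp add: ln_ge_iff)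
  qed
  have sq6: "6 \<le> sqrt (real T)" using T by (intro real_le_rsqrt) auto
  have "sqrt (real T) \<le> sqrt (real T + 1)" by simp
  then have S: "5/3 * sqrt (real T) \<le> S"
    using sum_inverse_sqrt_ge[of T] sq6 unfolding S_def by linarith
  have sqrt2: "7/5 \<le> sqrt (2::real)" by (intro real_le_rsqrt) (auto simp: power2_eq_square)
  have "S > 0" using S sq6 by linarith
  have "(2 + 5/2 * h + 4 * sqrt h) * sqrt (real T) \<le> (7 * ?l) * sqrt (real T)"
    using h sqrth l by (intro mult_right_mono) auto
  also have "\<dots> = (3 * (7/5) * ?l) * (5/3 * sqrt (real T))" by simp
  also have "\<dots> \<le> (3 * sqrt 2 * ?l) * S"
    using S sqrt2 l by (intro mult_mono) auto
  finally show ?thesis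
    using \<open>S > 0\<close> T by (simp add: pos_divide_le_eq pos_le_divide_eq mult.commute)
qed

lemma theta_eq: "theta T t = (1 / sqrt (real t)) / (\<Sum>s=1..T. 1 / sqrt (real s))"
proof -
  have "real s powr (- 1/2) = 1 / sqrt (real s)" for s
    using powr_minus[of "real s" "1/2"] by (simp add: powr_half_sqrt inverse_eq_divide)
  then show ?thesis by (simp add: theta_def)
qed

lemma theta_nonneg: "0 \<le> theta T t"
  unfolding theta_eq by (intro divide_nonneg_nonneg sum_nonneg) auto

lemma sum_inverse_sqrt_pos: "T \<ge> 1 \<Longrightarrow> 0 < (\<Sum>t=1..T. 1 / sqrt (real t))"
  by (intro sum_pos) auto

lemma sum_theta: "T \<ge> 1 \<Longrightarrow> (\<Sum>t=1..T. theta T t) = 1"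
  using sum_inverse_sqrt_pos[of T] unfolding theta_eq sum_divide_distrib[symmetric] by simp

section \<open>Stochastic mirror descent with high probability\<close>

lemma history_chain_links:
  assumes "history_chain M T H A" and "t \<in> {1..T}"
  shows "subalgebra (A t) (H t)" "subalgebra (H (Suc t)) (A t)" "subalgebra M (H (Suc t))"
    "subalgebra M (A t)" "subalgebra (H (Suc t)) (H t)" "subalgebra M (H t)"
  using assms unfolding history_chain_def subalgebra_def by blast+

text \<open>
In round \<open>t\<close> the iterate is known at \<open>H t\<close>, and the direction \<open>g t\<close>, revealed at \<open>H (Suc t)\<close>, has conditional
mean \<open>gbar t\<close> given the intermediate \<open>A t\<close>. For the decision player \<open>A t\<close> contains the sampled maximal index;
for the adversaries \<open>A t = H t\<close>. The case \<open>D = 0\<close>, where the step size vanishes, is included.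
\<close>

locale stochastic_mirror_descent =
  mirror_geometry X N \<psi> grad D + prob_space M
  for X :: "'a::euclidean_space set" and N \<psi> grad D and M :: "'w measure" +
  fixes T :: nat and H A :: "nat \<Rightarrow> 'w measure" and L \<Omega> :: real
    and x g gbar :: "nat \<Rightarrow> 'w \<Rightarrow> 'a"
  assumes chain: "history_chain M T H A"
    and T: "2 \<le> T" and L: "0 < L" and \<Omega>: "1 \<le> \<Omega>"
    and x_in: "\<And>t \<omega>. t \<in> {1..T} \<Longrightarrow> \<omega> \<in> space M \<Longrightarrow> x t \<omega> \<in> X"
    and x_meas: "\<And>t. t \<in> {1..T} \<Longrightarrow> x t \<in> borel_measurable (H t)"
    and g_meas: "\<And>t. t \<in> {1..T} \<Longrightarrow> g t \<in> borel_measurable (H (Suc t))"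
    and gbar_meas: "\<And>t. t \<in> {1..T} \<Longrightarrow> gbar t \<in> borel_measurable (A t)"
    and g_bound: "\<And>t \<omega>. t \<in> {1..T} \<Longrightarrow> \<omega> \<in> space M \<Longrightarrow> dual_norm_le N (g t \<omega>) L"
    and gbar_bound: "\<And>t. t \<in> {1..T} \<Longrightarrow> AE \<omega> in M. dual_norm_le N (gbar t \<omega>) L"
    and gbar_cond: "\<And>t b. t \<in> {1..T} \<Longrightarrow> b \<in> Basis \<Longrightarrow>
      AE \<omega> in M. real_cond_exp M (A t) (\<lambda>\<omega>. g t \<omega> \<bullet> b) \<omega> = gbar t \<omega> \<bullet> b"
    and step: "\<And>t \<omega>. t \<in> {1..T} \<Longrightarrow> \<omega> \<in> space M \<Longrightarrow>
      is_arg_min (\<lambda>y. g t \<omega> \<bullet> (y - x t \<omega>)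
                    + 1 / (1 / L * sqrt (D / \<Omega>) / sqrt (real t)) * bregman \<psi> grad y (x t \<omega>))
        (\<lambda>y. y \<in> X) (x (Suc t) \<omega>)"
begin

definition \<alpha> :: "nat \<Rightarrow> real" where "\<alpha> t = 1 / L * sqrt (D / \<Omega>) / sqrt (real t)"

definition \<xi> :: "nat \<Rightarrow> 'w \<Rightarrow> 'a" where "\<xi> t \<omega> = gbar t \<omega> - g t \<omega>"

definition ghost_base :: 'a where "ghost_base = (SOME y. y \<in> X)"

definition ghost_iterate :: "nat \<Rightarrow> 'w \<Rightarrow> 'a" where
  "ghost_iterate t \<omega> = ghost ghost_base (\<Sum>s=1..<t. \<alpha> s *\<^sub>R \<xi> s \<omega>)"

definition noise :: "nat \<Rightarrow> 'w \<Rightarrow> real" where "noise t \<omega> = \<xi> t \<omega> \<bullet> (x t \<omega> - ghost_iterate t \<omega>)"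

definition noise_range :: real where "noise_range = 2 * L * sqrt (2 * D)"

lemma ghost_base_in: "ghost_base \<in> X"
  using X_nonempty unfolding ghost_base_def by (simp add: some_in_eq)

lemmas subalg_links = history_chain_links[OF chain]

lemma measurable_later:
  assumes f: "f \<in> borel_measurable (H s)" and "1 \<le> s" "s \<le> t" "t \<le> Suc T"
  shows "f \<in> borel_measurable (H t)"
  using \<open>s \<le> t\<close> \<open>t \<le> Suc T\<close>
proof (induction t rule: dec_induct)
  case (step n)
  then show ?case using \<open>1 \<le> s\<close>
    by (intro measurable_from_subalg[OF subalg_links(5)]) auto
qed (rule f)

lemma \<xi>_meas: "t \<in> {1..T} \<Longrightarrow> \<xi> t \<in> borel_measurable (H (Suc t))"
  unfolding \<xi>_def
  by (intro borel_measurable_diff g_meas measurable_from_subalg[OF subalg_links(2) gbar_meas])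

lemma ghost_iterate_meas: "t \<in> {1..T} \<Longrightarrow> ghost_iterate t \<in> borel_measurable (H t)"
proof -
  assume t: "t \<in> {1..T}"
  have "(\<lambda>\<omega>. \<Sum>s=1..<t. \<alpha> s *\<^sub>R \<xi> s \<omega>) \<in> borel_measurable (H t)"
    using t by (intro borel_measurable_sum borel_measurable_scaleR borel_measurable_const
        measurable_later[OF \<xi>_meas]) auto
  then show ?thesis unfolding ghost_iterate_def
    by (rule borel_measurable_continuous_on[OF ghost_continuous])
qed

lemma noise_meas: "t \<in> {1..T} \<Longrightarrow> noise t \<in> borel_measurable (H (Suc t))"
  unfolding noise_def
  by (intro borel_measurable_inner borel_measurable_diff \<xi>_meas
      measurable_from_subalg[OF subalg_links(5) x_meas] measurable_from_subalg[OF subalg_links(5) ghost_iterate_meas])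

lemma gbar_bound_all: "AE \<omega> in M. \<forall>t\<in>{1..T}. dual_norm_le N (gbar t \<omega>) L"
  using gbar_bound by (intro AE_finite_allI) auto

lemma \<xi>_bound:
  "t \<in> {1..T} \<Longrightarrow> \<omega> \<in> space M \<Longrightarrow> dual_norm_le N (gbar t \<omega>) L \<Longrightarrow> dual_norm_le N (\<xi> t \<omega>) (2 * L)"
  using dual_norm_le_diff[OF N _ g_bound] unfolding \<xi>_def by fastforce

lemma noise_bound:
  assumes t: "t \<in> {1..T}"
  shows "AE \<omega> in M. \<bar>noise t \<omega>\<bar> \<le> noise_range"
  using gbar_bound[OF t] AE_space
proof eventually_elim
  fix \<omega> assume \<omega>: "dual_norm_le N (gbar t \<omega>) L" "\<omega> \<in> space M"
  have "\<bar>noise t \<omega>\<bar> \<le> 2 * L * N (x t \<omega> - ghost_iterate t \<omega>)"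
    unfolding noise_def using \<xi>_bound[OF t \<omega>(2,1)] by (rule dual_norm_le_abs[OF N])
  also have "\<dots> \<le> 2 * L * sqrt (2 * D)"
    using N_diam[OF _ x_in[OF t \<omega>(2)], of "ghost_iterate t \<omega>"] L ghost_minimizes(1)
    by (intro mult_left_mono) (auto simp: ghost_iterate_def)
  finally show "\<bar>noise t \<omega>\<bar> \<le> noise_range" by (simp add: noise_range_def)
qed

text \<open>
The difference \<open>x t - ghost_iterate t\<close> is known at \<open>A t\<close>, so the noise is a martingale difference. Stated as
orthogonality to bounded \<open>A t\<close>-measurable weights, this is all that the exponential moment bound needs.
\<close>

lemma noise_orthogonal:
  assumes t: "t \<in> {1..T}" and W: "W \<in> borel_measurable (A t)" and Wb: "AE \<omega> in M. \<bar>W \<omega>\<bar> \<le> c"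
  shows "expectation (\<lambda>\<omega>. W \<omega> * noise t \<omega>) = 0" and "integrable M (\<lambda>\<omega>. W \<omega> * noise t \<omega>)"
proof -
  interpret S: finite_measure_subalgebra M "A t"
    using subalg_links(4)[OF t] by unfold_locales
  obtain r where r: "\<And>y z. y \<in> X \<Longrightarrow> z \<in> X \<Longrightarrow> norm (y - z) \<le> r"
    using compact_imp_bounded[OF compact_X] bounded_two_points[of X] by (auto simp: dist_norm)
  obtain C where C: "0 \<le> C" "\<And>v. N v \<le> C * norm v"
    using is_norm_equivalent[OF N] by (metis less_eq_real_def)
  have c0: "0 \<le> c"
  proof -
    have "AE \<omega> in M. 0 \<le> c" using Wb by eventually_elim auto
    then show ?thesis by simp
  qed
  have vX: "ghost_iterate t \<omega> \<in> X" for \<omega> unfolding ghost_iterate_def by (rule ghost_minimizes)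
  have gM: "g t \<in> borel_measurable M" using measurable_from_subalg[OF subalg_links(3)[OF t] g_meas[OF t]] .
  have xA: "x t \<in> borel_measurable (A t)" "ghost_iterate t \<in> borel_measurable (A t)"
    using measurable_from_subalg[OF subalg_links(1)[OF t]] x_meas[OF t] ghost_iterate_meas[OF t] by auto
  have *: "expectation (\<lambda>\<omega>. (W \<omega> * ((x t \<omega> - ghost_iterate t \<omega>) \<bullet> b)) * (\<xi> t \<omega> \<bullet> b)) = 0 \<and>
    integrable M (\<lambda>\<omega>. (W \<omega> * ((x t \<omega> - ghost_iterate t \<omega>) \<bullet> b)) * (\<xi> t \<omega> \<bullet> b))" if b: "b \<in> Basis" for b
  proof -
    define f where "f \<omega> = W \<omega> * ((x t \<omega> - ghost_iterate t \<omega>) \<bullet> b)" for \<omega>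
    have fA: "f \<in> borel_measurable (A t)"
      unfolding f_def using W xA by (intro borel_measurable_times borel_measurable_inner borel_measurable_diff) auto
    have fM: "f \<in> borel_measurable M" using measurable_from_subalg[OF subalg_links(4)[OF t] fA] .
    have fb: "AE \<omega> in M. \<bar>f \<omega>\<bar> \<le> c * r"
      using Wb AE_space
    proof eventually_elim
      fix \<omega> assume \<omega>: "\<bar>W \<omega>\<bar> \<le> c" "\<omega> \<in> space M"
      have "\<bar>(x t \<omega> - ghost_iterate t \<omega>) \<bullet> b\<bar> \<le> r"
        using Basis_le_norm[OF b] r[OF x_in[OF t \<omega>(2)] vX] by (rule order_trans)
      then show "\<bar>f \<omega>\<bar> \<le> c * r" unfolding f_def abs_mult using \<omega> c0 by (intro mult_mono) auto
    qed
    have int: "integrable M (\<lambda>\<omega>. f \<omega> * (h \<omega> \<bullet> b))"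
      if h: "h \<in> borel_measurable M" "AE \<omega> in M. dual_norm_le N (h \<omega>) L" for h
    proof (rule integrable_const_bound)
      show "AE \<omega> in M. norm (f \<omega> * (h \<omega> \<bullet> b)) \<le> (c * r) * (L * C)"
        using fb h(2)
      proof eventually_elim
        fix \<omega> assume \<omega>: "\<bar>f \<omega>\<bar> \<le> c * r" "dual_norm_le N (h \<omega>) L"
        have "\<bar>h \<omega> \<bullet> b\<bar> \<le> L * C"
          using Basis_le_norm[OF b] dual_norm_le_imp_norm_le[OF C(2) _ \<omega>(2) C(1)] L order_trans by fastforce
        then show "norm (f \<omega> * (h \<omega> \<bullet> b)) \<le> (c * r) * (L * C)"
          unfolding real_norm_def abs_mult using \<omega>(1) by (intro mult_mono) auto
      qed
      show "(\<lambda>\<omega>. f \<omega> * (h \<omega> \<bullet> b)) \<in> borel_measurable M" using fM h(1) by measurable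
    qed
    have gbarM: "gbar t \<in> borel_measurable M"
      using measurable_from_subalg[OF subalg_links(4)[OF t] gbar_meas[OF t]] .
    have int_g: "integrable M (\<lambda>\<omega>. f \<omega> * (g t \<omega> \<bullet> b))"
      using g_bound[OF t] by (intro int gM) auto
    have int_gbar: "integrable M (\<lambda>\<omega>. f \<omega> * (gbar t \<omega> \<bullet> b))"
      using gbar_bound[OF t] by (intro int gbarM)
    have gbM: "(\<lambda>\<omega>. g t \<omega> \<bullet> b) \<in> borel_measurable M" using gM by measurable
    have "expectation (\<lambda>\<omega>. f \<omega> * (gbar t \<omega> \<bullet> b))
        = expectation (\<lambda>\<omega>. f \<omega> * real_cond_exp M (A t) (\<lambda>\<omega>. g t \<omega> \<bullet> b) \<omega>)"
      using gbar_cond[OF t b] fM gbarM by (intro integral_cong_AE) auto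
    also have "\<dots> = expectation (\<lambda>\<omega>. f \<omega> * (g t \<omega> \<bullet> b))"
      by (rule S.real_cond_exp_intg(2)[OF int_g fA gbM])
    finally have "expectation (\<lambda>\<omega>. f \<omega> * (gbar t \<omega> \<bullet> b) - f \<omega> * (g t \<omega> \<bullet> b)) = 0"
      using int_g int_gbar by simp
    moreover have "integrable M (\<lambda>\<omega>. f \<omega> * (gbar t \<omega> \<bullet> b) - f \<omega> * (g t \<omega> \<bullet> b))"
      using int_g int_gbar by simp
    ultimately show ?thesis by (simp add: f_def \<xi>_def inner_diff_left right_diff_distrib)
  qed
  have "W \<omega> * noise t \<omega> = (\<Sum>b\<in>Basis. (W \<omega> * ((x t \<omega> - ghost_iterate t \<omega>) \<bullet> b)) * (\<xi> t \<omega> \<bullet> b))" for \<omega>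
    unfolding noise_def by (subst euclidean_inner) (simp add: sum_distrib_left mult_ac)
  with * show "expectation (\<lambda>\<omega>. W \<omega> * noise t \<omega>) = 0" "integrable M (\<lambda>\<omega>. W \<omega> * noise t \<omega>)"
    by (simp_all add: Bochner_Integration.integral_sum)
qed

lemma weighted_noise_meas: "n \<le> T \<Longrightarrow> (\<lambda>\<omega>. \<Sum>t=1..n. \<alpha> t * noise t \<omega>) \<in> borel_measurable (H (Suc n))"
  by (intro borel_measurable_sum borel_measurable_times borel_measurable_const measurable_later[OF noise_meas]) auto

lemma exp_weighted_noise_bounded:
  assumes "n \<le> T"
  shows "\<exists>c. AE \<omega> in M. \<bar>exp (s * (\<Sum>t=1..n. \<alpha> t * noise t \<omega>))\<bar> \<le> c"
proof -
  have "AE \<omega> in M. \<forall>t\<in>{1..n}. \<bar>noise t \<omega>\<bar> \<le> noise_range"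
    using noise_bound assms by (intro AE_finite_allI) auto
  then have "AE \<omega> in M. \<bar>exp (s * (\<Sum>t=1..n. \<alpha> t * noise t \<omega>))\<bar> \<le> exp (\<bar>s\<bar> * (\<Sum>t=1..n. \<bar>\<alpha> t\<bar> * noise_range))"
  proof eventually_elim
    fix \<omega> assume *: "\<forall>t\<in>{1..n}. \<bar>noise t \<omega>\<bar> \<le> noise_range"
    have "s * (\<Sum>t=1..n. \<alpha> t * noise t \<omega>) \<le> \<bar>s\<bar> * \<bar>\<Sum>t=1..n. \<alpha> t * noise t \<omega>\<bar>"
      by (metis abs_ge_self abs_mult)
    also have "\<dots> \<le> \<bar>s\<bar> * (\<Sum>t=1..n. \<bar>\<alpha> t * noise t \<omega>\<bar>)"
      by (intro mult_left_mono sum_abs) auto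
    also have "\<dots> \<le> \<bar>s\<bar> * (\<Sum>t=1..n. \<bar>\<alpha> t\<bar> * noise_range)"
      using * by (intro mult_left_mono sum_mono) (auto simp: abs_mult intro: mult_left_mono)
    finally show "\<bar>exp (s * (\<Sum>t=1..n. \<alpha> t * noise t \<omega>))\<bar> \<le> exp (\<bar>s\<bar> * (\<Sum>t=1..n. \<bar>\<alpha> t\<bar> * noise_range))" by simp
  qed
  then show ?thesis by blast
qed

lemma exp_weighted_noise_integrable:
  assumes "n \<le> T"
  shows "integrable M (\<lambda>\<omega>. exp (s * (\<Sum>t=1..n. \<alpha> t * noise t \<omega>)))"
proof -
  have sub: "subalgebra M (H (Suc n))"
    using subalg_links(3)[of n] subalg_links(6)[of "Suc n"] T assms by (cases "n = 0") auto
  obtain c where c: "AE \<omega> in M. \<bar>exp (s * (\<Sum>t=1..n. \<alpha> t * noise t \<omega>))\<bar> \<le> c"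
    using exp_weighted_noise_bounded[OF assms, of s] by blast
  have "(\<lambda>\<omega>. \<Sum>t=1..n. \<alpha> t * noise t \<omega>) \<in> borel_measurable M"
    using measurable_from_subalg[OF sub weighted_noise_meas[OF assms]] .
  then have "(\<lambda>\<omega>. exp (s * (\<Sum>t=1..n. \<alpha> t * noise t \<omega>))) \<in> borel_measurable M"
    by measurable
  then show ?thesis using c by (intro integrable_const_bound[where B = c]) auto
qed

text \<open>
The Azuma induction: the last factor is replaced by its chord, whose linear part integrates to zero against the
earlier factors.
\<close>

lemma exp_moment_weighted_noise:
  assumes D: "0 < D" and "n \<le> T"
  shows "expectation (\<lambda>\<omega>. exp (s * (\<Sum>t=1..n. \<alpha> t * noise t \<omega>))) \<le> exp (s\<^sup>2 * noise_range\<^sup>2 / 2 * (\<Sum>t=1..n. (\<alpha> t)\<^sup>2))"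
  using \<open>n \<le> T\<close>
proof (induction n)
  case 0
  show ?case using prob_space by simp
next
  case (Suc n)
  let ?t = "Suc n"
  define W where "W \<omega> = exp (s * (\<Sum>t=1..n. \<alpha> t * noise t \<omega>))" for \<omega>
  define h where "h = s * \<alpha> ?t * noise_range"
  have noise_range: "0 < noise_range" unfolding noise_range_def using L D by simp
  have t: "?t \<in> {1..T}" using Suc by simp
  have Wint: "integrable M W" unfolding W_def using Suc.prems by (intro exp_weighted_noise_integrable) auto
  have "W \<in> borel_measurable (H ?t)"
    using weighted_noise_meas[OF Suc_leD[OF Suc.prems]] unfolding W_def by measurable
  then have WA: "W \<in> borel_measurable (A ?t)" by (rule measurable_from_subalg[OF subalg_links(1)[OF t]])
  obtain c where "AE \<omega> in M. \<bar>W \<omega>\<bar> \<le> c"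
    using exp_weighted_noise_bounded[of n s] Suc.prems unfolding W_def by auto
  note WY = noise_orthogonal[OF t WA this]
  have "expectation (\<lambda>\<omega>. exp (s * (\<Sum>t=1..?t. \<alpha> t * noise t \<omega>)))
      \<le> expectation (\<lambda>\<omega>. cosh h * W \<omega> + sinh h / noise_range * (W \<omega> * noise ?t \<omega>))"
  proof (rule integral_mono_AE)
    show "AE \<omega> in M. exp (s * (\<Sum>t=1..?t. \<alpha> t * noise t \<omega>)) \<le> cosh h * W \<omega> + sinh h / noise_range * (W \<omega> * noise ?t \<omega>)"
      using noise_bound[OF t]
    proof eventually_elim
      fix \<omega> assume "\<bar>noise ?t \<omega>\<bar> \<le> noise_range"
      then have "\<bar>noise ?t \<omega> / noise_range\<bar> \<le> 1" using noise_range by simp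
      from exp_le_chord[OF this, of h]
      have "W \<omega> * exp (h * (noise ?t \<omega> / noise_range)) \<le> W \<omega> * (cosh h + noise ?t \<omega> / noise_range * sinh h)"
        unfolding W_def by (intro mult_left_mono) auto
      moreover have "exp (s * (\<Sum>t=1..?t. \<alpha> t * noise t \<omega>)) = W \<omega> * exp (h * (noise ?t \<omega> / noise_range))"
        using noise_range unfolding W_def h_def by (simp add: algebra_simps flip: exp_add)
      ultimately show "exp (s * (\<Sum>t=1..?t. \<alpha> t * noise t \<omega>)) \<le> cosh h * W \<omega> + sinh h / noise_range * (W \<omega> * noise ?t \<omega>)"
        by (simp add: algebra_simps)
    qed
    show "integrable M (\<lambda>\<omega>. exp (s * (\<Sum>t=1..?t. \<alpha> t * noise t \<omega>)))"
      using Suc.prems by (rule exp_weighted_noise_integrable)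
    show "integrable M (\<lambda>\<omega>. cosh h * W \<omega> + sinh h / noise_range * (W \<omega> * noise ?t \<omega>))"
      using Wint WY(2) by (intro Bochner_Integration.integrable_add integrable_mult_right)
  qed
  also have "\<dots> = cosh h * expectation W"
    using Wint WY by (subst Bochner_Integration.integral_add) auto
  also have "\<dots> \<le> exp (h\<^sup>2 / 2) * exp (s\<^sup>2 * noise_range\<^sup>2 / 2 * (\<Sum>t=1..n. (\<alpha> t)\<^sup>2))"
    using Suc unfolding W_def by (intro mult_mono cosh_le_exp_half_square integral_nonneg) auto
  also have "\<dots> = exp (s\<^sup>2 * noise_range\<^sup>2 / 2 * (\<Sum>t=1..?t. (\<alpha> t)\<^sup>2))"
    unfolding h_def by (simp add: power_mult_distrib algebra_simps flip: exp_add)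
  finally show ?case .
qed

lemma \<alpha>_square: "(\<alpha> t)\<^sup>2 = D / (L\<^sup>2 * \<Omega>) * (1 / real t)"
  using D_nonneg \<Omega> by (simp add: \<alpha>_def power_divide power_mult_distrib)

lemma sum_\<alpha>_square: "(\<Sum>t=1..n. (\<alpha> t)\<^sup>2) = D / (L\<^sup>2 * \<Omega>) * (\<Sum>t=1..n. 1 / real t)"
  by (simp only: \<alpha>_square sum_distrib_left)

text \<open>
Chernoff's bound. The sum of \<open>(\<alpha> t)\<^sup>2\<close> is \<open>D * h / (L\<^sup>2 * \<Omega>)\<close>, so the exponent at the level
\<open>4 * D * sqrt h\<close> is independent of \<open>D\<close>, \<open>L\<close> and \<open>T\<close>.
\<close>

lemma weighted_noise_tail:
  assumes D: "0 < D"
  defines "h \<equiv> \<Sum>t=1..T. 1 / real t"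
  shows "prob {\<omega> \<in> space M. (\<Sum>t=1..T. \<alpha> t * noise t \<omega>) \<ge> 4 * D * sqrt h} \<le> exp (- \<Omega>)"
proof -
  have h: "0 < h" unfolding h_def using T by (intro sum_pos) auto
  define u where "u = 4 * D * sqrt h"
  \<comment> \<open>the minimizer of the Chernoff exponent for this level\<close>
  define s where "s = \<Omega> / (2 * D * sqrt h)"
  have s: "0 < s" unfolding s_def using \<Omega> D h by simp
  have "prob {\<omega> \<in> space M. (\<Sum>t=1..T. \<alpha> t * noise t \<omega>) \<ge> u}
      \<le> exp (- s * u) * (\<integral>\<omega>\<in>space M. exp (s * (\<Sum>t=1..T. \<alpha> t * noise t \<omega>)) \<partial>M)"
  proof (rule Chernoff_ineq_ge[OF s])
    show "set_integrable M (space M) (\<lambda>\<omega>. exp (s * (\<Sum>t=1..T. \<alpha> t * noise t \<omega>)))"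
      unfolding set_integrable_def
      by (rule integrable_mult_indicator[OF sets.top exp_weighted_noise_integrable]) simp
  qed simp
  also have "(\<integral>\<omega>\<in>space M. exp (s * (\<Sum>t=1..T. \<alpha> t * noise t \<omega>)) \<partial>M)
      = expectation (\<lambda>\<omega>. exp (s * (\<Sum>t=1..T. \<alpha> t * noise t \<omega>)))"
    using exp_weighted_noise_integrable[of T s] by (simp add: set_integral_space)
  also have "exp (- s * u) * \<dots> \<le> exp (- s * u) * exp (s\<^sup>2 * noise_range\<^sup>2 / 2 * (\<Sum>t=1..T. (\<alpha> t)\<^sup>2))"
    using exp_moment_weighted_noise[OF D, of T s] by (intro mult_left_mono) auto
  also have "\<dots> = exp (- s * u + s\<^sup>2 * noise_range\<^sup>2 / 2 * (\<Sum>t=1..T. (\<alpha> t)\<^sup>2))" by (simp only: exp_add)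
  finally have "prob {\<omega> \<in> space M. (\<Sum>t=1..T. \<alpha> t * noise t \<omega>) \<ge> u}
      \<le> exp (- s * u + s\<^sup>2 * noise_range\<^sup>2 / 2 * (\<Sum>t=1..T. (\<alpha> t)\<^sup>2))" .
  moreover have "s * u = 2 * \<Omega>" unfolding s_def u_def using D h by simp
  moreover have "s\<^sup>2 * noise_range\<^sup>2 / 2 * (\<Sum>t=1..T. (\<alpha> t)\<^sup>2) = \<Omega>"
  proof -
    have "s\<^sup>2 = \<Omega>\<^sup>2 / (4 * D\<^sup>2 * h)" unfolding s_def using h by (simp add: power_divide power_mult_distrib)
    moreover have "noise_range\<^sup>2 = 8 * L\<^sup>2 * D" unfolding noise_range_def using D by (simp add: power_mult_distrib)
    ultimately show ?thesis unfolding sum_\<alpha>_square h_def[symmetric]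
      using D h L \<Omega> by (simp add: field_simps power2_eq_square)
  qed
  ultimately show ?thesis unfolding u_def by simp
qed

lemma linearized_gap_trivial:
  assumes dual: "\<And>t. t \<in> {1..T} \<Longrightarrow> dual_norm_le N (gbar t \<omega>) L" and \<omega>: "\<omega> \<in> space M" and y: "y \<in> X"
  shows "(\<Sum>t=1..T. theta T t * (gbar t \<omega> \<bullet> (x t \<omega> - y))) \<le> L * sqrt (2 * D)"
proof -
  have "(\<Sum>t=1..T. theta T t * (gbar t \<omega> \<bullet> (x t \<omega> - y))) \<le> (\<Sum>t=1..T. theta T t * (L * sqrt (2 * D)))"
  proof (intro sum_mono mult_left_mono theta_nonneg)
    fix t assume t: "t \<in> {1..T}"
    have "gbar t \<omega> \<bullet> (x t \<omega> - y) \<le> L * N (x t \<omega> - y)"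
      using dual[OF t] unfolding dual_norm_le_def by blast
    also have "\<dots> \<le> L * sqrt (2 * D)"
      using N_diam[OF y x_in[OF t \<omega>]] L by (intro mult_left_mono) auto
    finally show "gbar t \<omega> \<bullet> (x t \<omega> - y) \<le> L * sqrt (2 * D)" .
  qed
  also have "\<dots> = L * sqrt (2 * D)"
    using sum_theta[of T] T by (simp flip: sum_distrib_right)
  finally show ?thesis .
qed

text \<open>
The splitting into the regret of the iterates, the martingale part and the regret of the ghost iterates. The
ghost losses have dual norm at most \<open>2 * L\<close>, which costs \<open>2 * L\<^sup>2\<close> per squared step on top of \<open>L\<^sup>2 / 2\<close>.
\<close>

lemma linearized_gap_martingale:
  assumes dual: "\<And>t. t \<in> {1..T} \<Longrightarrow> dual_norm_le N (gbar t \<omega>) L" and \<omega>: "\<omega> \<in> space M" and y: "y \<in> X"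
    and D: "0 < D"
  defines "h \<equiv> \<Sum>t=1..T. 1 / real t"
  assumes noise: "(\<Sum>t=1..T. \<alpha> t * noise t \<omega>) \<le> 4 * D * sqrt h"
  shows "(\<Sum>t=1..T. \<alpha> t * (gbar t \<omega> \<bullet> (x t \<omega> - y))) \<le> D * (2 + 5/2 * h + 4 * sqrt h)"
proof -
  have h0: "0 \<le> h" unfolding h_def by (intro sum_nonneg) auto
  have \<alpha>_pos: "0 < \<alpha> t" if "t \<in> {1..T}" for t
    unfolding \<alpha>_def using that L D \<Omega> by simp
  have 1: "(\<Sum>t=1..T. \<alpha> t * (g t \<omega> \<bullet> (x t \<omega> - y))) \<le> D + L\<^sup>2 / 2 * (\<Sum>t=1..T. (\<alpha> t)\<^sup>2)"
    by (rule mirror_descent_regret)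
       (use x_in g_bound \<omega> y \<alpha>_pos step in \<open>auto simp: \<alpha>_def\<close>)
  have 2: "(\<Sum>t=1..T. \<alpha> t * (\<xi> t \<omega> \<bullet> (ghost_iterate t \<omega> - y))) \<le> D + (2 * L)\<^sup>2 / 2 * (\<Sum>t=1..T. (\<alpha> t)\<^sup>2)"
    unfolding ghost_iterate_def by (rule ghost_regret[OF ghost_base_in y \<xi>_bound[OF _ \<omega> dual]])
  have "(\<Sum>t=1..T. \<alpha> t * (gbar t \<omega> \<bullet> (x t \<omega> - y)))
      = (\<Sum>t=1..T. \<alpha> t * (g t \<omega> \<bullet> (x t \<omega> - y))) + (\<Sum>t=1..T. \<alpha> t * noise t \<omega>)
        + (\<Sum>t=1..T. \<alpha> t * (\<xi> t \<omega> \<bullet> (ghost_iterate t \<omega> - y)))"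
    unfolding sum.distrib[symmetric]
    by (intro sum.cong) (simp_all add: \<xi>_def noise_def inner_diff_left inner_diff_right algebra_simps)
  also have "\<dots> \<le> 2 * D + 5/2 * (L\<^sup>2 * (\<Sum>t=1..T. (\<alpha> t)\<^sup>2)) + 4 * D * sqrt h"
    using 1 2 noise by (simp add: power_mult_distrib)
  also have "L\<^sup>2 * (\<Sum>t=1..T. (\<alpha> t)\<^sup>2) = D * h / \<Omega>"
    using L \<Omega> unfolding sum_\<alpha>_square h_def[symmetric] by simp
  also have "D * h / \<Omega> \<le> D * h / 1" using \<Omega> D h0 by (intro divide_left_mono) auto
  finally show ?thesis by (simp add: algebra_simps)
qed

text \<open>
The statement provides a measurable set on which the bound holds for every \<open>y\<close>, so that events of different
players can be intersected without asking whether the uncountable family of inequalities is measurable.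
\<close>

theorem linearized_gap_high_probability:
  "\<exists>E\<in>sets M. 1 - exp (- \<Omega>) \<le> prob E \<and>
     (\<forall>\<omega>\<in>E. \<forall>y\<in>X. (\<Sum>t=1..T. theta T t * (gbar t \<omega> \<bullet> (x t \<omega> - y)))
        \<le> 3 * sqrt \<Omega> * (L * ln (real T) * sqrt (2 * D) / sqrt (real T)))"
proof -
  let ?R = "3 * sqrt \<Omega> * (L * ln (real T) * sqrt (2 * D) / sqrt (real T))"
  define h where "h = (\<Sum>t=1..T. 1 / real t)"
  define S where "S = (\<Sum>t=1..T. 1 / sqrt (real t))"
  have S: "0 < S" unfolding S_def using T by (intro sum_inverse_sqrt_pos) auto
  obtain Z where Z: "\<And>\<omega>. \<omega> \<in> space M - Z \<Longrightarrow> \<forall>t\<in>{1..T}. dual_norm_le N (gbar t \<omega>) L" "Z \<in> null_sets M"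
    using AE_E3[OF gbar_bound_all] by metis
  define E where "E = {\<omega> \<in> space M. (\<Sum>t=1..T. \<alpha> t * noise t \<omega>) \<le> 4 * D * sqrt h}"
  have sub: "subalgebra M (H (Suc T))" using subalg_links(3)[of T] T by simp
  have noise_meas: "(\<lambda>\<omega>. \<Sum>t=1..T. \<alpha> t * noise t \<omega>) \<in> borel_measurable M"
    using measurable_from_subalg[OF sub weighted_noise_meas] by simp
  have Em: "E \<in> sets M" unfolding E_def using noise_meas by measurable
  show ?thesis
  proof (cases "0 < D \<and> 36 < T")
    case True
    have "1 - exp (- \<Omega>) \<le> prob E"
    proof -
      have "{\<omega> \<in> space M. (\<Sum>t=1..T. \<alpha> t * noise t \<omega>) \<ge> 4 * D * sqrt h} \<in> events"
        using noise_meas by measurable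
      then have "1 - prob {\<omega> \<in> space M. (\<Sum>t=1..T. \<alpha> t * noise t \<omega>) \<ge> 4 * D * sqrt h}
          = prob (space M - {\<omega> \<in> space M. (\<Sum>t=1..T. \<alpha> t * noise t \<omega>) \<ge> 4 * D * sqrt h})"
        by (simp add: prob_compl)
      also have "\<dots> \<le> prob E" using Em by (intro finite_measure_mono) (auto simp: E_def)
      finally show ?thesis using weighted_noise_tail True unfolding h_def by fastforce
    qed
    moreover have "prob (E - Z) = prob E"
      using Em Z(2) by (rule measure_Diff_null_set)
    moreover have "(\<Sum>t=1..T. theta T t * (gbar t \<omega> \<bullet> (x t \<omega> - y))) \<le> ?R"
      if \<omega>: "\<omega> \<in> E - Z" and y: "y \<in> X" for \<omega> y
    proof -
      define c where "c = 1 / L * sqrt (D / \<Omega>)"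
      have c: "0 < c" unfolding c_def using True L \<Omega> by simp
      have "theta T t = \<alpha> t / (c * S)" for t
        unfolding theta_eq \<alpha>_def S_def[symmetric] c_def[symmetric] using c by simp
      then have "(\<Sum>t=1..T. theta T t * (gbar t \<omega> \<bullet> (x t \<omega> - y)))
          = (\<Sum>t=1..T. \<alpha> t * (gbar t \<omega> \<bullet> (x t \<omega> - y))) / (c * S)"
        by (simp add: sum_divide_distrib)
      also have "\<dots> \<le> D * (2 + 5/2 * h + 4 * sqrt h) / (c * S)"
        using linearized_gap_martingale[of \<omega> y] Z(1)[of \<omega>] \<omega> y True c S unfolding h_def
        by (intro divide_right_mono) (auto simp: E_def h_def)
      also have "\<dots> = D / c * ((2 + 5/2 * h + 4 * sqrt h) / S)" by simp
      also have "\<dots> \<le> D / c * (3 * sqrt 2 * ln (real T) / sqrt (real T))"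
        using step_size_quotient_le[of T] True c unfolding h_def S_def
        by (intro mult_left_mono) auto
      also have "D / c = L * sqrt D * sqrt \<Omega>"
        unfolding c_def using True L \<Omega> by (simp add: real_sqrt_divide real_div_sqrt field_simps)
      finally show ?thesis by (simp add: real_sqrt_mult mult_ac)
    qed
    ultimately show ?thesis using Em Z(2) by (intro bexI[of _ "E - Z"]) auto
  next
    case False
    have "L * sqrt (2 * D) \<le> ?R"
    proof (cases "D = 0")
      case False
      then have "T \<le> 36" using \<open>\<not> (0 < D \<and> 36 < T)\<close> D_nonneg by simp
      then have "1 \<le> 3 * ln (real T) / sqrt (real T)"
        using sqrt_le_3_ln[of T] T by (simp add: pos_le_divide_eq)
      then have "1 * 1 \<le> sqrt \<Omega> * (3 * ln (real T) / sqrt (real T))"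
        using \<Omega> by (intro mult_mono) auto
      then have "1 * (L * sqrt (2 * D)) \<le> (sqrt \<Omega> * (3 * ln (real T) / sqrt (real T))) * (L * sqrt (2 * D))"
        using L D_nonneg by (intro mult_right_mono) auto
      then show ?thesis by (simp add: mult_ac)
    qed simp
    moreover have "prob (space M - Z) = 1" using Z(2) prob_space by (simp add: measure_Diff_null_set)
    moreover have "(\<Sum>t=1..T. theta T t * (gbar t \<omega> \<bullet> (x t \<omega> - y))) \<le> L * sqrt (2 * D)"
      if "\<omega> \<in> space M - Z" "y \<in> X" for \<omega> y
      using Z(1) that by (intro linearized_gap_trivial) auto
    moreover have "space M - Z \<in> sets M" using Z(2) by auto
    moreover have "1 - exp (- \<Omega>) \<le> 1" by simp
    ultimately show ?thesis
      by (intro bexI[of _ "space M - Z"] conjI ballI order_trans[OF _ \<open>L * sqrt (2 * D) \<le> ?R\<close>])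
         simp_all
  qed
qed

end

section \<open>Measurability and conditional expectations of vectors\<close>

lemma borel_measurable_continuous_compose:
  assumes f: "continuous_on X f" and h: "h \<in> borel_measurable M" and "\<And>\<omega>. \<omega> \<in> space M \<Longrightarrow> h \<omega> \<in> X"
  shows "(\<lambda>\<omega>. f (h \<omega>)) \<in> borel_measurable M"
proof -
  have "h \<in> M \<rightarrow>\<^sub>M restrict_space borel X"
    using h assms(3) by (intro measurable_restrict_space2) auto
  then show ?thesis
    by (rule measurable_compose) (rule borel_measurable_continuous_on_restrict[OF f])
qed

lemma continuous_le_on_dense:
  fixes f :: "'a::euclidean_space \<Rightarrow> real"
  assumes "closed X" "Q \<subseteq> X" "X \<subseteq> closure Q" "continuous_on X f" "\<And>q. q \<in> Q \<Longrightarrow> f q \<le> a" "y \<in> X"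
  shows "f y \<le> a"
proof -
  have "closure Q = X" using assms(1-3) by (simp add: closure_minimal subset_antisym)
  then show ?thesis using continuous_le_on_closure[of Q f y a] assms by simp
qed

text \<open>
By continuity in \<open>y\<close> the supremum does not exceed a level as soon as the values on a countable dense subset do
not.
\<close>

lemma borel_measurable_SUP_compact:
  fixes f :: "'a::euclidean_space \<Rightarrow> 'w \<Rightarrow> real"
  assumes X: "compact X" "X \<noteq> {}"
    and cont: "\<And>\<omega>. \<omega> \<in> space M \<Longrightarrow> continuous_on X (\<lambda>y. f y \<omega>)"
    and meas: "\<And>y. y \<in> X \<Longrightarrow> f y \<in> borel_measurable M"
  shows "(\<lambda>\<omega>. SUP y\<in>X. f y \<omega>) \<in> borel_measurable M"
  unfolding borel_measurable_iff_le
proof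
  fix a
  obtain Q where Q: "countable Q" "Q \<subseteq> X" "X \<subseteq> closure Q" by (rule separable)
  have "(SUP y\<in>X. f y \<omega>) \<le> a \<longleftrightarrow> (\<forall>q\<in>Q. f q \<omega> \<le> a)" if \<omega>: "\<omega> \<in> space M" for \<omega>
  proof -
    have "bdd_above ((\<lambda>y. f y \<omega>) ` X)"
      by (intro bounded_imp_bdd_above compact_imp_bounded compact_continuous_image cont \<omega> X)
    then have "(SUP y\<in>X. f y \<omega>) \<le> a \<longleftrightarrow> (\<forall>y\<in>X. f y \<omega> \<le> a)"
      by (rule cSUP_le_iff[OF X(2)])
    also have "\<dots> \<longleftrightarrow> (\<forall>q\<in>Q. f q \<omega> \<le> a)"
      using continuous_le_on_dense[OF compact_imp_closed[OF X(1)] Q(2,3) cont[OF \<omega>], of a] Q(2) by blast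
    finally show ?thesis .
  qed
  then have "{\<omega> \<in> space M. (SUP y\<in>X. f y \<omega>) \<le> a} = {\<omega> \<in> space M. \<forall>q\<in>Q. f q \<omega> \<le> a}" by blast
  also have "\<dots> \<in> sets M"
  proof -
    have "{\<omega> \<in> space M. f q \<omega> \<le> a} \<in> sets M" if "q \<in> Q" for q
    proof -
      have "f q \<in> borel_measurable M" using that meas Q(2) by blast
      then show ?thesis by measurable
    qed
    then show ?thesis using Q(1) by (rule sets.sets_Collect_countable_All')
  qed
  finally show "{\<omega> \<in> space M. (SUP y\<in>X. f y \<omega>) \<le> a} \<in> sets M" .
qed

lemma borel_measurable_INF_compact:
  fixes f :: "'a::euclidean_space \<Rightarrow> 'w \<Rightarrow> real"
  assumes X: "compact X" "X \<noteq> {}"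
    and cont: "\<And>\<omega>. \<omega> \<in> space M \<Longrightarrow> continuous_on X (\<lambda>y. f y \<omega>)"
    and meas: "\<And>y. y \<in> X \<Longrightarrow> f y \<in> borel_measurable M"
  shows "(\<lambda>\<omega>. INF y\<in>X. f y \<omega>) \<in> borel_measurable M"
proof -
  have "(\<lambda>\<omega>. SUP y\<in>X. - f y \<omega>) \<in> borel_measurable M"
    using meas by (intro borel_measurable_SUP_compact X continuous_on_minus cont borel_measurable_uminus) auto
  then have "(\<lambda>\<omega>. - (SUP y\<in>X. - f y \<omega>)) \<in> borel_measurable M" by measurable
  moreover have "- (SUP y\<in>X. - f y \<omega>) = (INF y\<in>X. f y \<omega>)" for \<omega>
    by (simp add: Inf_real_def image_image)
  ultimately show ?thesis by simp
qed

lemma continuous_on_Max: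
  fixes f :: "'i \<Rightarrow> 'a::topological_space \<Rightarrow> real"
  assumes "finite I" "I \<noteq> {}" "\<And>i. i \<in> I \<Longrightarrow> continuous_on X (f i)"
  shows "continuous_on X (\<lambda>y. Max ((\<lambda>i. f i y) ` I))"
  using assms
proof (induction I rule: finite_ne_induct)
  case (insert i I)
  then show ?case by (simp add: continuous_on_max)
qed simp

lemma borel_measurable_vec_nth:
  "f \<in> borel_measurable M \<Longrightarrow> (\<lambda>\<omega>. f \<omega> $ r) \<in> borel_measurable M" for f :: "'w \<Rightarrow> real^'n"
  by (rule borel_measurable_continuous_on[of "\<lambda>v. v $ r"]) (intro continuous_intros)

lemma borel_measurable_vec_lambda:
  assumes "\<And>r. f r \<in> borel_measurable M"
  shows "(\<lambda>\<omega>. (\<chi> r. f r \<omega>) :: real^'n) \<in> borel_measurable M"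
  unfolding borel_measurable_euclidean_space[where 'c="real^'n"]
  using assms by (auto simp: Basis_vec_def inner_axis)

definition vec_cond_exp :: "'w measure \<Rightarrow> 'w measure \<Rightarrow> ('w \<Rightarrow> 'a::euclidean_space) \<Rightarrow> 'w \<Rightarrow> 'a" where
  "vec_cond_exp M A g \<omega> = (\<Sum>b\<in>Basis. real_cond_exp M A (\<lambda>\<omega>. g \<omega> \<bullet> b) \<omega> *\<^sub>R b)"

lemma vec_cond_exp_Basis: "b \<in> Basis \<Longrightarrow> vec_cond_exp M A g \<omega> \<bullet> b = real_cond_exp M A (\<lambda>\<omega>. g \<omega> \<bullet> b) \<omega>"
  by (simp add: vec_cond_exp_def)

lemma vec_cond_exp_measurable: "vec_cond_exp M A g \<in> borel_measurable A"
  unfolding vec_cond_exp_def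
  by (intro borel_measurable_sum borel_measurable_scaleR borel_measurable_cond_exp borel_measurable_const)

text \<open>
A factor known at \<open>F\<close> can be taken out, coordinate by coordinate.
\<close>

lemma (in finite_measure_subalgebra) vec_cond_exp_inner:
  fixes g h :: "'a \<Rightarrow> 'b::euclidean_space"
  assumes g: "g \<in> borel_measurable M" "\<And>\<omega>. \<omega> \<in> space M \<Longrightarrow> norm (g \<omega>) \<le> c"
    and h: "h \<in> borel_measurable F" "\<And>\<omega>. \<omega> \<in> space M \<Longrightarrow> norm (h \<omega>) \<le> d"
  shows "AE \<omega> in M. real_cond_exp M F (\<lambda>\<omega>. g \<omega> \<bullet> h \<omega>) \<omega> = vec_cond_exp M F g \<omega> \<bullet> h \<omega>"
proof -
  have hM: "h \<in> borel_measurable M" using measurable_from_subalg[OF subalg h(1)] .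
  have int: "integrable M (\<lambda>\<omega>. (h \<omega> \<bullet> b) * (g \<omega> \<bullet> b))" for b
  proof (rule integrable_const_bound[where B = "(d * norm b) * (c * norm b)"])
    show "AE \<omega> in M. norm ((h \<omega> \<bullet> b) * (g \<omega> \<bullet> b)) \<le> (d * norm b) * (c * norm b)"
    proof (rule AE_I2)
      fix \<omega> assume \<omega>: "\<omega> \<in> space M"
      have "\<bar>h \<omega> \<bullet> b\<bar> \<le> d * norm b" "\<bar>g \<omega> \<bullet> b\<bar> \<le> c * norm b"
        using Cauchy_Schwarz_ineq2[of "h \<omega>" b] Cauchy_Schwarz_ineq2[of "g \<omega>" b]
          mult_right_mono[OF h(2)[OF \<omega>] norm_ge_zero[of b]] mult_right_mono[OF g(2)[OF \<omega>] norm_ge_zero[of b]]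
        by linarith+
      then show "norm ((h \<omega> \<bullet> b) * (g \<omega> \<bullet> b)) \<le> (d * norm b) * (c * norm b)"
        unfolding real_norm_def abs_mult by (intro mult_mono) (auto intro: order_trans[OF abs_ge_zero])
    qed
    show "(\<lambda>\<omega>. (h \<omega> \<bullet> b) * (g \<omega> \<bullet> b)) \<in> borel_measurable M" using hM g(1) by measurable
  qed
  have "AE \<omega> in M. real_cond_exp M F (\<lambda>\<omega>. \<Sum>b\<in>Basis. (h \<omega> \<bullet> b) * (g \<omega> \<bullet> b)) \<omega>
      = (\<Sum>b\<in>Basis. real_cond_exp M F (\<lambda>\<omega>. (h \<omega> \<bullet> b) * (g \<omega> \<bullet> b)) \<omega>)"
    by (rule real_cond_exp_sum[OF int])
  moreover have "AE \<omega> in M. \<forall>b\<in>Basis. real_cond_exp M F (\<lambda>\<omega>. (h \<omega> \<bullet> b) * (g \<omega> \<bullet> b)) \<omega>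
      = (h \<omega> \<bullet> b) * real_cond_exp M F (\<lambda>\<omega>. g \<omega> \<bullet> b) \<omega>"
    using h(1) g(1) int by (intro AE_finite_allI finite_Basis real_cond_exp_mult) auto
  ultimately show ?thesis
  proof eventually_elim
    fix \<omega>
    assume "real_cond_exp M F (\<lambda>\<omega>. \<Sum>b\<in>Basis. (h \<omega> \<bullet> b) * (g \<omega> \<bullet> b)) \<omega>
        = (\<Sum>b\<in>Basis. real_cond_exp M F (\<lambda>\<omega>. (h \<omega> \<bullet> b) * (g \<omega> \<bullet> b)) \<omega>)"
      and "\<forall>b\<in>Basis. real_cond_exp M F (\<lambda>\<omega>. (h \<omega> \<bullet> b) * (g \<omega> \<bullet> b)) \<omega>
        = (h \<omega> \<bullet> b) * real_cond_exp M F (\<lambda>\<omega>. g \<omega> \<bullet> b) \<omega>"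
    moreover have "g \<omega>' \<bullet> h \<omega>' = (\<Sum>b\<in>Basis. (h \<omega>' \<bullet> b) * (g \<omega>' \<bullet> b))" for \<omega>'
      by (subst euclidean_inner) (simp add: mult.commute)
    ultimately show "real_cond_exp M F (\<lambda>\<omega>. g \<omega> \<bullet> h \<omega>) \<omega> = vec_cond_exp M F g \<omega> \<bullet> h \<omega>"
      by (simp add: vec_cond_exp_def inner_sum_right inner_commute[of _ "h \<omega>"] mult.commute)
  qed
qed

text \<open>
Each linear inequality survives conditioning outside a null set; continuity in the direction makes countably many
of them suffice.
\<close>

lemma (in finite_measure_subalgebra) dual_norm_le_vec_cond_exp:
  fixes g :: "'a \<Rightarrow> 'b::euclidean_space"
  assumes N: "is_norm N" and g: "g \<in> borel_measurable M"
    and b: "\<And>\<omega>. \<omega> \<in> space M \<Longrightarrow> norm (g \<omega>) \<le> c"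
    and L: "\<And>\<omega>. \<omega> \<in> space M \<Longrightarrow> dual_norm_le N (g \<omega>) L"
  shows "AE \<omega> in M. dual_norm_le N (vec_cond_exp M F g \<omega>) L"
proof -
  obtain Q :: "'b set" where Q: "countable Q" "UNIV \<subseteq> closure Q" by (rule separable) auto
  have one: "AE \<omega> in M. vec_cond_exp M F g \<omega> \<bullet> q \<le> L * N q" for q
  proof -
    have "AE \<omega> in M. real_cond_exp M F (\<lambda>\<omega>. g \<omega> \<bullet> q) \<omega> = vec_cond_exp M F g \<omega> \<bullet> q"
      by (rule vec_cond_exp_inner[where h = "\<lambda>_. q", OF g b]) auto
    moreover have "AE \<omega> in M. real_cond_exp M F (\<lambda>\<omega>. g \<omega> \<bullet> q) \<omega> \<le> L * N q"
    proof (rule real_cond_exp_le_c)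
      show "integrable M (\<lambda>\<omega>. g \<omega> \<bullet> q)"
      proof (rule integrable_const_bound[where B = "c * norm q"])
        show "AE \<omega> in M. norm (g \<omega> \<bullet> q) \<le> c * norm q"
          using b by (auto intro!: AE_I2 order_trans[OF Cauchy_Schwarz_ineq2] mult_right_mono)
        show "(\<lambda>\<omega>. g \<omega> \<bullet> q) \<in> borel_measurable M" using g by measurable
      qed
      show "AE \<omega> in M. g \<omega> \<bullet> q \<le> L * N q" using L by (auto simp: dual_norm_le_def)
    qed
    ultimately show ?thesis by eventually_elim simp
  qed
  have "AE \<omega> in M. \<forall>q\<in>Q. vec_cond_exp M F g \<omega> \<bullet> q \<le> L * N q"
    using one by (simp add: AE_ball_countable[OF Q(1)])
  then show ?thesis
  proof eventually_elim
    fix \<omega> assume q: "\<forall>q\<in>Q. vec_cond_exp M F g \<omega> \<bullet> q \<le> L * N q"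
    let ?f = "\<lambda>h. vec_cond_exp M F g \<omega> \<bullet> h - L * N h"
    have "continuous_on UNIV ?f" by (intro continuous_intros is_norm_continuous[OF N])
    then have "?f h \<le> 0" for h
      using continuous_le_on_dense[OF closed_UNIV subset_UNIV Q(2), of ?f 0 h] q by simp
    then show "dual_norm_le N (vec_cond_exp M F g \<omega>) L" by (simp add: dual_norm_le_def)
  qed
qed

lemma (in prob_space) prob_Int_ge:
  assumes "A \<in> events" "B \<in> events" "1 - a \<le> prob A" "1 - b \<le> prob B"
  shows "1 - (a + b) \<le> prob (A \<inter> B)"
proof -
  have "prob (space M - A \<inter> B) \<le> prob ((space M - A) \<union> (space M - B))"
    using assms by (intro finite_measure_mono) auto
  also have "\<dots> \<le> prob (space M - A) + prob (space M - B)"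
    using assms by (intro measure_Un_le) auto
  finally show ?thesis using assms prob_compl[of "A \<inter> B"] prob_compl[of A] prob_compl[of B] by simp
qed

lemma (in prob_space) prob_INT_ge:
  assumes "finite I" "\<And>i. i \<in> I \<Longrightarrow> A i \<in> events" "\<And>i. i \<in> I \<Longrightarrow> 1 - a \<le> prob (A i)"
  shows "1 - real (card I) * a \<le> prob (space M \<inter> (\<Inter>i\<in>I. A i)) \<and> space M \<inter> (\<Inter>i\<in>I. A i) \<in> events"
  using assms
proof (induction I rule: finite_induct)
  case (insert i I)
  then have *: "1 - (real (card I) * a + a) \<le> prob ((space M \<inter> (\<Inter>i\<in>I. A i)) \<inter> A i)"
    by (intro prob_Int_ge) auto
  moreover have "space M \<inter> (\<Inter>j\<in>insert i I. A j) = (space M \<inter> (\<Inter>i\<in>I. A i)) \<inter> A i" by auto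
  ultimately show ?case using insert by (auto simp: algebra_simps)
qed (simp add: prob_space)

section \<open>The ambiguity set and products of sampling weights\<close>

text \<open>
The divergence from the uniform vector is \<open>n / 2\<close> times a squared Euclidean distance.
\<close>

lemma ambiguity_set_eq:
  fixes u :: "real^'n::finite"
  defines "u \<equiv> \<chi> r. 1 / real CARD('n)"
  assumes "0 \<le> \<rho>"
  shows "ambiguity_set \<delta> \<rho> = {q. \<forall>r. \<delta> / real CARD('n) \<le> q $ r} \<inter> cball u (sqrt (2 * \<rho>) / real CARD('n))"
proof -
  let ?n = "real CARD('n)"
  have n: "?n > 0" by simp
  have chi2: "chi2_div q u = ?n / 2 * (norm (q - u))\<^sup>2" for q
  proof -
    have "chi2_div q u = (\<Sum>r\<in>UNIV. ?n / 2 * (q $ r - 1 / ?n)\<^sup>2)"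
      unfolding chi2_div_def u_def
      by (intro sum.cong) (simp_all add: power2_eq_square field_simps)
    also have "\<dots> = ?n / 2 * (norm (q - u))\<^sup>2"
      unfolding sum_distrib_left[symmetric]
      by (simp add: u_def power2_norm_eq_inner inner_vec_def) (simp add: power2_eq_square)
    finally show ?thesis .
  qed
  have radius: "?n / 2 * (norm (q - u))\<^sup>2 \<le> \<rho> / ?n \<longleftrightarrow> dist u q \<le> sqrt (2 * \<rho>) / ?n" for q
  proof -
    have "?n / 2 * (norm (q - u))\<^sup>2 \<le> \<rho> / ?n \<longleftrightarrow> (norm (q - u) * ?n)\<^sup>2 \<le> 2 * \<rho>"
      by (simp add: field_simps power2_eq_square)
    also have "\<dots> \<longleftrightarrow> norm (q - u) * ?n \<le> sqrt (2 * \<rho>)"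
      using assms by (auto intro: real_le_rsqrt simp: sqrt_ge_absD intro!: power_mono dest: power_mono[where n = 2])
    also have "\<dots> \<longleftrightarrow> dist u q \<le> sqrt (2 * \<rho>) / ?n"
      by (simp add: dist_norm norm_minus_commute pos_le_divide_eq)
    finally show ?thesis .
  qed
  have "chi2_div q u \<le> \<rho> / ?n \<longleftrightarrow> dist u q \<le> sqrt (2 * \<rho>) / ?n" for q
    by (simp only: chi2 radius)
  then show ?thesis unfolding ambiguity_set_def u_def[symmetric] by auto
qed

lemma closed_ambiguity_set:
  assumes "0 \<le> \<rho>" shows "closed (ambiguity_set \<delta> \<rho> :: (real^'n::finite) set)"
proof -
  have "closed {q :: real^'n. \<forall>r. \<delta> / real CARD('n) \<le> q $ r}"
    by (intro closed_Collect_all closed_Collect_le continuous_intros)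
  then show ?thesis unfolding ambiguity_set_eq[OF assms] by (intro closed_Int) auto
qed

lemma convex_ambiguity_set:
  assumes "0 \<le> \<rho>" shows "convex (ambiguity_set \<delta> \<rho> :: (real^'n::finite) set)"
proof -
  have "convex {q :: real^'n. \<forall>r. \<delta> / real CARD('n) \<le> q $ r}"
  proof (rule convexI)
    fix q q' :: "real^'n" and a b :: real
    assume *: "q \<in> {q. \<forall>r. \<delta> / real CARD('n) \<le> q $ r}" "q' \<in> {q. \<forall>r. \<delta> / real CARD('n) \<le> q $ r}"
      "0 \<le> a" "0 \<le> b" "a + b = 1"
    have "\<delta> / real CARD('n) \<le> a * q $ r + b * q' $ r" for r
    proof -
      have "a * (\<delta> / real CARD('n)) + b * (\<delta> / real CARD('n)) \<le> a * q $ r + b * q' $ r"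
        using * by (intro add_mono mult_left_mono) auto
      then show ?thesis using *(5) by (metis distrib_right mult_1)
    qed
    then show "a *\<^sub>R q + b *\<^sub>R q' \<in> {q. \<forall>r. \<delta> / real CARD('n) \<le> q $ r}" by simp
  qed
  then show ?thesis unfolding ambiguity_set_eq[OF assms] by (intro convex_Int) auto
qed

lemma ambiguity_set_diameter:
  fixes q q' :: "real^'n::finite"
  assumes "0 \<le> \<rho>" "q \<in> ambiguity_set \<delta> \<rho>" "q' \<in> ambiguity_set \<delta> \<rho>"
  shows "norm (q - q') \<le> 2 * sqrt (2 * \<rho>) / real CARD('n)"
proof -
  let ?u = "(\<chi> r. 1 / real CARD('n)) :: real^'n"
  have "dist q q' \<le> dist ?u q + dist ?u q'" by (metis dist_commute dist_triangle)
  then show ?thesis using assms(2,3) unfolding ambiguity_set_eq[OF assms(1)] by (simp add: dist_norm)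
qed

text \<open>
The excess mass is the inner product of \<open>q - u\<close> with the all-ones vector, \<open>u\<close> being the uniform vector.
\<close>

lemma total_mass_le:
  fixes q :: "real^'n::finite"
  assumes "0 \<le> \<rho>" "q \<in> ambiguity_set \<delta> \<rho>"
  shows "total_mass q \<le> 1 + sqrt (2 * \<rho> / real CARD('n))"
proof -
  let ?n = "real CARD('n)" and ?u = "(\<chi> r. 1 / real CARD('n)) :: real^'n" and ?e = "(\<chi> r. 1) :: real^'n"
  have n: "?n > 0" by simp
  have "norm (q - ?u) \<le> sqrt (2 * \<rho>) / ?n"
    using assms(2) unfolding ambiguity_set_eq[OF assms(1)] by (simp add: dist_norm norm_minus_commute)
  moreover have "norm ?e = sqrt ?n" by (simp add: norm_eq_sqrt_inner inner_vec_def)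
  ultimately have "(q - ?u) \<bullet> ?e \<le> sqrt (2 * \<rho>) / ?n * sqrt ?n"
    using norm_cauchy_schwarz[of "q - ?u" ?e] mult_right_mono[of "norm (q - ?u)" _ "sqrt ?n"]
    by (smt (verit) real_sqrt_ge_zero of_nat_0_le_iff)
  also have "sqrt (2 * \<rho>) / ?n * sqrt ?n = sqrt (2 * \<rho> / ?n)"
    using n by (simp add: real_sqrt_divide real_div_sqrt field_simps)
  also have "(q - ?u) \<bullet> ?e = total_mass q - 1"
    by (simp add: inner_vec_def total_mass_def sum_subtractf)
  finally show ?thesis by simp
qed

lemma ambiguity_set_component_pos:
  fixes q :: "real^'n::finite"
  assumes "0 < \<delta>" "q \<in> ambiguity_set \<delta> \<rho>"
  shows "\<delta> / real CARD('n) \<le> q $ r" and "0 < q $ r"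
proof -
  show "\<delta> / real CARD('n) \<le> q $ r" using assms(2) by (simp add: ambiguity_set_def)
  moreover have "0 < \<delta> / real CARD('n)" using assms(1) by simp
  ultimately show "0 < q $ r" by linarith
qed

lemma total_mass_pos:
  fixes q :: "real^'n::finite"
  assumes "0 < \<delta>" "q \<in> ambiguity_set \<delta> \<rho>"
  shows "0 < total_mass q"
  unfolding total_mass_def using ambiguity_set_component_pos(2)[OF assms] by (intro sum_pos) auto

lemma sum_normalized_weight: "total_mass q \<noteq> 0 \<Longrightarrow> (\<Sum>r\<in>UNIV. normalized_weight q r) = 1"
  by (simp add: normalized_weight_def total_mass_def flip: sum_divide_distrib)

lemma sum_product_weights_eq_1:
  assumes "\<And>i::'m::finite. (\<Sum>r::'n::finite\<in>UNIV. w i r) = (1::real)"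
  shows "(\<Sum>s\<in>PiE UNIV (\<lambda>_. PiE {1..K::nat} (\<lambda>_. UNIV)). \<Prod>i\<in>UNIV. \<Prod>k=1..K. w i (s i k)) = 1"
proof -
  have fin: "finite (PiE {1..K} (\<lambda>_. UNIV :: 'n set))" by (intro finite_PiE) auto
  have "(\<Prod>i\<in>(UNIV::'m set). \<Sum>f\<in>PiE {1..K} (\<lambda>_. UNIV). \<Prod>k=1..K. w i (f k)) = (\<Prod>i\<in>(UNIV::'m set). \<Prod>k=1..K. \<Sum>r\<in>UNIV. w i r)"
    by (subst prod_sum_PiE) auto
  also have "\<dots> = 1" using assms by simp
  also have "(\<Prod>i\<in>(UNIV::'m set). \<Sum>f\<in>PiE {1..K} (\<lambda>_. UNIV). \<Prod>k=1..K. w i (f k))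
      = (\<Sum>s\<in>PiE UNIV (\<lambda>_. PiE {1..K} (\<lambda>_. UNIV)). \<Prod>i\<in>UNIV. \<Prod>k=1..K. w i (s i k))"
    using fin by (subst prod_sum_PiE) auto
  finally show ?thesis .
qed

text \<open>
Fixing one coordinate of a product distribution leaves the marginal weight.
\<close>

lemma sum_product_weights_marginal:
  assumes "\<And>i::'m::finite. (\<Sum>r::'n::finite\<in>UNIV. w i r) = (1::real)"
  shows "(\<Sum>u | u i = r. \<Prod>j\<in>UNIV. w j (u j)) = w i r"
proof -
  have "{u :: 'm \<Rightarrow> 'n. u i = r} = PiE UNIV (\<lambda>j. if j = i then {r} else UNIV)"
    by (auto simp: PiE_iff split: if_splits)
  then have "(\<Sum>u | u i = r. \<Prod>j\<in>UNIV. w j (u j))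
      = (\<Prod>j\<in>UNIV. \<Sum>r'\<in>(if j = i then {r} else UNIV). w j r')"
    by (subst prod_sum_PiE) auto
  also have "\<dots> = (\<Prod>j\<in>UNIV. if j = i then w i r else 1)"
    using assms by (intro prod.cong) auto
  also have "\<dots> = w i r" by simp
  finally show ?thesis .
qed

section \<open>The alternating scheme\<close>

text \<open>
The step sizes are written out, with \<open>1 / (Cg * G) * sqrt (Dx / \<Omega>)\<close> already in the form
\<open>1 / L * sqrt (D / \<Omega>)\<close> of the abstract scheme.
\<close>

locale robust_scheme = prob_space M for M :: "'w measure" +
  fixes X :: "(real^'d::finite) set"
    and N :: "real^'d \<Rightarrow> real"
    and F :: "'m::finite \<Rightarrow> 'n::finite \<Rightarrow> real^'d \<Rightarrow> real"
    and G :: real and Mb :: "'m \<Rightarrow> real"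
    and \<psi> :: "real^'d \<Rightarrow> real" and grad :: "real^'d \<Rightarrow> real^'d"
    and \<rho> \<delta> \<Omega> Cg Dx :: real
    and P :: "(real^'n) set"
    and T K :: nat
    and H H' :: "nat \<Rightarrow> 'w measure"
    and x g :: "nat \<Rightarrow> 'w \<Rightarrow> real^'d"
    and p :: "nat \<Rightarrow> 'w \<Rightarrow> 'm \<Rightarrow> real^'n"
    and S :: "nat \<Rightarrow> 'w \<Rightarrow> 'm \<Rightarrow> nat \<Rightarrow> 'n"
    and Ip :: "nat \<Rightarrow> 'w \<Rightarrow> 'm \<Rightarrow> 'n"
    and ihat :: "nat \<Rightarrow> 'w \<Rightarrow> 'm"
    and Ix :: "nat \<Rightarrow> 'w \<Rightarrow> 'n"
  assumes X_closed: "closed X" and X_convex: "convex X" and N: "is_norm N"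
    and G: "0 < G" and Mb: "\<And>i. 0 < Mb i"
    and F_lipschitz: "\<And>i r. lipschitz_wrt N G X (F i r)"
    and F_bound: "\<And>i r y. y \<in> X \<Longrightarrow> \<bar>F i r y\<bar> \<le> Mb i"
    and deriv: "\<And>y. y \<in> X \<Longrightarrow> (\<psi> has_derivative (\<lambda>h. grad y \<bullet> h)) (at y within X)"
    and strong: "strongly_convex_wrt N 1 X \<psi>"
    and bregman_le: "\<And>y z. y \<in> X \<Longrightarrow> z \<in> X \<Longrightarrow> bregman \<psi> grad y z \<le> Dx"
    and \<rho>: "0 < \<rho>" and \<delta>: "0 < \<delta>" "\<delta> < 1" and \<Omega>: "1 \<le> \<Omega>" and T: "2 \<le> T"
    and P_eq: "P = ambiguity_set \<delta> \<rho>"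
    and Cg_eq: "Cg = 1 + sqrt (2 * \<rho> / real CARD('n))"
    and chain: "history_chain M T H H'"
    and start: "starts_in M (H 1) X P (x 1) (p 1)"
    and fresh: "\<And>t. t \<in> {1..T} \<Longrightarrow>
           samples_fresh M K (H t) (H' t) (H (Suc t)) (p t) (S t) (Ip t) (ihat t) (Ix t)"
    and g_meas: "\<And>t. t \<in> {1..T} \<Longrightarrow> g t \<in> borel_measurable (H (Suc t))"
    and x_meas_Suc: "\<And>t. t \<in> {1..T} \<Longrightarrow> x (Suc t) \<in> borel_measurable (H (Suc t))"
    and p_meas_Suc: "\<And>t i. t \<in> {1..T} \<Longrightarrow> (\<lambda>\<omega>. p (Suc t) \<omega> i) \<in> borel_measurable (H (Suc t))"
    and smd: "\<And>t \<omega>. t \<in> {1..T} \<Longrightarrow> \<omega> \<in> space M \<Longrightarrow>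
           eps_SMD_update X N G F \<psi> grad K (1 / (Cg * G) * sqrt (Dx / \<Omega>) / sqrt (real t))
             (x t \<omega>) (p t \<omega>) (S t \<omega>) (ihat t \<omega>) (Ix t \<omega>) (g t \<omega>) (x (Suc t) \<omega>)"
    and bandit: "\<And>t \<omega>. t \<in> {1..T} \<Longrightarrow> \<omega> \<in> space M \<Longrightarrow>
           bandit_MD_update P F
             (\<lambda>i. 2 * \<delta> / (Cg * Mb i * (real CARD('n))\<^sup>2) * sqrt (\<rho> / \<Omega>) / sqrt (real t))
             (x t \<omega>) (p t \<omega>) (Ip t \<omega>) (p (Suc t) \<omega>)"
begin

lemma Cg_ge_1: "1 \<le> Cg"
  using \<rho> by (simp add: Cg_eq)

lemmas links = history_chain_links[OF chain]

lemma space_H: "t \<in> {1..T} \<Longrightarrow> space (H t) = space M" "t \<in> {1..T} \<Longrightarrow> space (H' t) = space M"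
  using links(4,6) by (auto simp: subalgebra_def)

lemma X_nonempty: "X \<noteq> {}"
  using start not_empty unfolding starts_in_def by blast

lemma P_nonempty: "P \<noteq> {}"
  using start not_empty unfolding starts_in_def by blast

lemma closed_P: "closed P" and convex_P: "convex P"
  using \<rho> by (simp_all add: P_eq closed_ambiguity_set convex_ambiguity_set)

lemma iterates_in:
  assumes t: "t \<in> {1..T}" and \<omega>: "\<omega> \<in> space M"
  shows "x t \<omega> \<in> X" and "p t \<omega> i \<in> P"
proof -
  have "x t \<omega> \<in> X \<and> (\<forall>i. p t \<omega> i \<in> P)"
  proof (cases "t = 1")
    case True
    then show ?thesis using start \<omega> unfolding starts_in_def by blast
  next
    case False
    then obtain s where s: "t = Suc s" "s \<in> {1..T}" using t by (cases t) auto
    have "x (Suc s) \<omega> \<in> X" using smd[OF s(2) \<omega>] by (simp add: eps_SMD_update_def is_arg_min_def)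
    moreover have "p (Suc s) \<omega> i \<in> P" for i
      using bandit[OF s(2) \<omega>] closest_point_in_set[OF closed_P P_nonempty]
      by (simp add: bandit_MD_update_def)
    ultimately show ?thesis by (simp add: s)
  qed
  then show "x t \<omega> \<in> X" "p t \<omega> i \<in> P" by auto
qed

lemma iterates_measurable:
  assumes t: "t \<in> {1..T}"
  shows "x t \<in> borel_measurable (H t)" and "(\<lambda>\<omega>. p t \<omega> i) \<in> borel_measurable (H t)"
proof -
  have "x t \<in> borel_measurable (H t) \<and> (\<lambda>\<omega>. p t \<omega> i) \<in> borel_measurable (H t)"
  proof (cases "t = 1")
    case True
    then show ?thesis using start unfolding starts_in_def by blast
  next
    case False
    then obtain s where s: "t = Suc s" "s \<in> {1..T}" using t by (cases t) auto
    then show ?thesis using x_meas_Suc p_meas_Suc by blast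
  qed
  then show "x t \<in> borel_measurable (H t)" "(\<lambda>\<omega>. p t \<omega> i) \<in> borel_measurable (H t)" by auto
qed

lemma F_continuous: "continuous_on X (F i r)"
  using lipschitz_wrt_continuous_on[OF N _ F_lipschitz] G by simp

lemma F_iterate_measurable: "t \<in> {1..T} \<Longrightarrow> (\<lambda>\<omega>. F i r (x t \<omega>)) \<in> borel_measurable (H t)"
  using iterates_in(1) by (intro borel_measurable_continuous_compose[OF F_continuous] iterates_measurable(1)) (auto simp: space_H)

lemma total_mass_iterate_measurable: "t \<in> {1..T} \<Longrightarrow> (\<lambda>\<omega>. total_mass (p t \<omega> i)) \<in> borel_measurable (H t)"
  unfolding total_mass_def
  by (intro borel_measurable_sum borel_measurable_vec_nth iterates_measurable(2))

lemma total_mass_iterate: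
  assumes "t \<in> {1..T}" "\<omega> \<in> space M"
  shows "0 < total_mass (p t \<omega> i)" and "total_mass (p t \<omega> i) \<le> Cg"
  using total_mass_pos[OF \<delta>(1)] total_mass_le[of \<rho>] iterates_in(2)[OF assms, of i] \<rho>
  unfolding P_eq Cg_eq by auto

lemma p_component:
  assumes "t \<in> {1..T}" "\<omega> \<in> space M"
  shows "\<delta> / real CARD('n) \<le> p t \<omega> i $ r" and "0 < p t \<omega> i $ r"
  using ambiguity_set_component_pos[OF \<delta>(1)] iterates_in(2)[OF assms, of i] unfolding P_eq by auto

lemma bandit_weight_bound:
  assumes t: "t \<in> {1..T}" and \<omega>: "\<omega> \<in> space M"
  shows "\<bar>total_mass (p t \<omega> i) * F i r (x t \<omega>) / p t \<omega> i $ r\<bar> \<le> Cg * Mb i * real CARD('n) / \<delta>"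
proof -
  have "\<bar>total_mass (p t \<omega> i) * F i r (x t \<omega>) / p t \<omega> i $ r\<bar>
      = total_mass (p t \<omega> i) * \<bar>F i r (x t \<omega>)\<bar> / p t \<omega> i $ r"
    using total_mass_iterate(1)[OF t \<omega>, of i] p_component(2)[OF t \<omega>, of i r]
    by (simp add: abs_mult)
  also have "\<dots> \<le> Cg * Mb i / (\<delta> / real CARD('n))"
    using total_mass_iterate[OF t \<omega>, of i] p_component[OF t \<omega>, of i r] F_bound[OF iterates_in(1)[OF t \<omega>]]
      Mb[of i] Cg_ge_1 \<delta> by (intro frac_le mult_mono mult_nonneg_nonneg) auto
  finally show ?thesis by simp
qed

sublocale decision: mirror_geometry X N \<psi> grad Dx
  by unfold_locales (use X_closed X_convex X_nonempty N deriv strong bregman_le in auto)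

text \<open>
The samples of a round are given through their joint conditional law. Summing it over all outcomes with
\<open>Ip t \<omega> i = r\<close> gives the marginal; the law concerns the estimation samples with index in \<open>{1..K}\<close>, so
their outcomes are represented by extensional functions on \<open>{1..K}\<close>.
\<close>

lemma bandit_sample_marginal:
  assumes t: "t \<in> {1..T}"
  shows "AE \<omega> in M. real_cond_exp M (H t) (indicator {\<omega> \<in> space M. Ip t \<omega> i = r}) \<omega>
           = normalized_weight (p t \<omega> i) r"
proof -
  interpret fin: finite_measure_subalgebra M "H t" using links(6)[OF t] by unfold_locales
  note fr = fresh[OF t, unfolded samples_fresh_def]
  define Sp :: "('m \<Rightarrow> nat \<Rightarrow> 'n) set" where "Sp = PiE UNIV (\<lambda>_. PiE {1..K} (\<lambda>_. UNIV))"
  define Up :: "('m \<Rightarrow> 'n) set" where "Up = {u. u i = r}"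
  have fin_Sp: "finite Sp" unfolding Sp_def by (intro finite_PiE) auto
  define E where "E su = {\<omega> \<in> space M. (\<forall>j. \<forall>k\<in>{1..K}. S t \<omega> j k = fst su j k) \<and> (\<forall>j. Ip t \<omega> j = snd su j)}"
    for su
  have E_meas: "E su \<in> sets M" for su
  proof -
    have *: "{\<omega> \<in> space M. f \<omega> = a} \<in> sets M" if "f \<in> measurable (H' t) (count_space UNIV)" for f and a :: 'n
    proof -
      have "f \<in> measurable M (count_space UNIV)"
        using measurable_from_subalg[OF links(4)[OF t] that] .
      then show ?thesis by measurable
    qed
    have "{\<omega> \<in> space M. (\<forall>j\<in>UNIV. \<forall>k\<in>{1..K}. S t \<omega> j k = fst su j k) \<and> (\<forall>j\<in>UNIV. Ip t \<omega> j = snd su j)} \<in> sets M"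
      using fr by (intro sets.sets_Collect_conj sets.sets_Collect_finite_All *) (blast | simp)+
    then show ?thesis by (simp add: E_def)
  qed
  have decomp: "indicator {\<omega> \<in> space M. Ip t \<omega> i = r} \<omega> = (\<Sum>su\<in>Sp \<times> Up. indicator (E su) \<omega> :: real)" for \<omega>
  proof (cases "\<omega> \<in> space M \<and> Ip t \<omega> i = r")
    case True
    define c where "c = ((\<lambda>j. restrict (S t \<omega> j) {1..K}), Ip t \<omega>)"
    have c: "c \<in> Sp \<times> Up" using True by (auto simp: c_def Sp_def Up_def)
    have "\<omega> \<in> E su \<longleftrightarrow> su = c" if "su \<in> Sp \<times> Up" for su
    proof
      assume "\<omega> \<in> E su"
      moreover have "fst su j \<in> extensional {1..K}" for j
        using that by (auto simp: Sp_def PiE_def)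
      ultimately have "fst su j = restrict (S t \<omega> j) {1..K}" for j
        by (intro extensionalityI[of _ "{1..K}"]) (auto simp: E_def)
      then have "fst su = fst c" by (auto simp: c_def)
      moreover have "snd su = snd c" using \<open>\<omega> \<in> E su\<close> by (auto simp: E_def c_def)
      ultimately show "su = c" by (rule prod_eqI)
    qed (use True in \<open>auto simp: E_def c_def\<close>)
    then have "(\<Sum>su\<in>Sp \<times> Up. indicator (E su) \<omega> :: real) = (\<Sum>su\<in>Sp \<times> Up. if su = c then 1 else 0)"
      by (intro sum.cong) (auto simp: indicator_def)
    also have "\<dots> = 1" using c fin_Sp by (subst sum.delta) auto
    finally show ?thesis using True by simp
  next
    case False
    then have "\<omega> \<notin> E su" if "su \<in> Sp \<times> Up" for su
      using that by (auto simp: E_def Up_def)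
    then have "(\<Sum>su\<in>Sp \<times> Up. indicator (E su) \<omega> :: real) = 0"
      by (intro sum.neutral) auto
    then show ?thesis using False by simp
  qed
  have "AE \<omega> in M. real_cond_exp M (H t) (\<lambda>\<omega>. \<Sum>su\<in>Sp \<times> Up. indicator (E su) \<omega>) \<omega>
      = (\<Sum>su\<in>Sp \<times> Up. real_cond_exp M (H t) (indicator (E su)) \<omega>)"
    using E_meas by (intro fin.real_cond_exp_sum) (auto simp: integrable_indicator_iff emeasure_eq_measure)
  moreover have "AE \<omega> in M. \<forall>su\<in>Sp \<times> Up. real_cond_exp M (H t) (indicator (E su)) \<omega>
      = (\<Prod>j\<in>UNIV. \<Prod>k=1..K. normalized_weight (p t \<omega> j) (fst su j k)) *
        (\<Prod>j\<in>UNIV. normalized_weight (p t \<omega> j) (snd su j))"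
    using fr fin_Sp unfolding cond_prob_given_def E_def by (intro AE_finite_allI) auto
  ultimately show ?thesis using AE_space
  proof eventually_elim
    fix \<omega>
    assume 1: "real_cond_exp M (H t) (\<lambda>\<omega>. \<Sum>su\<in>Sp \<times> Up. indicator (E su) \<omega>) \<omega>
      = (\<Sum>su\<in>Sp \<times> Up. real_cond_exp M (H t) (indicator (E su)) \<omega>)"
      and 2: "\<forall>su\<in>Sp \<times> Up. real_cond_exp M (H t) (indicator (E su)) \<omega>
      = (\<Prod>j\<in>UNIV. \<Prod>k=1..K. normalized_weight (p t \<omega> j) (fst su j k)) *
        (\<Prod>j\<in>UNIV. normalized_weight (p t \<omega> j) (snd su j))" and \<omega>: "\<omega> \<in> space M"
    define w where "w j = normalized_weight (p t \<omega> j)" for j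
    have w: "(\<Sum>r\<in>UNIV. w j r) = 1" for j
      unfolding w_def using total_mass_iterate(1)[OF t \<omega>, of j] by (intro sum_normalized_weight) auto
    have "real_cond_exp M (H t) (indicator {\<omega> \<in> space M. Ip t \<omega> i = r}) \<omega>
        = real_cond_exp M (H t) (\<lambda>\<omega>. \<Sum>su\<in>Sp \<times> Up. indicator (E su) \<omega>) \<omega>"
      using decomp by presburger
    also have "\<dots> = (\<Sum>su\<in>Sp \<times> Up. (\<Prod>j\<in>UNIV. \<Prod>k=1..K. w j (fst su j k)) * (\<Prod>j\<in>UNIV. w j (snd su j)))"
      unfolding 1 w_def using 2 by (intro sum.cong) auto
    also have "\<dots> = (\<Sum>s\<in>Sp. \<Prod>j\<in>UNIV. \<Prod>k=1..K. w j (s j k)) * (\<Sum>u\<in>Up. \<Prod>j\<in>UNIV. w j (u j))"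
      by (simp add: sum_product sum.cartesian_product case_prod_beta)
    also have "\<dots> = w i r"
      using sum_product_weights_eq_1[of w K, OF w] sum_product_weights_marginal[of w i r, OF w]
      by (simp add: Sp_def Up_def)
    finally show "real_cond_exp M (H t) (indicator {\<omega> \<in> space M. Ip t \<omega> i = r}) \<omega>
        = normalized_weight (p t \<omega> i) r" by (simp add: w_def)
  qed
qed

text \<open>
Dividing by the weight of the sampled coordinate compensates its sampling probability, and the total mass
compensates the normalization. The signs are those of a minimizing player with loss \<open>- Fvec F i (x t)\<close>.
\<close>

lemma bandit_grad_unbiased:
  assumes t: "t \<in> {1..T}" and b: "b \<in> Basis"
  shows "AE \<omega> in M. real_cond_exp M (H t) (\<lambda>\<omega>. - bandit_grad F (x t \<omega>) (p t \<omega>) i (Ip t \<omega> i) \<bullet> b) \<omega>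
           = - Fvec F i (x t \<omega>) \<bullet> b"
proof -
  interpret fin: finite_measure_subalgebra M "H t" using links(6)[OF t] by unfold_locales
  obtain r where r: "b = axis r 1" using b by (auto simp: Basis_vec_def)
  define A where "A = {\<omega> \<in> space M. Ip t \<omega> i = r}"
  define f where "f \<omega> = - (total_mass (p t \<omega> i) * F i r (x t \<omega>) / p t \<omega> i $ r)" for \<omega>
  have IpM: "(\<lambda>\<omega>. Ip t \<omega> i) \<in> measurable M (count_space UNIV)"
    using fresh[OF t] measurable_from_subalg[OF links(4)[OF t]] unfolding samples_fresh_def by blast
  have A: "A \<in> sets M" unfolding A_def using IpM by measurable
  have fH: "f \<in> borel_measurable (H t)"
    unfolding f_def
    by (intro borel_measurable_uminus borel_measurable_divide borel_measurable_times borel_measurable_vec_nth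
        total_mass_iterate_measurable F_iterate_measurable iterates_measurable(2) t)
  have fM: "f \<in> borel_measurable M" using measurable_from_subalg[OF links(6)[OF t] fH] .
  have f_bound: "\<bar>f \<omega>\<bar> \<le> Cg * Mb i * real CARD('n) / \<delta>" if \<omega>: "\<omega> \<in> space M" for \<omega>
    using bandit_weight_bound[OF t \<omega>] by (simp add: f_def)
  have "AE \<omega> in M. real_cond_exp M (H t) (\<lambda>\<omega>. f \<omega> * indicator A \<omega>) \<omega>
      = f \<omega> * real_cond_exp M (H t) (indicator A) \<omega>"
  proof (rule fin.real_cond_exp_mult[OF fH])
    show "indicator A \<in> borel_measurable M" using A by measurable
    show "integrable M (\<lambda>\<omega>. f \<omega> * indicator A \<omega>)"
    proof (rule integrable_const_bound[where B = "Cg * Mb i * real CARD('n) / \<delta>"])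
      show "AE \<omega> in M. norm (f \<omega> * indicator A \<omega>) \<le> Cg * Mb i * real CARD('n) / \<delta>"
        using f_bound by (intro AE_I2) (auto simp: indicator_def intro: order_trans[OF abs_ge_zero])
      show "(\<lambda>\<omega>. f \<omega> * indicator A \<omega>) \<in> borel_measurable M" using A fM by measurable
    qed
  qed
  moreover have "AE \<omega> in M. real_cond_exp M (H t) (\<lambda>\<omega>. - bandit_grad F (x t \<omega>) (p t \<omega>) i (Ip t \<omega> i) \<bullet> b) \<omega>
      = real_cond_exp M (H t) (\<lambda>\<omega>. f \<omega> * indicator A \<omega>) \<omega>"
  proof (rule fin.real_cond_exp_cong)
    have *: "- bandit_grad F (x t \<omega>) (p t \<omega>) i (Ip t \<omega> i) \<bullet> b = (if Ip t \<omega> i = r then f \<omega> else 0)" for \<omega>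
      by (auto simp: r inner_axis bandit_grad_def f_def)
    then show "AE \<omega> in M. - bandit_grad F (x t \<omega>) (p t \<omega>) i (Ip t \<omega> i) \<bullet> b = f \<omega> * indicator A \<omega>"
      by (auto simp: A_def)
    show "(\<lambda>\<omega>. - bandit_grad F (x t \<omega>) (p t \<omega>) i (Ip t \<omega> i) \<bullet> b) \<in> borel_measurable M"
      unfolding * using fM IpM by measurable
    show "(\<lambda>\<omega>. f \<omega> * indicator A \<omega>) \<in> borel_measurable M" using A fM by measurable
  qed
  ultimately show ?thesis using bandit_sample_marginal[OF t, of i r, folded A_def] AE_space
  proof eventually_elim
    fix \<omega>
    assume "real_cond_exp M (H t) (\<lambda>\<omega>. f \<omega> * indicator A \<omega>) \<omega> = f \<omega> * real_cond_exp M (H t) (indicator A) \<omega>"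
      "real_cond_exp M (H t) (\<lambda>\<omega>. - bandit_grad F (x t \<omega>) (p t \<omega>) i (Ip t \<omega> i) \<bullet> b) \<omega>
        = real_cond_exp M (H t) (\<lambda>\<omega>. f \<omega> * indicator A \<omega>) \<omega>"
      "real_cond_exp M (H t) (indicator A) \<omega> = normalized_weight (p t \<omega> i) r" and \<omega>: "\<omega> \<in> space M"
    moreover have "f \<omega> * normalized_weight (p t \<omega> i) r = - F i r (x t \<omega>)"
      using total_mass_iterate(1)[OF t \<omega>, of i] p_component(2)[OF t \<omega>, of i r]
      by (simp add: f_def normalized_weight_def)
    ultimately show "real_cond_exp M (H t) (\<lambda>\<omega>. - bandit_grad F (x t \<omega>) (p t \<omega>) i (Ip t \<omega> i) \<bullet> b) \<omega>
           = - Fvec F i (x t \<omega>) \<bullet> b"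
      by (simp add: r inner_axis Fvec_def)
  qed
qed

lemma g_dual_norm:
  assumes t: "t \<in> {1..T}" and \<omega>: "\<omega> \<in> space M"
  shows "dual_norm_le N (g t \<omega>) (Cg * G)"
proof (rule dual_norm_le_mono[OF N])
  show "dual_norm_le N (g t \<omega>) (total_mass (p t \<omega> (ihat t \<omega>)) * G)"
    using smd[OF t \<omega>] by (simp add: eps_SMD_update_def)
  show "total_mass (p t \<omega> (ihat t \<omega>)) * G \<le> Cg * G"
    using total_mass_iterate(2)[OF t \<omega>] G by (intro mult_right_mono) auto
qed

lemma g_norm_bounded: "\<exists>c. \<forall>t\<in>{1..T}. \<forall>\<omega>\<in>space M. norm (g t \<omega>) \<le> c"
proof -
  obtain c C where C: "C > 0" "\<And>v. N v \<le> C * norm v" using is_norm_equivalent[OF N] by metis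
  have "norm (g t \<omega>) \<le> Cg * G * C" if "t \<in> {1..T}" "\<omega> \<in> space M" for t \<omega>
    using dual_norm_le_imp_norm_le[OF C(2) _ g_dual_norm[OF that]] C(1) G Cg_ge_1 by simp
  then show ?thesis by blast
qed

lemma g_measurable: "t \<in> {1..T} \<Longrightarrow> g t \<in> borel_measurable M"
  using measurable_from_subalg[OF links(3) g_meas] .

definition gbar :: "nat \<Rightarrow> 'w \<Rightarrow> real^'d" where
  "gbar t = vec_cond_exp M (H' t) (g t)"

lemma loss_continuous: "continuous_on X (\<lambda>y. q \<bullet> Fvec F i y)"
  by (simp add: inner_vec_def Fvec_def) (intro continuous_intros F_continuous)

text \<open>
The subgradient inequality for the sampled loss is conditioned on \<open>H' t\<close>. The weights of the sample turn the
sampled losses into the full loss with index \<open>ihat t\<close>.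
\<close>

lemma loss_difference_cond_exp:
  assumes t: "t \<in> {1..T}" and y: "y \<in> X"
  shows "AE \<omega> in M. p t \<omega> (ihat t \<omega>) \<bullet> Fvec F (ihat t \<omega>) (x t \<omega>) - p t \<omega> (ihat t \<omega>) \<bullet> Fvec F (ihat t \<omega>) y
           \<le> gbar t \<omega> \<bullet> (x t \<omega> - y)"
proof -
  interpret fin: finite_measure_subalgebra M "H' t" using links(4)[OF t] by unfold_locales
  note fr = fresh[OF t, unfolded samples_fresh_def]
  define f where "f r \<omega> = total_mass (p t \<omega> (ihat t \<omega>)) * (F (ihat t \<omega>) r (x t \<omega>) - F (ihat t \<omega>) r y)" for r \<omega>
  define A where "A r = {\<omega> \<in> space M. Ix t \<omega> = r}" for r
  have IxM: "Ix t \<in> measurable M (count_space UNIV)"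
    using fr measurable_from_subalg[OF links(3)[OF t]] by blast
  have A: "A r \<in> sets M" for r unfolding A_def using IxM by measurable
  have fH: "f r \<in> borel_measurable (H' t)" for r
    unfolding f_def
  proof (rule measurable_compose_countable'[where I = UNIV and g = "ihat t"])
    fix j
    have "(\<lambda>\<omega>. total_mass (p t \<omega> j) * (F j r (x t \<omega>) - F j r y)) \<in> borel_measurable (H t)"
      by (intro borel_measurable_times borel_measurable_diff borel_measurable_const
          total_mass_iterate_measurable F_iterate_measurable t)
    then show "(\<lambda>\<omega>. total_mass (p t \<omega> j) * (F j r (x t \<omega>) - F j r y)) \<in> borel_measurable (H' t)"
      by (rule measurable_from_subalg[OF links(1)[OF t]])
  qed (use fr in \<open>auto intro: countable_finite\<close>)
  have fM: "f r \<in> borel_measurable M" for r using measurable_from_subalg[OF links(4)[OF t] fH] .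
  have f_bound: "\<bar>f r \<omega>\<bar> \<le> Cg * (2 * (\<Sum>j\<in>UNIV. Mb j))" if \<omega>: "\<omega> \<in> space M" for r \<omega>
  proof -
    let ?i = "ihat t \<omega>"
    have "Mb ?i \<le> (\<Sum>j\<in>UNIV. Mb j)" using Mb by (intro member_le_sum) (auto intro: less_imp_le)
    then have "\<bar>F ?i r (x t \<omega>) - F ?i r y\<bar> \<le> 2 * (\<Sum>j\<in>UNIV. Mb j)"
      using F_bound[OF iterates_in(1)[OF t \<omega>], of ?i r] F_bound[OF y, of ?i r] by linarith
    then show ?thesis
      unfolding f_def abs_mult using total_mass_iterate[OF t \<omega>, of ?i] by (intro mult_mono) auto
  qed
  have f_int: "integrable M (\<lambda>\<omega>. f r \<omega> * indicator (A r) \<omega>)" for r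
  proof (rule integrable_const_bound[where B = "Cg * (2 * (\<Sum>j\<in>UNIV. Mb j))"])
    show "AE \<omega> in M. norm (f r \<omega> * indicator (A r) \<omega>) \<le> Cg * (2 * (\<Sum>j\<in>UNIV. Mb j))"
    proof (rule AE_I2)
      fix \<omega> assume \<omega>: "\<omega> \<in> space M"
      have "norm (f r \<omega> * indicator (A r) \<omega>) \<le> \<bar>f r \<omega>\<bar>" by (simp add: indicator_def)
      also note f_bound[OF \<omega>]
      finally show "norm (f r \<omega> * indicator (A r) \<omega>) \<le> Cg * (2 * (\<Sum>j\<in>UNIV. Mb j))" .
    qed
    show "(\<lambda>\<omega>. f r \<omega> * indicator (A r) \<omega>) \<in> borel_measurable M" using A fM by measurable
  qed
  have xH: "(\<lambda>\<omega>. x t \<omega> - y) \<in> borel_measurable (H' t)"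
    using measurable_from_subalg[OF links(1)[OF t] iterates_measurable(1)[OF t]] by measurable
  obtain c where c: "\<And>\<omega>. \<omega> \<in> space M \<Longrightarrow> norm (g t \<omega>) \<le> c" using g_norm_bounded t by blast
  obtain d where d: "\<And>\<omega>. \<omega> \<in> space M \<Longrightarrow> norm (x t \<omega> - y) \<le> d"
    using compact_imp_bounded[OF decision.compact_X] iterates_in(1)[OF t] y
    by (metis bounded_two_points dist_norm)
  have xM: "(\<lambda>\<omega>. x t \<omega> - y) \<in> borel_measurable M" using measurable_from_subalg[OF links(4)[OF t] xH] .
  have g_int: "integrable M (\<lambda>\<omega>. g t \<omega> \<bullet> (x t \<omega> - y))"
  proof (rule integrable_const_bound[where B = "c * d"])
    show "AE \<omega> in M. norm (g t \<omega> \<bullet> (x t \<omega> - y)) \<le> c * d"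
    proof (rule AE_I2)
      fix \<omega> assume \<omega>: "\<omega> \<in> space M"
      have "norm (g t \<omega>) * norm (x t \<omega> - y) \<le> c * d"
        using c[OF \<omega>] d[OF \<omega>] by (intro mult_mono) (auto intro: order_trans[OF norm_ge_zero])
      then show "norm (g t \<omega> \<bullet> (x t \<omega> - y)) \<le> c * d"
        using Cauchy_Schwarz_ineq2[of "g t \<omega>" "x t \<omega> - y"] by simp
    qed
    show "(\<lambda>\<omega>. g t \<omega> \<bullet> (x t \<omega> - y)) \<in> borel_measurable M"
      using g_measurable[OF t] xM by (rule borel_measurable_inner)
  qed
  have "AE \<omega> in M. real_cond_exp M (H' t) (\<lambda>\<omega>. \<Sum>r\<in>UNIV. f r \<omega> * indicator (A r) \<omega>) \<omega>
      \<le> real_cond_exp M (H' t) (\<lambda>\<omega>. g t \<omega> \<bullet> (x t \<omega> - y)) \<omega>"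
  proof (rule fin.real_cond_exp_mono)
    show "AE \<omega> in M. (\<Sum>r\<in>UNIV. f r \<omega> * indicator (A r) \<omega>) \<le> g t \<omega> \<bullet> (x t \<omega> - y)"
    proof (rule AE_I2)
      fix \<omega> assume \<omega>: "\<omega> \<in> space M"
      have "(\<Sum>r\<in>UNIV. f r \<omega> * indicator (A r) \<omega>) = (\<Sum>r\<in>UNIV. if r = Ix t \<omega> then f r \<omega> else 0)"
        using \<omega> by (intro sum.cong) (auto simp: A_def indicator_def)
      also have "\<dots> = f (Ix t \<omega>) \<omega>" by simp
      also have "\<dots> \<le> g t \<omega> \<bullet> (x t \<omega> - y)"
        using smd[OF t \<omega>] y
        by (auto simp: eps_SMD_update_def subdifferential_on_def f_def right_diff_distrib inner_diff_right)
      finally show "(\<Sum>r\<in>UNIV. f r \<omega> * indicator (A r) \<omega>) \<le> g t \<omega> \<bullet> (x t \<omega> - y)" .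
    qed
  qed (rule Bochner_Integration.integrable_sum[OF f_int] g_int)+
  moreover have "AE \<omega> in M. real_cond_exp M (H' t) (\<lambda>\<omega>. \<Sum>r\<in>UNIV. f r \<omega> * indicator (A r) \<omega>) \<omega>
      = (\<Sum>r\<in>UNIV. real_cond_exp M (H' t) (\<lambda>\<omega>. f r \<omega> * indicator (A r) \<omega>) \<omega>)"
    using f_int by (rule fin.real_cond_exp_sum)
  moreover have "AE \<omega> in M. \<forall>r\<in>UNIV. real_cond_exp M (H' t) (\<lambda>\<omega>. f r \<omega> * indicator (A r) \<omega>) \<omega>
      = f r \<omega> * real_cond_exp M (H' t) (indicator (A r)) \<omega>"
    using A f_int fH by (intro AE_finite_allI fin.real_cond_exp_mult) auto
  moreover have "AE \<omega> in M. \<forall>r\<in>UNIV. real_cond_exp M (H' t) (indicator (A r)) \<omega>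
      = normalized_weight (p t \<omega> (ihat t \<omega>)) r"
    using fr unfolding cond_prob_given_def A_def by (intro AE_finite_allI) auto
  moreover have "AE \<omega> in M. real_cond_exp M (H' t) (\<lambda>\<omega>. g t \<omega> \<bullet> (x t \<omega> - y)) \<omega> = gbar t \<omega> \<bullet> (x t \<omega> - y)"
    unfolding gbar_def by (rule fin.vec_cond_exp_inner[OF g_measurable[OF t] c xH d])
  ultimately show ?thesis using AE_space
  proof eventually_elim
    fix \<omega>
    let ?q = "p t \<omega> (ihat t \<omega>)" and ?i = "ihat t \<omega>"
    assume 1: "real_cond_exp M (H' t) (\<lambda>\<omega>. \<Sum>r\<in>UNIV. f r \<omega> * indicator (A r) \<omega>) \<omega>
        \<le> real_cond_exp M (H' t) (\<lambda>\<omega>. g t \<omega> \<bullet> (x t \<omega> - y)) \<omega>"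
      and 2: "real_cond_exp M (H' t) (\<lambda>\<omega>. \<Sum>r\<in>UNIV. f r \<omega> * indicator (A r) \<omega>) \<omega>
        = (\<Sum>r\<in>UNIV. real_cond_exp M (H' t) (\<lambda>\<omega>. f r \<omega> * indicator (A r) \<omega>) \<omega>)"
      and 3: "\<forall>r\<in>UNIV. real_cond_exp M (H' t) (\<lambda>\<omega>. f r \<omega> * indicator (A r) \<omega>) \<omega>
        = f r \<omega> * real_cond_exp M (H' t) (indicator (A r)) \<omega>"
      and 4: "\<forall>r\<in>UNIV. real_cond_exp M (H' t) (indicator (A r)) \<omega> = normalized_weight ?q r"
      and 5: "real_cond_exp M (H' t) (\<lambda>\<omega>. g t \<omega> \<bullet> (x t \<omega> - y)) \<omega> = gbar t \<omega> \<bullet> (x t \<omega> - y)"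
      and \<omega>: "\<omega> \<in> space M"
    have "f r \<omega> * normalized_weight ?q r = ?q $ r * F ?i r (x t \<omega>) - ?q $ r * F ?i r y" for r
      using total_mass_iterate(1)[OF t \<omega>, of ?i]
      by (simp add: f_def normalized_weight_def algebra_simps)
    then have "(\<Sum>r\<in>UNIV. real_cond_exp M (H' t) (\<lambda>\<omega>. f r \<omega> * indicator (A r) \<omega>) \<omega>)
        = ?q \<bullet> Fvec F ?i (x t \<omega>) - ?q \<bullet> Fvec F ?i y"
      using 3 4 by (simp add: inner_vec_def Fvec_def sum_subtractf)
    then show "?q \<bullet> Fvec F ?i (x t \<omega>) - ?q \<bullet> Fvec F ?i y \<le> gbar t \<omega> \<bullet> (x t \<omega> - y)"
      using 1 2 5 by simp
  qed
qed

text \<open>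
The exceptional null set of the preceding inequality depends on \<open>y\<close>; restricting to a countable dense subset and
using continuity gives one null set for all \<open>y\<close>.
\<close>

lemma gbar_subgradient:
  assumes t: "t \<in> {1..T}"
  shows "AE \<omega> in M. \<forall>y\<in>X. p t \<omega> (ihat t \<omega>) \<bullet> Fvec F (ihat t \<omega>) (x t \<omega>) - p t \<omega> (ihat t \<omega>) \<bullet> Fvec F (ihat t \<omega>) y
           \<le> gbar t \<omega> \<bullet> (x t \<omega> - y)"
proof -
  obtain Q where Q: "countable Q" "Q \<subseteq> X" "X \<subseteq> closure Q" by (rule separable)
  have "AE \<omega> in M. \<forall>y\<in>Q. p t \<omega> (ihat t \<omega>) \<bullet> Fvec F (ihat t \<omega>) (x t \<omega>) - p t \<omega> (ihat t \<omega>) \<bullet> Fvec F (ihat t \<omega>) y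
           \<le> gbar t \<omega> \<bullet> (x t \<omega> - y)"
    using loss_difference_cond_exp[OF t] Q(2) by (subst AE_ball_countable[OF Q(1)]) auto
  then show ?thesis
  proof eventually_elim
    fix \<omega>
    let ?q = "p t \<omega> (ihat t \<omega>)" and ?i = "ihat t \<omega>"
    let ?f = "\<lambda>y. ?q \<bullet> Fvec F ?i (x t \<omega>) - ?q \<bullet> Fvec F ?i y - gbar t \<omega> \<bullet> (x t \<omega> - y)"
    assume *: "\<forall>y\<in>Q. ?q \<bullet> Fvec F ?i (x t \<omega>) - ?q \<bullet> Fvec F ?i y \<le> gbar t \<omega> \<bullet> (x t \<omega> - y)"
    have "continuous_on X ?f" by (intro continuous_intros loss_continuous)
    then have "?f y \<le> 0" if "y \<in> X" for y
      using continuous_le_on_dense[OF X_closed Q(2,3), of ?f 0 y] * that by simp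
    then show "\<forall>y\<in>X. ?q \<bullet> Fvec F ?i (x t \<omega>) - ?q \<bullet> Fvec F ?i y \<le> gbar t \<omega> \<bullet> (x t \<omega> - y)" by simp
  qed
qed

text \<open>
Here \<open>L = Cg * Mb i * n / \<delta>\<close> bounds the bandit gradient, as all components of \<open>p t i\<close> are at least
\<open>\<delta> / n\<close>, and \<open>D = 4 * \<rho> / n\<^sup>2\<close> is half the square of the bound in
\<open>ambiguity_set_diameter\<close>.
\<close>

lemma adversary_linearized_gap:
  "\<exists>E\<in>sets M. 1 - exp (- \<Omega>) \<le> prob E \<and>
     (\<forall>\<omega>\<in>E. \<forall>q\<in>P. (\<Sum>t=1..T. theta T t * (- Fvec F i (x t \<omega>) \<bullet> (p t \<omega> i - q)))
        \<le> 3 * sqrt \<Omega> * (2 * Cg * Mb i * ln (real T) * sqrt (2 * \<rho>) / (\<delta> * sqrt (real T))))"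
proof -
  let ?n = "real CARD('n)"
  define L where "L = Cg * Mb i * ?n / \<delta>"
  define D where "D = 4 * \<rho> / ?n\<^sup>2"
  have n: "1 \<le> ?n" by (simp add: Suc_leI)
  have L: "0 < L" unfolding L_def using Cg_ge_1 Mb[of i] \<delta> n by simp
  have D: "0 < D" unfolding D_def using \<rho> n by simp
  have step_size: "1 / L * sqrt (D / \<Omega>) / sqrt (real t)
      = 2 * \<delta> / (Cg * Mb i * ?n\<^sup>2) * sqrt (\<rho> / \<Omega>) / sqrt (real t)" for t
  proof -
    have "sqrt (D / \<Omega>) = 2 / ?n * sqrt (\<rho> / \<Omega>)"
      unfolding D_def using n by (simp add: real_sqrt_divide real_sqrt_mult)
    then show ?thesis unfolding L_def by (simp add: power2_eq_square mult_ac)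
  qed
  have bandit_norm: "norm (bandit_grad F (x t \<omega>) (p t \<omega>) i (Ip t \<omega> i)) \<le> L"
    if "t \<in> {1..T}" "\<omega> \<in> space M" for t \<omega>
  proof -
    let ?I = "Ip t \<omega> i"
    have "bandit_grad F (x t \<omega>) (p t \<omega>) i ?I = axis ?I (total_mass (p t \<omega> i) * F i ?I (x t \<omega>) / p t \<omega> i $ ?I)"
      by (auto simp: bandit_grad_def axis_def vec_eq_iff)
    then show ?thesis using bandit_weight_bound[OF that, of i ?I] by (simp add: norm_eq_sqrt_inner inner_axis_axis L_def flip: power2_eq_square)
  qed
  have Fvec_norm: "norm (Fvec F i y) \<le> L" if "y \<in> X" for y
  proof -
    have "norm (Fvec F i y) \<le> (\<Sum>r\<in>UNIV. \<bar>F i r y\<bar>)"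
      using norm_le_l1_cart[of "Fvec F i y"] by (simp add: Fvec_def)
    also have "\<dots> \<le> ?n * Mb i" using sum_bounded_above[of UNIV "\<lambda>r. \<bar>F i r y\<bar>" "Mb i"] F_bound[OF that] by simp
    also have "\<dots> \<le> L"
    proof -
      have "1 * (?n * Mb i) \<le> Cg / \<delta> * (?n * Mb i)"
        using Cg_ge_1 \<delta> Mb[of i] by (intro mult_right_mono) (auto simp: pos_le_divide_eq)
      then show ?thesis by (simp add: L_def mult_ac)
    qed
    finally show ?thesis .
  qed
  interpret run: stochastic_mirror_descent P norm "\<lambda>y. (y \<bullet> y) / 2" "\<lambda>y. y" D M T H H L \<Omega>
    "\<lambda>t \<omega>. p t \<omega> i" "\<lambda>t \<omega>. - bandit_grad F (x t \<omega>) (p t \<omega>) i (Ip t \<omega> i)" "\<lambda>t \<omega>. - Fvec F i (x t \<omega>)"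
  proof unfold_locales
    show "((\<lambda>y. (y \<bullet> y) / 2) has_derivative (\<bullet>) y) (at y within P)" for y :: "real^'n"
      by (rule has_derivative_half_square)
    show "bregman (\<lambda>y. (y \<bullet> y) / 2) (\<lambda>y. y) y z \<le> D" if "y \<in> P" "z \<in> P" for y z
    proof -
      have "(norm (y - z))\<^sup>2 \<le> (2 * sqrt (2 * \<rho>) / ?n)\<^sup>2"
        using ambiguity_set_diameter[of \<rho> y \<delta> z] that \<rho> by (intro power_mono) (auto simp: P_eq)
      then show ?thesis using \<rho> by (simp add: bregman_half_square D_def power_divide power_mult_distrib)
    qed
    show "history_chain M T H H"
      using links unfolding history_chain_def by (auto simp: subalgebra_def)
    fix t :: nat assume t: "t \<in> {1..T}"
    show FH: "(\<lambda>\<omega>. - Fvec F i (x t \<omega>)) \<in> borel_measurable (H t)"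
      unfolding Fvec_def
      by (intro borel_measurable_uminus borel_measurable_vec_lambda F_iterate_measurable t)
    have IpH: "(\<lambda>\<omega>. Ip t \<omega> i) \<in> measurable (H (Suc t)) (count_space UNIV)"
      using fresh[OF t] measurable_from_subalg[OF links(2)[OF t]] unfolding samples_fresh_def by blast
    have "(\<lambda>\<omega>. if r = Ip t \<omega> i then total_mass (p t \<omega> i) * F i r (x t \<omega>) / p t \<omega> i $ r else 0)
        \<in> borel_measurable (H (Suc t))" for r
    proof (rule measurable_If)
      show "(\<lambda>\<omega>. total_mass (p t \<omega> i) * F i r (x t \<omega>) / p t \<omega> i $ r) \<in> borel_measurable (H (Suc t))"
        by (rule measurable_from_subalg[OF links(5)[OF t]])
           (intro borel_measurable_divide borel_measurable_times borel_measurable_vec_nth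
            total_mass_iterate_measurable F_iterate_measurable iterates_measurable(2) t)
      show "{\<omega> \<in> space (H (Suc t)). r = Ip t \<omega> i} \<in> sets (H (Suc t))" using IpH by measurable
    qed simp
    then show "(\<lambda>\<omega>. - bandit_grad F (x t \<omega>) (p t \<omega>) i (Ip t \<omega> i)) \<in> borel_measurable (H (Suc t))"
      unfolding bandit_grad_def by (intro borel_measurable_uminus borel_measurable_vec_lambda)
    show "AE \<omega> in M. dual_norm_le norm (- Fvec F i (x t \<omega>)) L"
      using Fvec_norm iterates_in(1)[OF t] by (intro AE_I2 dual_norm_le_norm) simp
    show "AE \<omega> in M. real_cond_exp M (H t) (\<lambda>\<omega>. - bandit_grad F (x t \<omega>) (p t \<omega>) i (Ip t \<omega> i) \<bullet> b) \<omega>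
        = - Fvec F i (x t \<omega>) \<bullet> b" if "b \<in> Basis" for b
      by (rule bandit_grad_unbiased[OF t that])
    show "dual_norm_le norm (- bandit_grad F (x t \<omega>) (p t \<omega>) i (Ip t \<omega> i)) L" if "\<omega> \<in> space M" for \<omega>
      using bandit_norm[OF t that] by (intro dual_norm_le_norm) simp
    show "is_arg_min (\<lambda>y. - bandit_grad F (x t \<omega>) (p t \<omega>) i (Ip t \<omega> i) \<bullet> (y - p t \<omega> i)
          + 1 / (1 / L * sqrt (D / \<Omega>) / sqrt (real t)) * bregman (\<lambda>y. (y \<bullet> y) / 2) (\<lambda>y. y) y (p t \<omega> i))
        (\<lambda>y. y \<in> P) (p (Suc t) \<omega> i)" if \<omega>: "\<omega> \<in> space M" for \<omega>
    proof -
      have "0 < 1 / L * sqrt (D / \<Omega>) / sqrt (real t)" using t L D \<Omega> by simp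
      from closest_point_is_mirror_step[OF closed_P P_nonempty this] show ?thesis
        using bandit[OF t \<omega>] by (simp only: bandit_MD_update_def step_size)
    qed
  qed (fact closed_P convex_P P_nonempty is_norm_norm strongly_convex_half_square T L \<Omega>
        | erule (1) iterates_in(2) | erule iterates_measurable(2))+
  have "L * ln (real T) * sqrt (2 * D) / sqrt (real T)
      = 2 * Cg * Mb i * ln (real T) * sqrt (2 * \<rho>) / (\<delta> * sqrt (real T))"
  proof -
    have "2 * D = (2 * sqrt (2 * \<rho>) / ?n)\<^sup>2"
      using \<rho> by (simp add: D_def power_divide power_mult_distrib)
    then have "sqrt (2 * D) = 2 * sqrt (2 * \<rho>) / ?n"
      using \<rho> by (simp only: real_sqrt_abs) simp
    then show ?thesis unfolding L_def by simp
  qed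
  with run.linearized_gap_high_probability show ?thesis by simp
qed

lemma decision_linearized_gap:
  "\<exists>E\<in>sets M. 1 - exp (- \<Omega>) \<le> prob E \<and>
     (\<forall>\<omega>\<in>E. \<forall>y\<in>X. (\<Sum>t=1..T. theta T t * (gbar t \<omega> \<bullet> (x t \<omega> - y)))
        \<le> 3 * sqrt \<Omega> * (Cg * G * ln (real T) * sqrt (2 * Dx) / sqrt (real T)))"
proof -
  interpret run: stochastic_mirror_descent X N \<psi> grad Dx M T H H' "Cg * G" \<Omega> x g gbar
  proof unfold_locales
    fix t :: nat assume t: "t \<in> {1..T}"
    interpret fin: finite_measure_subalgebra M "H' t" using links(4)[OF t] by unfold_locales
    obtain c where c: "\<And>\<omega>. \<omega> \<in> space M \<Longrightarrow> norm (g t \<omega>) \<le> c" using g_norm_bounded t by blast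
    show "gbar t \<in> borel_measurable (H' t)" unfolding gbar_def by (rule vec_cond_exp_measurable)
    show "AE \<omega> in M. dual_norm_le N (gbar t \<omega>) (Cg * G)"
      unfolding gbar_def
      by (rule fin.dual_norm_le_vec_cond_exp[OF N g_measurable[OF t] c g_dual_norm[OF t]])
    show "AE \<omega> in M. real_cond_exp M (H' t) (\<lambda>\<omega>. g t \<omega> \<bullet> b) \<omega> = gbar t \<omega> \<bullet> b" if "b \<in> Basis" for b
      using that by (simp add: gbar_def vec_cond_exp_Basis)
    show "is_arg_min (\<lambda>y. g t \<omega> \<bullet> (y - x t \<omega>)
                    + 1 / (1 / (Cg * G) * sqrt (Dx / \<Omega>) / sqrt (real t)) * bregman \<psi> grad y (x t \<omega>))
        (\<lambda>y. y \<in> X) (x (Suc t) \<omega>)" if "\<omega> \<in> space M" for \<omega>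
      using smd[OF t that] by (simp add: eps_SMD_update_def)
  qed (use chain T G Cg_ge_1 \<Omega> iterates_in iterates_measurable g_meas g_dual_norm in auto)
  show ?thesis by (rule run.linearized_gap_high_probability)
qed

text \<open>
The maximal index and the estimated one are compared through the estimates at \<open>x t\<close>, at a cost of \<open>\<eta> / 2\<close> each;
at \<open>y\<close> the maximum only helps.
\<close>

lemma eps_bullet_le:
  assumes \<omega>: "\<omega> \<in> space M"
    and approx: "\<And>y i t. y \<in> X \<Longrightarrow> t \<in> {1..T} \<Longrightarrow> \<bar>fhat F K (p t \<omega>) (S t \<omega>) i y - p t \<omega> i \<bullet> Fvec F i y\<bar> \<le> \<eta> / 2"
    and subgrad: "\<And>y t. y \<in> X \<Longrightarrow> t \<in> {1..T} \<Longrightarrow>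
      p t \<omega> (ihat t \<omega>) \<bullet> Fvec F (ihat t \<omega>) (x t \<omega>) - p t \<omega> (ihat t \<omega>) \<bullet> Fvec F (ihat t \<omega>) y \<le> gbar t \<omega> \<bullet> (x t \<omega> - y)"
    and gap: "\<And>y. y \<in> X \<Longrightarrow> (\<Sum>t=1..T. theta T t * (gbar t \<omega> \<bullet> (x t \<omega> - y))) \<le> R"
  shows "eps_bullet X F T (\<lambda>t. x t \<omega>) (\<lambda>t. p t \<omega>) \<le> R + \<eta>"
proof -
  have "(\<Sum>t=1..T. theta T t * phi F (x t \<omega>) (p t \<omega>)) - (R + \<eta>)
      \<le> (INF y\<in>X. \<Sum>t=1..T. theta T t * phi F y (p t \<omega>))"
  proof (rule cINF_greatest[OF X_nonempty])
    fix y assume y: "y \<in> X"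
    have "phi F (x t \<omega>) (p t \<omega>) \<le> phi F y (p t \<omega>) + gbar t \<omega> \<bullet> (x t \<omega> - y) + \<eta>" if t: "t \<in> {1..T}" for t
    proof -
      let ?i = "ihat t \<omega>"
      let ?f = "\<lambda>i y. p t \<omega> i \<bullet> Fvec F i y" and ?h = "\<lambda>i y. fhat F K (p t \<omega>) (S t \<omega>) i y"
      note xX = iterates_in(1)[OF t \<omega>]
      obtain j where j: "phi F (x t \<omega>) (p t \<omega>) = ?f j (x t \<omega>)"
      proof -
        have "phi F (x t \<omega>) (p t \<omega>) \<in> range (\<lambda>i. ?f i (x t \<omega>))"
          unfolding phi_def by (rule Max_in) auto
        then show ?thesis using that by blast
      qed
      have "?f j (x t \<omega>) \<le> ?h j (x t \<omega>) + \<eta> / 2" using approx[OF xX t, of j] by linarith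
      also have "?h j (x t \<omega>) \<le> ?h ?i (x t \<omega>)"
        using smd[OF t \<omega>] by (auto simp: eps_SMD_update_def is_arg_max_def not_less)
      also have "?h ?i (x t \<omega>) \<le> ?f ?i (x t \<omega>) + \<eta> / 2" using approx[OF xX t, of ?i] by linarith
      also have "?f ?i (x t \<omega>) \<le> ?f ?i y + gbar t \<omega> \<bullet> (x t \<omega> - y)" using subgrad[OF y t] by simp
      also have "?f ?i y \<le> phi F y (p t \<omega>)" unfolding phi_def by (intro Max_ge) auto
      finally show ?thesis using j by simp
    qed
    then have "(\<Sum>t=1..T. theta T t * phi F (x t \<omega>) (p t \<omega>))
        \<le> (\<Sum>t=1..T. theta T t * (phi F y (p t \<omega>) + gbar t \<omega> \<bullet> (x t \<omega> - y) + \<eta>))"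
      by (intro sum_mono mult_left_mono theta_nonneg)
    also have "\<dots> = (\<Sum>t=1..T. theta T t * phi F y (p t \<omega>))
        + (\<Sum>t=1..T. theta T t * (gbar t \<omega> \<bullet> (x t \<omega> - y))) + (\<Sum>t=1..T. theta T t) * \<eta>"
      by (simp add: distrib_left sum.distrib sum_distrib_right)
    also have "\<dots> \<le> (\<Sum>t=1..T. theta T t * phi F y (p t \<omega>)) + R + \<eta>"
      using gap[OF y] sum_theta[of T] T by simp
    finally show "(\<Sum>t=1..T. theta T t * phi F (x t \<omega>) (p t \<omega>)) - (R + \<eta>)
        \<le> (\<Sum>t=1..T. theta T t * phi F y (p t \<omega>))" by simp
  qed
  then show ?thesis unfolding eps_bullet_def by simp
qed

lemma eps_i_le:
  assumes gap: "\<And>q. q \<in> P \<Longrightarrow> (\<Sum>t=1..T. theta T t * (- Fvec F i (x t \<omega>) \<bullet> (p t \<omega> i - q))) \<le> R"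
  shows "eps_i P F T (\<lambda>t. x t \<omega>) (\<lambda>t. p t \<omega>) i \<le> R"
proof -
  have "(SUP q\<in>P. \<Sum>t=1..T. theta T t * (q \<bullet> Fvec F i (x t \<omega>)))
      \<le> (\<Sum>t=1..T. theta T t * (p t \<omega> i \<bullet> Fvec F i (x t \<omega>))) + R"
  proof (rule cSUP_least[OF P_nonempty])
    fix q assume "q \<in> P"
    from gap[OF this] show "(\<Sum>t=1..T. theta T t * (q \<bullet> Fvec F i (x t \<omega>)))
        \<le> (\<Sum>t=1..T. theta T t * (p t \<omega> i \<bullet> Fvec F i (x t \<omega>))) + R"
      by (simp add: inner_diff_right right_diff_distrib sum_subtractf inner_commute sum_negf)
  qed
  then show ?thesis unfolding eps_i_def by simp
qed

text \<open>
The continuity behind this comes from the Lipschitz losses, and compactness of \<open>X\<close> from the finite Bregman diameter.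
\<close>

lemma error_measurable:
  "(\<lambda>\<omega>. eps_bullet X F T (\<lambda>t. x t \<omega>) (\<lambda>t. p t \<omega>) + eps_circ P F T (\<lambda>t. x t \<omega>) (\<lambda>t. p t \<omega>))
     \<in> borel_measurable M"
proof -
  have pM: "(\<lambda>\<omega>. p t \<omega> i) \<in> borel_measurable M" if "t \<in> {1..T}" for t i
    using measurable_from_subalg[OF links(6)[OF that] iterates_measurable(2)[OF that]] .
  have FM: "(\<lambda>\<omega>. Fvec F i (x t \<omega>)) \<in> borel_measurable M" if "t \<in> {1..T}" for t i
    unfolding Fvec_def
    by (intro borel_measurable_vec_lambda measurable_from_subalg[OF links(6)[OF that] F_iterate_measurable[OF that]])
  have compact_P: "compact P"
    using closed_P \<rho> unfolding P_eq
    by (auto simp: compact_eq_bounded_closed ambiguity_set_eq intro: bounded_subset[OF bounded_cball])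
  have phi_M: "(\<lambda>\<omega>. phi F (x t \<omega>) (p t \<omega>)) \<in> borel_measurable M" if "t \<in> {1..T}" for t
    unfolding phi_def using pM[OF that] FM[OF that] by (intro borel_measurable_Max borel_measurable_inner) auto
  have phi_yM: "(\<lambda>\<omega>. phi F y (p t \<omega>)) \<in> borel_measurable M" if "t \<in> {1..T}" for t y
    unfolding phi_def using pM[OF that] by (intro borel_measurable_Max borel_measurable_inner) auto
  have 1: "(\<lambda>\<omega>. INF y\<in>X. \<Sum>t=1..T. theta T t * phi F y (p t \<omega>)) \<in> borel_measurable M"
  proof (rule borel_measurable_INF_compact[OF decision.compact_X X_nonempty])
    show "continuous_on X (\<lambda>y. \<Sum>t=1..T. theta T t * phi F y (p t \<omega>))" for \<omega>
      unfolding phi_def by (intro continuous_intros continuous_on_Max loss_continuous) auto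
  qed (auto intro!: borel_measurable_sum borel_measurable_times phi_yM)
  have 2: "(\<lambda>\<omega>. SUP q\<in>P. \<Sum>t=1..T. theta T t * (q \<bullet> Fvec F i (x t \<omega>))) \<in> borel_measurable M" for i
  proof (rule borel_measurable_SUP_compact[OF compact_P P_nonempty])
    show "continuous_on P (\<lambda>q. \<Sum>t=1..T. theta T t * (q \<bullet> Fvec F i (x t \<omega>)))" for \<omega>
      by (intro continuous_intros)
  qed (intro borel_measurable_sum borel_measurable_times borel_measurable_inner borel_measurable_const FM)
  have 3: "(\<lambda>\<omega>. eps_i P F T (\<lambda>t. x t \<omega>) (\<lambda>t. p t \<omega>) i) \<in> borel_measurable M" for i
    unfolding eps_i_def
    by (intro borel_measurable_diff 2 borel_measurable_sum borel_measurable_times borel_measurable_inner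
        borel_measurable_const FM pM)
  show ?thesis
    unfolding eps_bullet_def eps_circ_def
    by (intro borel_measurable_add borel_measurable_diff 1 borel_measurable_sum borel_measurable_times
        borel_measurable_const phi_M borel_measurable_Max 3) auto
qed

theorem error_high_probability:
  fixes Rp :: "'m \<Rightarrow> real"
  assumes approx: "1 - \<nu> \<le> prob {\<omega> \<in> space M. \<forall>y\<in>X. \<forall>i. \<forall>t\<in>{1..T}.
           \<bar>fhat F K (p t \<omega>) (S t \<omega>) i y - p t \<omega> i \<bullet> Fvec F i y\<bar> \<le> \<eta> / 2}"
    and "\<nu> < 1"
    and Rx: "Rx = Cg * G * ln (real T) * sqrt (2 * Dx) / sqrt (real T)"
    and Rp: "\<And>i. Rp i = 2 * Cg * Mb i * ln (real T) * sqrt (2 * \<rho>) / (\<delta> * sqrt (real T))"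
  shows "1 - (real CARD('m) + 1) * exp (- \<Omega>) - \<nu> \<le> prob {\<omega> \<in> space M.
           eps_bullet X F T (\<lambda>t. x t \<omega>) (\<lambda>t. p t \<omega>) + eps_circ P F T (\<lambda>t. x t \<omega>) (\<lambda>t. p t \<omega>)
             \<le> 3 * sqrt \<Omega> * (Rx + (MAX i. Rp i)) + \<eta>}"
proof -
  define E0 where "E0 = {\<omega> \<in> space M. \<forall>y\<in>X. \<forall>i. \<forall>t\<in>{1..T}.
           \<bar>fhat F K (p t \<omega>) (S t \<omega>) i y - p t \<omega> i \<bullet> Fvec F i y\<bar> \<le> \<eta> / 2}"
  \<comment> \<open>Non-measurable sets have measure 0, so the positive lower bound makes \<open>E0\<close> measurable.\<close>
  have E0: "E0 \<in> events" "1 - \<nu> \<le> prob E0"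
    using approx \<open>\<nu> < 1\<close> measure_notin_sets[of E0 M] unfolding E0_def by auto
  obtain Ex where Ex: "Ex \<in> events" "1 - exp (- \<Omega>) \<le> prob Ex"
    "\<And>\<omega> y. \<omega> \<in> Ex \<Longrightarrow> y \<in> X \<Longrightarrow>
       (\<Sum>t=1..T. theta T t * (gbar t \<omega> \<bullet> (x t \<omega> - y))) \<le> 3 * sqrt \<Omega> * Rx"
    using decision_linearized_gap unfolding Rx by blast
  define good where "good i E \<longleftrightarrow> E \<in> events \<and> 1 - exp (- \<Omega>) \<le> prob E \<and> (\<forall>\<omega>\<in>E. \<forall>q\<in>P.
      (\<Sum>t=1..T. theta T t * (- Fvec F i (x t \<omega>) \<bullet> (p t \<omega> i - q))) \<le> 3 * sqrt \<Omega> * Rp i)" for i E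
  have "\<exists>E. good i E" for i
    using adversary_linearized_gap[of i] unfolding good_def Rp by blast
  then obtain Ep where "\<And>i. good i (Ep i)" by metis
  then have Ep: "\<And>i. Ep i \<in> events" "\<And>i. 1 - exp (- \<Omega>) \<le> prob (Ep i)"
    "\<And>i \<omega> q. \<omega> \<in> Ep i \<Longrightarrow> q \<in> P \<Longrightarrow>
       (\<Sum>t=1..T. theta T t * (- Fvec F i (x t \<omega>) \<bullet> (p t \<omega> i - q))) \<le> 3 * sqrt \<Omega> * Rp i"
    unfolding good_def by blast+
  define subgrad where "subgrad \<omega> \<longleftrightarrow> (\<forall>t\<in>{1..T}. \<forall>y\<in>X. p t \<omega> (ihat t \<omega>) \<bullet> Fvec F (ihat t \<omega>) (x t \<omega>)
      - p t \<omega> (ihat t \<omega>) \<bullet> Fvec F (ihat t \<omega>) y \<le> gbar t \<omega> \<bullet> (x t \<omega> - y))" for \<omega>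
  have "AE \<omega> in M. subgrad \<omega>"
    unfolding subgrad_def using gbar_subgradient by (rule AE_finite_allI[OF finite_atLeastAtMost])
  then obtain Z where Z: "\<And>\<omega>. \<omega> \<in> space M - Z \<Longrightarrow> subgrad \<omega>" "Z \<in> null_sets M"
    by (rule AE_E3) blast
  define Eall where "Eall = space M \<inter> (\<Inter>i. Ep i)"
  have Eall: "Eall \<in> events" "1 - real CARD('m) * exp (- \<Omega>) \<le> prob Eall"
    using prob_INT_ge[of UNIV Ep "exp (- \<Omega>)"] Ep(1,2) unfolding Eall_def by auto
  define E where "E = (E0 \<inter> Ex) \<inter> Eall"
  have E: "E \<in> events" unfolding E_def using E0 Ex Eall by auto
  have "1 - (\<nu> + exp (- \<Omega>) + real CARD('m) * exp (- \<Omega>)) \<le> prob E"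
    unfolding E_def using E0 Ex Eall by (intro prob_Int_ge) auto
  then have "1 - (real CARD('m) + 1) * exp (- \<Omega>) - \<nu> \<le> prob (E - Z)"
    using measure_Diff_null_set[OF E Z(2)] by (simp add: algebra_simps)
  also have "prob (E - Z) \<le> prob {\<omega> \<in> space M.
           eps_bullet X F T (\<lambda>t. x t \<omega>) (\<lambda>t. p t \<omega>) + eps_circ P F T (\<lambda>t. x t \<omega>) (\<lambda>t. p t \<omega>)
             \<le> 3 * sqrt \<Omega> * (Rx + (MAX i. Rp i)) + \<eta>}"
  proof (rule finite_measure_mono)
    show "{\<omega> \<in> space M.
           eps_bullet X F T (\<lambda>t. x t \<omega>) (\<lambda>t. p t \<omega>) + eps_circ P F T (\<lambda>t. x t \<omega>) (\<lambda>t. p t \<omega>)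
             \<le> 3 * sqrt \<Omega> * (Rx + (MAX i. Rp i)) + \<eta>} \<in> events"
      using error_measurable by measurable
    show "E - Z \<subseteq> {\<omega> \<in> space M.
           eps_bullet X F T (\<lambda>t. x t \<omega>) (\<lambda>t. p t \<omega>) + eps_circ P F T (\<lambda>t. x t \<omega>) (\<lambda>t. p t \<omega>)
             \<le> 3 * sqrt \<Omega> * (Rx + (MAX i. Rp i)) + \<eta>}"
    proof
      fix \<omega> assume \<omega>E: "\<omega> \<in> E - Z"
      then have \<omega>: "\<omega> \<in> space M" and "\<omega> \<in> E0" "\<omega> \<in> Ex" "\<And>i. \<omega> \<in> Ep i" "\<omega> \<notin> Z"
        by (auto simp: E_def Eall_def)
      have "eps_bullet X F T (\<lambda>t. x t \<omega>) (\<lambda>t. p t \<omega>) \<le> 3 * sqrt \<Omega> * Rx + \<eta>"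
      proof (rule eps_bullet_le[OF \<omega> _ _ Ex(3)[OF \<open>\<omega> \<in> Ex\<close>]])
        fix y t assume "y \<in> X" "t \<in> {1..T}"
        then show "\<bar>fhat F K (p t \<omega>) (S t \<omega>) i y - p t \<omega> i \<bullet> Fvec F i y\<bar> \<le> \<eta> / 2" for i
          using \<open>\<omega> \<in> E0\<close> unfolding E0_def by blast
        show "p t \<omega> (ihat t \<omega>) \<bullet> Fvec F (ihat t \<omega>) (x t \<omega>) - p t \<omega> (ihat t \<omega>) \<bullet> Fvec F (ihat t \<omega>) y
            \<le> gbar t \<omega> \<bullet> (x t \<omega> - y)"
          using Z(1)[of \<omega>] \<omega> \<open>\<omega> \<notin> Z\<close> \<open>y \<in> X\<close> \<open>t \<in> {1..T}\<close> unfolding subgrad_def by blast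
      qed
      moreover have "eps_circ P F T (\<lambda>t. x t \<omega>) (\<lambda>t. p t \<omega>) \<le> 3 * sqrt \<Omega> * (MAX i. Rp i)"
      proof -
        have "eps_i P F T (\<lambda>t. x t \<omega>) (\<lambda>t. p t \<omega>) i \<le> 3 * sqrt \<Omega> * (MAX i. Rp i)" for i
        proof -
          have "eps_i P F T (\<lambda>t. x t \<omega>) (\<lambda>t. p t \<omega>) i \<le> 3 * sqrt \<Omega> * Rp i"
            using Ep(3)[OF \<open>\<And>i. \<omega> \<in> Ep i\<close>] by (rule eps_i_le)
          also have "\<dots> \<le> 3 * sqrt \<Omega> * (MAX i. Rp i)"
            using \<Omega> by (intro mult_left_mono Max_ge) auto
          finally show ?thesis .
        qed
        then show ?thesis unfolding eps_circ_def by (subst Max_le_iff) auto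
      qed
      ultimately show "\<omega> \<in> {\<omega> \<in> space M.
           eps_bullet X F T (\<lambda>t. x t \<omega>) (\<lambda>t. p t \<omega>) + eps_circ P F T (\<lambda>t. x t \<omega>) (\<lambda>t. p t \<omega>)
             \<le> 3 * sqrt \<Omega> * (Rx + (MAX i. Rp i)) + \<eta>}"
        using \<omega> by (simp add: distrib_left)
    qed
  qed
  finally show ?thesis .
qed

end

text \<open>
The \<open>m + 1\<close> in the general bound is one failure for the decision player and one for each of the \<open>m\<close>
adversaries.
\<close>

theorem theorem5:
  fixes M :: "'w measure"
    and X :: "(real^'d::finite) set"
    and N :: "real^'d \<Rightarrow> real"
    and F :: "'m::finite \<Rightarrow> 'n::finite \<Rightarrow> real^'d \<Rightarrow> real"
    and G :: real and Mb :: "'m \<Rightarrow> real"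
    and \<psi> :: "real^'d \<Rightarrow> real" and grad\<psi> :: "real^'d \<Rightarrow> real^'d"
    and \<epsilon> \<rho> \<delta> \<Omega> C\<^sub>g C\<^sub>K \<nu>\<^sub>1 D\<^sub>x c\<^sub>x R\<^sub>x :: real
    and c\<^sub>p R\<^sub>p :: "'m \<Rightarrow> real"
    and P :: "(real^'n) set"
    and T K :: nat
    and H H' :: "nat \<Rightarrow> 'w measure"
    and x g :: "nat \<Rightarrow> 'w \<Rightarrow> real^'d"
    and p :: "nat \<Rightarrow> 'w \<Rightarrow> 'm \<Rightarrow> real^'n"
    and S :: "nat \<Rightarrow> 'w \<Rightarrow> 'm \<Rightarrow> nat \<Rightarrow> 'n"
    and Ip :: "nat \<Rightarrow> 'w \<Rightarrow> 'm \<Rightarrow> 'n"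
    and ihat :: "nat \<Rightarrow> 'w \<Rightarrow> 'm"
    and Ix :: "nat \<Rightarrow> 'w \<Rightarrow> 'n"
  assumes "prob_space M"
    and "closed X" and "convex X"
    and "is_norm N"
    and "G > 0" and "\<And>i. Mb i > 0"
    and "\<And>i r. convex_on X (F i r)"
    and "\<And>i r. lipschitz_wrt N G X (F i r)"
    and "\<And>i r y. y \<in> X \<Longrightarrow> \<bar>F i r y\<bar> \<le> Mb i"
    and "\<And>y. y \<in> X \<Longrightarrow> (\<psi> has_derivative (\<lambda>h. grad\<psi> y \<bullet> h)) (at y within X)"
    and "strongly_convex_wrt N 1 X \<psi>"
    and "bdd_above ((\<lambda>(y, z). bregman \<psi> grad\<psi> y z) ` (X \<times> X))"
    and "D\<^sub>x = (SUP (y, z)\<in>X \<times> X. bregman \<psi> grad\<psi> y z)"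
    and "\<epsilon> > 0" and "0 < \<rho>" and "\<rho> < 1" and "0 < \<delta>" and "\<delta> < 1" and "\<Omega> \<ge> 1"
    and "T \<ge> 2" and "K \<ge> 1"
    and "P = ambiguity_set \<delta> \<rho>"
    and "C\<^sub>g = 1 + sqrt (2 * \<rho> / real CARD('n))"
    and "c\<^sub>x = 1 / (C\<^sub>g * G) * sqrt (D\<^sub>x / \<Omega>)"
    and "\<And>i. c\<^sub>p i = 2 * \<delta> / (C\<^sub>g * Mb i * (real CARD('n))\<^sup>2) * sqrt (\<rho> / \<Omega>)"
    and "history_chain M T H H'"
    and "starts_in M (H 1) X P (x 1) (p 1)"
    and "\<And>t. t \<in> {1..T} \<Longrightarrow>
           samples_fresh M K (H t) (H' t) (H (Suc t)) (p t) (S t) (Ip t) (ihat t) (Ix t)"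
    and "\<And>t. t \<in> {1..T} \<Longrightarrow> g t \<in> borel_measurable (H (Suc t))"
    and "\<And>t. t \<in> {1..T} \<Longrightarrow> x (Suc t) \<in> borel_measurable (H (Suc t))"
    and "\<And>t i. t \<in> {1..T} \<Longrightarrow> (\<lambda>\<omega>. p (Suc t) \<omega> i) \<in> borel_measurable (H (Suc t))"
    and "\<And>t \<omega>. t \<in> {1..T} \<Longrightarrow> \<omega> \<in> space M \<Longrightarrow>
           eps_SMD_update X N G F \<psi> grad\<psi> K (c\<^sub>x / sqrt (real t))
             (x t \<omega>) (p t \<omega>) (S t \<omega>) (ihat t \<omega>) (Ix t \<omega>) (g t \<omega>) (x (Suc t) \<omega>)"
    and "\<And>t \<omega>. t \<in> {1..T} \<Longrightarrow> \<omega> \<in> space M \<Longrightarrow>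
           bandit_MD_update P F (\<lambda>i. c\<^sub>p i / sqrt (real t))
             (x t \<omega>) (p t \<omega>) (Ip t \<omega>) (p (Suc t) \<omega>)"
    and "0 < C\<^sub>K" and "C\<^sub>K < 1/2" and "0 < \<nu>\<^sub>1" and "\<nu>\<^sub>1 < 1"
    and "measure M {\<omega> \<in> space M. \<forall>y\<in>X. \<forall>i. \<forall>t\<in>{1..T}.
           \<bar>fhat F K (p t \<omega>) (S t \<omega>) i y - p t \<omega> i \<bullet> Fvec F i y\<bar> \<le> C\<^sub>K * \<epsilon> / 2} \<ge> 1 - \<nu>\<^sub>1"
    and "R\<^sub>x = C\<^sub>g * G * ln (real T) * sqrt (2 * D\<^sub>x) / sqrt (real T)"
    and "\<And>i. R\<^sub>p i = 2 * C\<^sub>g * Mb i * ln (real T) * sqrt (2 * \<rho>) / (\<delta> * sqrt (real T))"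
  shows "measure M {\<omega> \<in> space M.
           eps_bullet X F T (\<lambda>t. x t \<omega>) (\<lambda>t. p t \<omega>) + eps_circ P F T (\<lambda>t. x t \<omega>) (\<lambda>t. p t \<omega>)
             \<le> 3 * sqrt \<Omega> * (R\<^sub>x + (MAX i. R\<^sub>p i)) + C\<^sub>K * \<epsilon>}
         \<ge> 1 - 4 * real CARD('m) * exp (- \<Omega>) - \<nu>\<^sub>1"
proof -
  interpret prob_space M by (rule assms(1))
  have bregman_le: "bregman \<psi> grad\<psi> y z \<le> D\<^sub>x" if "y \<in> X" "z \<in> X" for y z
    using cSUP_upper[OF _ assms(12), of "(y, z)"] that unfolding assms(13) by simp
  interpret robust_scheme M X N F G Mb \<psi> grad\<psi> \<rho> \<delta> \<Omega> C\<^sub>g D\<^sub>x P T K H H' x g p S Ip ihat Ix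
    by (unfold_locales;
        fact assms(2-6,8-11) assms(15,17-20,22,23,26-31) bregman_le
          assms(32)[unfolded assms(24)] assms(33)[unfolded assms(25)])
  have "1 - (real CARD('m) + 1) * exp (- \<Omega>) - \<nu>\<^sub>1 \<le> measure M {\<omega> \<in> space M.
           eps_bullet X F T (\<lambda>t. x t \<omega>) (\<lambda>t. p t \<omega>) + eps_circ P F T (\<lambda>t. x t \<omega>) (\<lambda>t. p t \<omega>)
             \<le> 3 * sqrt \<Omega> * (R\<^sub>x + (MAX i. R\<^sub>p i)) + C\<^sub>K * \<epsilon>}"
    by (rule error_high_probability[OF assms(38,37,39,40)])
  moreover have "(real CARD('m) + 1) * exp (- \<Omega>) \<le> 4 * real CARD('m) * exp (- \<Omega>)"
  proof (rule mult_right_mono)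
    have "1 \<le> real CARD('m)" by (simp add: Suc_leI)
    then show "real CARD('m) + 1 \<le> 4 * real CARD('m)" by linarith
  qed simp
  ultimately show ?thesis by linarith
qed

end
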